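(* Let $D>2$ be an integer, let $\gamma = 2D/(D-2)$, let $\lambda<0$ be a real constant, and let $V(\phi)=\lambda|\phi|^{\gamma}$ for $\phi\in\mathbb{R}$. Consider the equation $$\nabla^2\phi - V'(\phi)=0 \quad\text{on } \mathbb{R}^D, \qquad (\ast)$$ where $\nabla^2$ is the Laplacian on $D$-dimensional Euclidean space, and the Euclidean action $$S[\phi]=\int_{\mathbb{R}^D} d^Dx\left[\tfrac12(\partial\phi)^2+V(\phi)\right].$$ Then $(\ast)$ has at least one monotone spherical solution $\bar\phi$ of finite action vanishing at infinity, other than the trivial solution $\phi=0$, such that: (1) $S[\bar\phi]\le S[\phi]$ for every non-trivial solution $\phi$ of $(\ast)$ of finite action vanishing at infinity; (2) if such a solution $\phi$ is not both spherical and monotone, then $S[\bar\phi]<S[\phi]$.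
   Context: Solutions are real-valued classical ($C^2$) solutions on all of $\mathbb{R}^D$; here $V'(\phi)=\lambda\gamma|\phi|^{\gamma-2}\phi$ and $(\partial\phi)^2=|\nabla\phi|^2$. "Vanishing at infinity" means $\phi(x)\to0$ as $|x|\to\infty$. "Finite action" means that both $\int_{\mathbb{R}^D}\frac12(\partial\phi)^2\,d^Dx$ and $\int_{\mathbb{R}^D}V(\phi)\,d^Dx$ are finite. "Spherical" means spherically symmetric about some point $x_0\in\mathbb{R}^D$, i.e. $\phi(x)$ depends only on $|x-x_0|$. A spherical function is "monotone" if it is a monotone function of the radius $|x-x_0|$. *)

theory Defs
  imports "HOL-Analysis.Analysis"
begin

definition partial :: "'a::euclidean_space \<Rightarrow> ('a \<Rightarrow> real) \<Rightarrow> 'a \<Rightarrow> real" where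
  "partial b f x = frechet_derivative f (at x) b"

definition grad :: "('a::euclidean_space \<Rightarrow> real) \<Rightarrow> 'a \<Rightarrow> 'a" where
  "grad f x = (\<Sum>b\<in>Basis. partial b f x *\<^sub>R b)"

definition laplacian :: "('a::euclidean_space \<Rightarrow> real) \<Rightarrow> 'a \<Rightarrow> real" where
  "laplacian f x = (\<Sum>b\<in>Basis. partial b (partial b f) x)"

(* frechet_derivative is unspecified where f is not differentiable, so the
   differentiability of f and of its first partial derivatives is required explicitly. *)
definition C2 :: "('a::euclidean_space \<Rightarrow> real) \<Rightarrow> bool" where
  "C2 f \<longleftrightarrow>
     (\<forall>x. f differentiable (at x)) \<and>
     (\<forall>b\<in>Basis. \<forall>x. partial b f differentiable (at x)) \<and>
     (\<forall>b\<in>Basis. \<forall>c\<in>Basis. continuous_on UNIV (partial c (partial b f)))"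

lemma grad_eq_gderiv:
  assumes "GDERIV f x :> d"
  shows "grad f x = d"
proof -
  have "frechet_derivative f (at x) = (\<lambda>h. h \<bullet> d)"
    using assms unfolding gderiv_def by (rule frechet_derivative_at[symmetric])
  then show ?thesis
    using euclidean_representation[of d] by (simp add: grad_def partial_def inner_commute)
qed

definition potential :: "real \<Rightarrow> real \<Rightarrow> real \<Rightarrow> real" where
  "potential lam gam t = lam * \<bar>t\<bar> powr gam"

definition potential_deriv :: "real \<Rightarrow> real \<Rightarrow> real \<Rightarrow> real" where
  "potential_deriv lam gam t = lam * gam * \<bar>t\<bar> powr (gam - 2) * t"

lemma potential_has_real_derivative:
  assumes "gam > 1"
  shows "(potential lam gam has_real_derivative potential_deriv lam gam t) (at t)"
proof (cases "t = 0")
  case True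
  have "((\<lambda>h::real. \<bar>h\<bar> powr (gam - 1)) \<longlongrightarrow> 0) (at 0)"
    using assms by (auto intro!: tendsto_eq_intros)
  then have "((\<lambda>h::real. \<bar>\<bar>h\<bar> powr gam / h\<bar>) \<longlongrightarrow> 0) (at 0)"
    by (rule Lim_transform_eventually)
       (auto simp: eventually_at_filter powr_diff intro!: always_eventually)
  then have "((\<lambda>h::real. \<bar>h\<bar> powr gam / h) \<longlongrightarrow> 0) (at 0)"
    by (simp only: tendsto_rabs_zero_iff)
  from tendsto_mult_right_zero[OF this, of lam] show ?thesis
    using True by (simp add: DERIV_def potential_def potential_deriv_def)
next
  case False
  show ?thesis
  proof (cases "t > 0")
    case True
    have "((\<lambda>s. lam * s powr gam) has_real_derivative potential_deriv lam gam t) (at t)"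
      using True
      by (auto intro!: derivative_eq_intros simp: potential_deriv_def powr_diff power2_eq_square)
    then show ?thesis
      by (rule has_field_derivative_transform_within_open[where S = "{0<..}"])
         (use True in \<open>auto simp: potential_def\<close>)
  next
    case neg: False
    have "((\<lambda>s. lam * (- s) powr gam) has_real_derivative potential_deriv lam gam t) (at t)"
      using neg False
      by (auto intro!: derivative_eq_intros simp: potential_deriv_def powr_diff power2_eq_square)
    then show ?thesis
      by (rule has_field_derivative_transform_within_open[where S = "{..<0}"])
         (use neg False in \<open>auto simp: potential_def\<close>)
  qed
qed

definition is_solution :: "real \<Rightarrow> real \<Rightarrow> ('a::euclidean_space \<Rightarrow> real) \<Rightarrow> bool" where
  "is_solution lam gam \<phi> \<longleftrightarrow>
     C2 \<phi> \<and> (\<forall>x. laplacian \<phi> x - potential_deriv lam gam (\<phi> x) = 0)"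

definition finite_action :: "real \<Rightarrow> real \<Rightarrow> ('a::euclidean_space \<Rightarrow> real) \<Rightarrow> bool" where
  "finite_action lam gam \<phi> \<longleftrightarrow>
     integrable lborel (\<lambda>x. 1/2 * (norm (grad \<phi> x))\<^sup>2) \<and>
     integrable lborel (\<lambda>x. potential lam gam (\<phi> x))"

definition action :: "real \<Rightarrow> real \<Rightarrow> ('a::euclidean_space \<Rightarrow> real) \<Rightarrow> real" where
  "action lam gam \<phi> =
     (LINT x|lborel. 1/2 * (norm (grad \<phi> x))\<^sup>2 + potential lam gam (\<phi> x))"

definition vanishes_at_infinity :: "('a::euclidean_space \<Rightarrow> real) \<Rightarrow> bool" where
  "vanishes_at_infinity \<phi> \<longleftrightarrow> (\<phi> \<longlongrightarrow> 0) at_infinity"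

(* The monotonicity refers to the radius about the same centre as the symmetry. *)
definition monotone_spherical :: "('a::euclidean_space \<Rightarrow> real) \<Rightarrow> bool" where
  "monotone_spherical \<phi> \<longleftrightarrow>
     (\<exists>x0 g. (\<forall>x. \<phi> x = g (norm (x - x0))) \<and>
             (mono_on {0..} g \<or> antimono_on {0..} g))"

definition admissible :: "real \<Rightarrow> real \<Rightarrow> ('a::euclidean_space \<Rightarrow> real) \<Rightarrow> bool" where
  "admissible lam gam \<phi> \<longleftrightarrow>
     is_solution lam gam \<phi> \<and> finite_action lam gam \<phi> \<and>
     vanishes_at_infinity \<phi> \<and> \<phi> \<noteq> (\<lambda>x. 0)"

end

theory Submission
  imports Defs
begin

text \<open>
  Write \<open>n\<close> for the dimension, \<open>q = 2 / (n - 2)\<close>, so \<open>\<gamma> = q n\<close>. Testing the equation with the solution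
  gives \<open>S[\<phi>] = |\<lambda>| q \<integral> |\<phi>|\<^sup>\<gamma>\<close>, so it suffices to bound this integral from below. Where \<open>\<phi>\<close> is positive, the
  function \<open>v\<close> that is \<open>\<phi>\<close> to the power \<open>- q\<close> satisfies \<open>\<Delta>v = n (|\<nabla>v|\<^sup>2 + c) / (2 v)\<close>. Let \<open>A\<close> be the set of points
  whose tangent plane lies below the graph of \<open>v\<close>. As \<open>v\<close> blows up at the boundary of its domain and grows
  superlinearly, \<open>\<nabla>v\<close> maps \<open>A\<close> onto the whole space; on \<open>A\<close> the Hessian is positive semidefinite, whence
  \<open>det D\<^sup>2v \<le> (\<Delta>v / n)\<close> to the power \<open>n\<close>. The area inequality with the weight \<open>(|p|\<^sup>2 + c)\<close> to the power
  \<open>- n\<close> makes the gradient terms cancel and leaves the integral over \<open>A\<close> of \<open>2 v\<close> to the power \<open>- n\<close>, which is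
  a multiple of the integral of \<open>|\<phi>|\<^sup>\<gamma>\<close> over \<open>A\<close>. Equality forces \<open>D\<^sup>2v\<close> to be scalar, so \<open>v\<close> is a quadratic
  polynomial in the distance to a point, that is, \<open>\<phi>\<close> is a bubble. A sign-changing solution has at
  least twice the minimal mass. The superlinear growth of \<open>v\<close> comes from the same contact argument
  on balls, applied to \<open>v\<close> plus a paraboloid.
\<close>

section \<open>Determinant and trace of positive semidefinite operators\<close>

text \<open>The exponent \<open>- q\<close> is the one that turns bubbles into paraboloids, whose
  Hessian is a multiple of the identity: the equality case of the determinant-trace inequality. For
  the paraboloid (|x|^2 + c) / 2 the gradient map is the identity, so the weight is, up to the
  factor 2^n, the mass density of the bubble itself, and the bound is sharp. The argument takes
  place on the set where \<phi> is positive, so it applies to \<phi> and to - \<phi> separately;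
  this is why a sign change costs two minimal masses. The obstacle is that all gradients must be
  attained, which needs v(x) / |x| to tend to infinity, that is |\<phi>| = o(|x|^(-(n - 2) / 2)),
  whereas integrability of |\<phi>|^\<gamma> gives this only on average. A local mass bound makes it
  pointwise; v need not blow up on the boundary of a ball, hence the paraboloid. The same rate
  removes the cutoff error when the equation is tested with \<phi>. In the equality case the
  positivity set is not known to be connected, so the quadratic formula is found on a ball and then
  used to exclude a boundary.\<close>

lemma quad_min_zero_linear:
  fixes a b :: real
  assumes "\<And>t. 0 \<le> a * t\<^sup>2 + b * t" shows "b = 0"
proof (rule ccontr)
  assume b: "b \<noteq> 0"
  define d where "d = \<bar>a\<bar> + 1"
  have d: "d > 0" "a \<le> d" by (auto simp: d_def)
  define t where "t = - b / (2 * d)"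
  have "a * t\<^sup>2 + b * t \<le> d * t\<^sup>2 + b * t" using d by (simp add: mult_right_mono)
  also have "\<dots> = - (b\<^sup>2 / (4 * d))" using d by (simp add: t_def field_simps power2_eq_square)
  also have "\<dots> < 0" using b d by simp
  finally show False using assms[of t] by simp
qed

text \<open>A maximizer \<open>b\<close> of the Rayleigh quotient on the unit sphere of
  \<open>S\<close> works: its first variation makes \<open>f b - l *\<^sub>R b\<close> orthogonal to
  \<open>S\<close>, and this vector lies in \<open>S\<close> by invariance, so it is zero.\<close>

lemma selfadjoint_eigenvector_in_subspace:
  fixes f :: "'a::euclidean_space \<Rightarrow> 'a"
  assumes lin: "linear f" and sa: "\<And>x y. f x \<bullet> y = x \<bullet> f y"
    and S: "subspace S" "\<And>x. x \<in> S \<Longrightarrow> f x \<in> S" "S \<noteq> {0}"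
  obtains b l where "b \<in> S" "norm b = 1" "f b = l *\<^sub>R b"
proof -
  have cl: "closed S" using S by (simp add: closed_subspace)
  have "compact (S \<inter> sphere 0 1)" using cl by (simp add: closed_Int_compact)
  moreover have "S \<inter> sphere 0 1 \<noteq> {}"
  proof -
    obtain x where "x \<in> S" "x \<noteq> 0" using S subspace_0 by blast
    then have "(1 / norm x) *\<^sub>R x \<in> S \<inter> sphere 0 1" using S by (simp add: subspace_scale)
    then show ?thesis by blast
  qed
  moreover have cf: "continuous_on A f" for A
    using lin by (simp add: linear_continuous_on linear_conv_bounded_linear)
  moreover have "continuous_on (S \<inter> sphere 0 1) (\<lambda>x. f x \<bullet> x)"
    by (intro continuous_on_inner continuous_on_id cf)
  ultimately have "\<exists>b\<in>S \<inter> sphere 0 1. \<forall>y\<in>S \<inter> sphere 0 1. f y \<bullet> y \<le> f b \<bullet> b"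
    by (intro continuous_attains_sup) auto
  then obtain b where b: "b \<in> S \<inter> sphere 0 1" and
    bmax: "\<And>y. y \<in> S \<inter> sphere 0 1 \<Longrightarrow> f y \<bullet> y \<le> f b \<bullet> b"
    by blast
  define l where "l = f b \<bullet> b"
  have nb: "norm b = 1" "b \<in> S" "b \<bullet> b = 1" using b by (auto simp: dot_square_norm)
  have le: "f y \<bullet> y \<le> l * (y \<bullet> y)" if "y \<in> S" for y
  proof (cases "y = 0")
    case True then show ?thesis using lin by (simp add: linear_0)
  next
    case False
    then have "(1 / norm y) *\<^sub>R y \<in> S \<inter> sphere 0 1" using S that by (simp add: subspace_scale)
    from bmax[OF this] have "(f y \<bullet> y) / (norm y)\<^sup>2 \<le> l"
      using lin by (simp add: l_def linear_scale power2_eq_square)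
    then show ?thesis using False by (simp add: dot_square_norm field_simps)
  qed
  have orth: "(f b - l *\<^sub>R b) \<bullet> y = 0" if y: "y \<in> S" for y
  proof -
    have "0 \<le> (l * (y \<bullet> y) - f y \<bullet> y) * t\<^sup>2 + (2 * (l * (b \<bullet> y) - f b \<bullet> y)) * t" for t
    proof -
      have "b + t *\<^sub>R y \<in> S" using S y nb by (simp add: subspace_add subspace_scale)
      from le[OF this] have "f (b + t *\<^sub>R y) \<bullet> (b + t *\<^sub>R y) \<le> l * ((b + t *\<^sub>R y) \<bullet> (b + t *\<^sub>R y))" .
      moreover have "f y \<bullet> b = f b \<bullet> y" using sa[of y b] by (simp add: inner_commute)
      moreover have "f (b + t *\<^sub>R y) \<bullet> (b + t *\<^sub>R y) =
          f b \<bullet> b + t * (f b \<bullet> y) + t * (f y \<bullet> b) + t\<^sup>2 * (f y \<bullet> y)"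
        using lin by (simp add: linear_add linear_scale inner_simps algebra_simps power2_eq_square)
      moreover have "(b + t *\<^sub>R y) \<bullet> (b + t *\<^sub>R y) = 1 + 2 * t * (b \<bullet> y) + t\<^sup>2 * (y \<bullet> y)"
        using nb(3) by (simp add: inner_simps algebra_simps power2_eq_square inner_commute[of y b])
      ultimately have "l + t * (f b \<bullet> y) + t * (f b \<bullet> y) + t\<^sup>2 * (f y \<bullet> y)
          \<le> l * (1 + 2 * t * (b \<bullet> y) + t\<^sup>2 * (y \<bullet> y))"
        unfolding l_def by simp
      then show ?thesis by (simp only: distrib_left) (simp add: algebra_simps)
    qed
    then have "2 * (l * (b \<bullet> y) - f b \<bullet> y) = 0" by (rule quad_min_zero_linear)
    then show ?thesis by (simp add: inner_simps)
  qed
  have "f b - l *\<^sub>R b \<in> S" using S nb by (simp add: subspace_diff subspace_scale)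
  from orth[OF this] have "f b = l *\<^sub>R b" by simp
  then show ?thesis using that nb by blast
qed

text \<open>Splitting off one eigenvector leaves its orthogonal complement in \<open>S\<close>,
  which self-adjointness keeps invariant; the dimension drops by one.\<close>

lemma selfadjoint_orthonormal_eigenbasis:
  fixes f :: "'a::euclidean_space \<Rightarrow> 'a"
  assumes lin: "linear f" and sa: "\<And>x y. f x \<bullet> y = x \<bullet> f y"
    and S: "subspace S" "\<And>x. x \<in> S \<Longrightarrow> f x \<in> S"
  shows "\<exists>B. B \<subseteq> S \<and> pairwise orthogonal B \<and> (\<forall>b\<in>B. norm b = 1) \<and> card B = dim S \<and>
             (\<forall>b\<in>B. \<exists>l. f b = l *\<^sub>R b)"
  using S
proof (induction "dim S" arbitrary: S)
  case 0
  then show ?case by (intro exI[of _ "{}"]) auto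
next
  case (Suc d)
  have "S \<noteq> {0}" using Suc(2) by auto
  then obtain b l where b: "b \<in> S" "norm b = 1" "f b = l *\<^sub>R b"
    using selfadjoint_eigenvector_in_subspace[OF lin sa Suc(3) Suc(4)] by blast
  define T where "T = {y \<in> S. orthogonal b y}"
  have dimT: "d = dim T"
  proof -
    have "dim {y \<in> S. \<forall>x\<in>{b}. orthogonal x y} + dim {b} = dim S"
    proof -
      have "{y \<in> S. \<forall>x\<in>{b}. orthogonal x y} = {y \<in> S. \<forall>x\<in>span {b}. orthogonal x y}"
        by (auto simp: span_singleton orthogonal_def)
      moreover have "span {b} \<subseteq> S" using b(1) Suc(3) by (simp add: span_minimal)
      ultimately show ?thesis
        using dim_subspace_orthogonal_to_vectors[of "span {b}" S] Suc(3) by (simp add: dim_span)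
    qed
    moreover have "b \<noteq> 0" using b by auto
    ultimately show ?thesis using Suc(2) by (simp add: T_def dim_singleton)
  qed
  have T: "subspace T" "\<And>x. x \<in> T \<Longrightarrow> f x \<in> T"
  proof -
    show "subspace T" using Suc(3) unfolding T_def subspace_def by (auto simp: orthogonal_def inner_simps)
    show "f x \<in> T" if "x \<in> T" for x
      using that Suc(4) sa[of b x] b(3) by (auto simp: T_def orthogonal_def)
  qed
  obtain B where B: "B \<subseteq> T" "pairwise orthogonal B" "\<forall>b\<in>B. norm b = 1" "card B = dim T"
    "\<forall>b\<in>B. \<exists>l. f b = l *\<^sub>R b"
    using Suc(1)[OF dimT T] by auto
  have "b \<notin> B" using B(1) b(2) by (auto simp: T_def orthogonal_def)
  moreover have "finite B" using B(2,3) pairwise_orthogonal_imp_finite by blast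
  ultimately have "card (insert b B) = dim S" using B(4) dimT Suc(2) by simp
  moreover have "pairwise orthogonal (insert b B)"
    using B(1,2) by (auto simp: pairwise_insert T_def orthogonal_commute)
  ultimately show ?case using b B by (intro exI[of _ "insert b B"]) (auto simp: T_def)
qed

text \<open>Polya's proof of the inequality of the means: t \<le> exp (t - 1) is applied to each
  \<open>c i / m\<close>, and the exponents add up to zero. Equality t = exp (t - 1) only at t = 1
  yields the rigidity statement.\<close>

lemma prod_le_power_mean:
  fixes c :: "'i \<Rightarrow> real"
  assumes I: "finite I" "I \<noteq> {}" and nn: "\<And>i. i \<in> I \<Longrightarrow> 0 \<le> c i"
  shows "prod c I \<le> (sum c I / card I) ^ card I"
    and "\<lbrakk>prod c I = (sum c I / card I) ^ card I; sum c I > 0; i \<in> I\<rbrakk> \<Longrightarrow> c i = sum c I / card I"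
proof -
  define m where "m = sum c I / card I"
  have c0: "card I > 0" using I by (simp add: card_gt_0_iff)
  have le: "c i / m \<le> exp (c i / m - 1)" for i using exp_ge_add_one_self[of "c i / m - 1"] by simp
  have expsum: "(\<Prod>i\<in>I. exp (c i / m - 1)) = 1" if "m > 0"
  proof -
    have "(\<Prod>i\<in>I. exp (c i / m - 1)) = exp (\<Sum>i\<in>I. c i / m - 1)" using I by (simp add: exp_sum)
    also have "(\<Sum>i\<in>I. c i / m - 1) = sum c I / m - card I" by (simp add: sum_subtractf sum_divide_distrib)
    also have "\<dots> = 0" using that c0 by (simp add: m_def field_simps)
    finally show ?thesis by simp
  qed
  have prodm: "(\<Prod>i\<in>I. c i / m) = prod c I / m ^ card I" by (simp add: prod_dividef)
  have s0: "sum c I \<ge> 0" using nn by (simp add: sum_nonneg)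
  show "prod c I \<le> (sum c I / card I) ^ card I"
  proof (cases "sum c I = 0")
    case True
    then have "\<And>i. i \<in> I \<Longrightarrow> c i = 0" using nn I by (simp add: sum_nonneg_eq_0_iff)
    then have "prod c I = 0" using I by (metis ex_in_conv prod_zero)
    then show ?thesis using s0 by simp
  next
    case False
    then have m: "m > 0" using s0 c0 by (simp add: m_def)
    have "(\<Prod>i\<in>I. c i / m) \<le> (\<Prod>i\<in>I. exp (c i / m - 1))"
      using nn m le by (intro prod_mono) auto
    then have "prod c I / m ^ card I \<le> 1" using expsum[OF m] prodm by simp
    then have "prod c I \<le> m ^ card I" using m by (simp add: field_simps)
    then show ?thesis by (simp add: m_def)
  qed
  show "c i = sum c I / card I" if eq: "prod c I = (sum c I / card I) ^ card I" and s: "sum c I > 0" and i: "i \<in> I"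
  proof (rule ccontr)
    assume ne: "c i \<noteq> sum c I / card I"
    have m: "m > 0" using s c0 by (simp add: m_def)
    have "c i / m < exp (c i / m - 1)"
    proof (rule ccontr)
      assume "\<not> ?thesis"
      then have e: "c i / m = exp (c i / m - 1)" using le[of i] by simp
      then have "c i / m > 0" "ln (c i / m) = c i / m - 1"
        by (metis exp_gt_zero) (metis e ln_exp)
      then have "c i / m = 1" by (rule ln_eq_minus_one)
      then show False using ne m by (simp flip: m_def)
    qed
    moreover have "(\<Prod>j\<in>I-{i}. c j / m) \<le> (\<Prod>j\<in>I-{i}. exp (c j / m - 1))"
      using nn m le by (intro prod_mono) auto
    moreover have "(\<Prod>j\<in>I-{i}. c j / m) \<ge> 0" "(\<Prod>j\<in>I-{i}. exp (c j / m - 1)) > 0" 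
      using nn m by (auto intro!: prod_nonneg prod_pos)
    moreover have "c i / m \<ge> 0" using nn i m by simp
    ultimately have "c i / m * (\<Prod>j\<in>I-{i}. c j / m) < exp (c i / m - 1) * (\<Prod>j\<in>I-{i}. exp (c j / m - 1))"
      by (smt (verit) mult_left_mono mult_strict_right_mono)
    then have "(\<Prod>i\<in>I. c i / m) < (\<Prod>i\<in>I. exp (c i / m - 1))"
      using I i by (simp add: prod.remove)
    moreover have "prod c I / m ^ card I = 1" using eq m unfolding m_def[symmetric] by simp
    ultimately show False using expsum[OF m] prodm by simp
  qed
qed

text \<open>Determinant and trace are product and sum of the nonnegative eigenvalues
  \<open>l i\<close>, so this is the inequality of the means. Equality makes all eigenvalues equal,
  hence the diagonal form scalar and with it \<open>A\<close>.\<close>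

lemma det_le_trace_power:
  fixes A :: "real^'m^'m"
  assumes sa: "\<And>x y. (A *v x) \<bullet> y = x \<bullet> (A *v y)" and psd: "\<And>x. 0 \<le> (A *v x) \<bullet> x"
  shows "\<bar>det A\<bar> \<le> (trace A / CARD('m)) ^ CARD('m)"
    and "\<lbrakk>\<bar>det A\<bar> = (trace A / CARD('m)) ^ CARD('m); trace A > 0\<rbrakk> \<Longrightarrow> A *v x = (trace A / CARD('m)) *\<^sub>R x"
proof -
  obtain B where B: "pairwise orthogonal B" "\<forall>b\<in>B. norm b = 1" "card B = CARD('m)"
    "\<forall>b\<in>B. \<exists>l. A *v b = l *\<^sub>R b"
    using selfadjoint_orthonormal_eigenbasis[of "(*v) A" UNIV] sa by auto
  have fB: "finite B" using B(3) by (metis card.infinite zero_less_card_finite less_irrefl)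
  obtain \<beta> :: "'m \<Rightarrow> real^'m" where \<beta>: "bij_betw \<beta> UNIV B"
    using B(3) fB finite_same_card_bij[of "UNIV :: 'm set" B] by auto
  then have \<beta>B: "\<beta> i \<in> B" for i by (auto simp: bij_betw_def)
  have on: "\<beta> i \<bullet> \<beta> j = (if i = j then 1 else 0)" for i j
  proof (cases "i = j")
    case True then show ?thesis using B(2) \<beta>B by (simp add: dot_square_norm)
  next
    case False
    then have "\<beta> i \<noteq> \<beta> j" using \<beta> by (auto simp: bij_betw_def inj_on_def)
    then show ?thesis using False B(1) \<beta>B by (auto simp: pairwise_def orthogonal_def)
  qed
  have "\<forall>i. \<exists>l. A *v \<beta> i = l *\<^sub>R \<beta> i" using B(4) \<beta>B by blast
  from choice[OF this] obtain l where l: "\<And>i. A *v \<beta> i = l i *\<^sub>R \<beta> i" by blast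
  define P :: "real^'m^'m" where "P = (\<chi> i j. \<beta> j $ i)"
  define D :: "real^'m^'m" where "D = (\<chi> i j. if i = j then l i else 0)"
  have PP: "transpose P ** P = mat 1"
    by (simp add: vec_eq_iff matrix_matrix_mult_def transpose_def P_def mat_def on[unfolded inner_vec_def inner_real_def])
  then have PP': "P ** transpose P = mat 1" by (simp add: matrix_left_right_inverse)
  have AP: "A ** P = P ** D"
  proof -
    have 1: "(A ** P) $ i $ j = (A *v \<beta> j) $ i" for i j
      by (simp add: matrix_matrix_mult_def matrix_vector_mult_def P_def)
    have 2: "(P ** D) $ i $ j = (l j *\<^sub>R \<beta> j) $ i" for i j
      by (simp add: matrix_matrix_mult_def P_def D_def if_distrib sum.delta cong: if_cong)
    show ?thesis unfolding vec_eq_iff 1 2 l by simp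
  qed
  have A: "A = P ** D ** transpose P"
  proof -
    have "A = A ** (P ** transpose P)" using PP' by simp
    also have "\<dots> = (A ** P) ** transpose P" by (rule matrix_mul_assoc)
    finally show ?thesis unfolding AP .
  qed
  have "det P * det P = 1" using arg_cong[OF PP, of det] by (simp add: det_mul)
  moreover have "det A = det P * det D * det P" unfolding A by (simp add: det_mul)
  moreover have "det P * det D * det P = (det P * det P) * det D" by simp
  ultimately have "det A = det D" by simp
  also have "\<dots> = prod l UNIV" by (subst det_diagonal) (auto simp: D_def)
  finally have detA: "det A = prod l UNIV" .
  have "trace A = trace (transpose P ** (P ** D))"
    unfolding A by (rule trace_mul_sym)
  also have "\<dots> = trace D" using PP by (simp add: matrix_mul_assoc)
  also have "\<dots> = sum l UNIV" by (simp add: trace_def D_def)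
  finally have trA: "trace A = sum l UNIV" .
  have l0: "0 \<le> l i" for i using psd[of "\<beta> i"] on[of i i] l by simp
  show "\<bar>det A\<bar> \<le> (trace A / CARD('m)) ^ CARD('m)"
    using prod_le_power_mean(1)[of UNIV l] l0 unfolding detA trA by (simp add: abs_of_nonneg prod_nonneg)
  show "A *v x = (trace A / CARD('m)) *\<^sub>R x"
    if "\<bar>det A\<bar> = (trace A / CARD('m)) ^ CARD('m)" "trace A > 0"
  proof -
    have "prod l UNIV \<ge> 0" using l0 by (simp add: prod_nonneg)
    then have "l i = trace A / CARD('m)" for i
      using prod_le_power_mean(2)[of UNIV l i] l0 that unfolding detA trA by simp
    then have "D = mat (trace A / CARD('m))" by (simp add: D_def mat_def vec_eq_iff)
    then have "D = (trace A / CARD('m)) *\<^sub>R mat 1" by (simp add: mat_def vec_eq_iff)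
    then have D: "D *v y = (trace A / CARD('m)) *\<^sub>R y" for y
      by (simp add: scaleR_matrix_vector_assoc[symmetric])
    have "A *v x = P *v (D *v (transpose P *v x))"
      by (subst A) (simp only: matrix_vector_mul_assoc matrix_mul_assoc)
    also have "\<dots> = (trace A / CARD('m)) *\<^sub>R (P *v (transpose P *v x))"
      unfolding D by (rule matrix_vector_mult_scaleR)
    also have "P *v (transpose P *v x) = x"
      by (simp only: matrix_vector_mul_assoc PP' matrix_vector_mul_lid)
    finally show ?thesis .
  qed
qed

section \<open>The area inequality\<close>

text \<open>The change of variables theorems of HOL-Analysis need a well-ordered index type. The isometry
  \<open>to_idx\<close> transports them to an arbitrary finite index type; for the same reason \<open>idx_det\<close> takes the
  determinant after reindexing.\<close>

typedef ('n::finite) idx = "{..<CARD('n)}" by (auto intro: exI[of _ 0])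

instance idx :: (finite) finite
proof
  have "(UNIV :: 'a idx set) = Abs_idx ` {..<CARD('a)}"
    by (metis type_definition.Abs_image type_definition_idx)
  then show "finite (UNIV :: 'a idx set)" by (metis finite_imageI finite_lessThan)
qed

instantiation idx :: (finite) wellorder
begin
definition "x \<le> y \<longleftrightarrow> Rep_idx x \<le> Rep_idx y"
definition "x < y \<longleftrightarrow> Rep_idx x < Rep_idx y"
instance
proof
  fix P :: "'a idx \<Rightarrow> bool" and a
  assume step: "\<And>x. (\<And>y. y < x \<Longrightarrow> P y) \<Longrightarrow> P x"
  show "P a"
  proof (induction "Rep_idx a" arbitrary: a rule: less_induct)
    case less then show ?case using step by (auto simp: less_idx_def)
  qed
qed (auto simp: less_eq_idx_def less_idx_def Rep_idx_inject)
end

lemma card_idx: "CARD('n::finite idx) = CARD('n)"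
  using type_definition.card[OF type_definition_idx] by simp

definition idx_bij :: "'n::finite idx \<Rightarrow> 'n" where
  "idx_bij = (SOME e. bij e)"

lemma bij_idx_bij: "bij (idx_bij :: 'n::finite idx \<Rightarrow> 'n)"
proof -
  have "\<exists>e :: 'n idx \<Rightarrow> 'n. bij e"
    using finite_same_card_bij[of "UNIV :: 'n idx set" "UNIV :: 'n set"] card_idx by auto
  then show ?thesis unfolding idx_bij_def by (rule someI_ex)
qed

lemma idx_bij_inv [simp]: "idx_bij (inv idx_bij j) = j" "inv idx_bij (idx_bij i) = i"
  by (simp_all add: surj_f_inv_f[OF bij_is_surj[OF bij_idx_bij]] inv_f_f[OF bij_is_inj[OF bij_idx_bij]])

definition to_idx :: "real^'n \<Rightarrow> real^('n::finite idx)" where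
  "to_idx x = (\<chi> i. x $ idx_bij i)"

definition of_idx :: "real^('n::finite idx) \<Rightarrow> real^'n" where
  "of_idx y = (\<chi> i. y $ inv idx_bij i)"

lemma of_to_idx [simp]: "of_idx (to_idx x) = x"
  by (simp add: of_idx_def to_idx_def vec_eq_iff)

lemma to_of_idx [simp]: "to_idx (of_idx y) = y"
  by (simp add: of_idx_def to_idx_def vec_eq_iff)

lemma linear_to_idx: "linear to_idx" and linear_of_idx: "linear of_idx"
  by (auto intro!: linearI simp: to_idx_def of_idx_def vec_eq_iff)

lemma bounded_linear_to_idx: "bounded_linear to_idx"
  and bounded_linear_of_idx: "bounded_linear of_idx"
  using linear_to_idx linear_of_idx by (simp_all add: linear_conv_bounded_linear)

lemma inner_to_idx: "to_idx x \<bullet> y = x \<bullet> of_idx y"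
proof -
  have "(\<Sum>i\<in>UNIV. x $ idx_bij i * y $ i) = (\<Sum>i\<in>UNIV. x $ i * y $ inv idx_bij i)"
    by (intro sum.reindex_bij_witness[of _ "inv idx_bij" idx_bij]) auto
  then show ?thesis by (simp add: inner_vec_def to_idx_def of_idx_def)
qed

lemma measurable_to_idx [measurable]: "to_idx \<in> borel_measurable borel"
  and measurable_of_idx [measurable]: "of_idx \<in> borel_measurable borel"
  using bounded_linear_to_idx bounded_linear_of_idx
  by (auto intro!: borel_measurable_continuous_onI linear_continuous_on)

lemma bij_betw_axis_Basis: "bij_betw (\<lambda>i. axis i (1::real)) UNIV (Basis :: (real^'m) set)"
  by (auto simp: bij_betw_def Basis_vec_def inj_on_def axis_eq_axis)

lemma prod_Basis_vec: "prod f (Basis :: (real^'m) set) = (\<Prod>i\<in>UNIV. f (axis i 1))"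
  and sum_Basis_vec: "sum h (Basis :: (real^'m) set) = (\<Sum>i\<in>UNIV. h (axis i 1))"
  by (rule prod.reindex_bij_betw[OF bij_betw_axis_Basis, symmetric]
      sum.reindex_bij_betw[OF bij_betw_axis_Basis, symmetric])+

text \<open>Relabelling coordinates permutes the side lengths of a box, and box volumes determine
  \<open>lborel\<close>. This is what carries integrals from one index type to the other.\<close>

lemma lborel_distr_to_idx: "distr lborel borel to_idx = (lborel :: (real^('n::finite idx)) measure)"
proof (rule lborel_eqI[symmetric])
  fix l u :: "real^('n idx)" assume le: "\<And>b. b \<in> Basis \<Longrightarrow> l \<bullet> b \<le> u \<bullet> b"
  have le': "l $ i \<le> u $ i" for i using le[of "axis i 1"] by (simp add: inner_axis axis_in_Basis_iff)
  have "to_idx -` box l u = (box (of_idx l) (of_idx u) :: (real^'n) set)"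
  proof (intro set_eqI)
    fix x :: "real^'n"
    have "(\<forall>i. l $ i < x $ idx_bij i \<and> x $ idx_bij i < u $ i) \<longleftrightarrow>
          (\<forall>j. l $ inv idx_bij j < x $ j \<and> x $ j < u $ inv idx_bij j)"
      by (metis idx_bij_inv)
    then show "x \<in> to_idx -` box l u \<longleftrightarrow> x \<in> box (of_idx l) (of_idx u)"
      by (simp add: mem_box_cart to_idx_def of_idx_def)
  qed
  then have "emeasure (distr lborel borel to_idx) (box l u) = emeasure lborel (box (of_idx l) (of_idx u) :: (real^'n) set)"
    by (subst emeasure_distr) auto
  also have "\<dots> = (\<Prod>b\<in>Basis. (of_idx u - of_idx l) \<bullet> b)"
  proof (rule emeasure_lborel_box)
    fix b :: "real^'n" assume "b \<in> Basis"
    then show "of_idx l \<bullet> b \<le> of_idx u \<bullet> b"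
      using le' by (auto simp: Basis_vec_def inner_axis of_idx_def)
  qed
  also have "(\<Prod>b\<in>Basis. (of_idx u - of_idx l) \<bullet> (b :: real^'n)) = (\<Prod>j\<in>UNIV. u $ inv idx_bij j - l $ inv idx_bij (j::'n))"
    by (simp add: prod_Basis_vec inner_axis of_idx_def)
  also have "\<dots> = (\<Prod>i\<in>UNIV. u $ i - l $ i)"
    by (intro prod.reindex_bij_betw[of "inv idx_bij"] bij_imp_bij_inv bij_idx_bij)
  also have "\<dots> = (\<Prod>b\<in>Basis. (u - l) \<bullet> b)"
    by (simp add: prod_Basis_vec inner_axis)
  finally show "emeasure (distr lborel borel (to_idx :: real^'n \<Rightarrow> _)) (box l u) = (\<Prod>b\<in>Basis. (u - l) \<bullet> b)" .
qed simp

definition idx_det :: "(real^'n \<Rightarrow> real^'n) \<Rightarrow> real" where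
  "idx_det L = det (matrix (\<lambda>y. to_idx (L (of_idx y))))"

definition op_trace :: "('a::euclidean_space \<Rightarrow> 'a) \<Rightarrow> real" where
  "op_trace L = (\<Sum>b\<in>Basis. L b \<bullet> b)"

lemma of_idx_axis: "of_idx (axis i 1) = axis (idx_bij i) 1"
proof -
  have "inv idx_bij j = i \<longleftrightarrow> j = idx_bij i" for j by (metis idx_bij_inv)
  then show ?thesis by (simp add: of_idx_def axis_def vec_eq_iff)
qed

text \<open>Conjugation with the isometry \<open>to_idx\<close> preserves self-adjointness,
  positivity and the trace, so the matrix statement transfers.\<close>

lemma idx_det_le_trace_power:
  fixes L :: "real^'n \<Rightarrow> real^'n"
  assumes lin: "linear L" and sa: "\<And>x y. L x \<bullet> y = x \<bullet> L y" and psd: "\<And>x. 0 \<le> L x \<bullet> x"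
  shows "\<bar>idx_det L\<bar> \<le> (op_trace L / CARD('n)) ^ CARD('n)"
    and "\<lbrakk>\<bar>idx_det L\<bar> = (op_trace L / CARD('n)) ^ CARD('n); op_trace L > 0\<rbrakk>
           \<Longrightarrow> L x = (op_trace L / CARD('n)) *\<^sub>R x"
proof -
  define M where "M = (\<lambda>y. to_idx (L (of_idx y)))"
  define A where "A = matrix M"
  have linM: "linear M"
    using linear_compose[OF linear_compose[OF linear_of_idx lin] linear_to_idx] by (simp add: M_def o_def)
  have AM: "A *v y = M y" for y unfolding A_def using linM by (simp add: matrix_works)
  have saA: "(A *v x) \<bullet> y = x \<bullet> (A *v y)" for x y
    by (metis AM M_def inner_commute inner_to_idx sa)
  have psdA: "0 \<le> (A *v x) \<bullet> x" for x
    using psd[of "of_idx x"] by (simp add: AM M_def inner_to_idx)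
  have tr: "trace A = op_trace L"
  proof -
    have "trace A = (\<Sum>i\<in>UNIV. (A *v axis i 1) \<bullet> axis i 1)"
      by (simp add: trace_def matrix_vector_mul_component inner_axis matrix_vector_mult_basis column_def)
    also have "\<dots> = (\<Sum>i\<in>UNIV. L (axis (idx_bij i) 1) \<bullet> axis (idx_bij i) 1)"
      by (simp add: AM M_def inner_to_idx of_idx_axis)
    also have "\<dots> = (\<Sum>j\<in>UNIV. L (axis j 1) \<bullet> axis j 1)"
      using bij_idx_bij by (intro sum.reindex_bij_betw)
    also have "\<dots> = op_trace L" unfolding op_trace_def
      by (simp add: sum_Basis_vec)
    finally show ?thesis .
  qed
  have dA: "det A = idx_det L" by (simp add: A_def M_def idx_det_def)
  show "\<bar>idx_det L\<bar> \<le> (op_trace L / CARD('n)) ^ CARD('n)"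
    using det_le_trace_power(1)[OF saA psdA] by (simp add: tr dA card_idx)
  show "L x = (op_trace L / CARD('n)) *\<^sub>R x"
    if "\<bar>idx_det L\<bar> = (op_trace L / CARD('n)) ^ CARD('n)" "op_trace L > 0"
  proof -
    have "M (to_idx x) = (op_trace L / CARD('n)) *\<^sub>R to_idx x"
      using det_le_trace_power(2)[OF saA psdA, of "to_idx x"] that by (simp add: tr dA card_idx AM)
    then have "of_idx (M (to_idx x)) = of_idx ((op_trace L / CARD('n)) *\<^sub>R to_idx x)" by simp
    then show ?thesis by (simp add: M_def linear_scale[OF linear_of_idx])
  qed
qed

lemma continuous_on_idx_det:
  fixes H :: "'a::topological_space \<Rightarrow> real^'n \<Rightarrow> real^'n"
  assumes "\<And>h. continuous_on S (\<lambda>x. H x h)"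
  shows "continuous_on S (\<lambda>x. idx_det (H x))"
  unfolding idx_det_def matrix_def det_def to_idx_def vec_lambda_beta
  by (intro continuous_on_sum continuous_on_prod continuous_on_mult continuous_on_const
      continuous_on_component assms)

text \<open>As \<open>g\<close> may be many-to-one, values taken several times are counted several
  times on the right, and only an inequality holds. A Borel image is not guaranteed for a Borel
  \<open>S\<close>, so the left side integrates over a Borel set \<open>T\<close> inside the
  image.\<close>

lemma integral_le_integral_idx_det:
  fixes g :: "real^'n \<Rightarrow> real^'n" and f :: "real^'n \<Rightarrow> real"
  assumes S: "S \<in> sets borel" and T: "T \<in> sets borel" "T \<subseteq> g ` S"
    and g: "\<And>x. x \<in> S \<Longrightarrow> (g has_derivative g' x) (at x)"
    and f: "f \<in> borel_measurable borel" "\<And>x. 0 \<le> f x"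
    and int: "integrable lborel (\<lambda>x. indicator S x * (\<bar>idx_det (g' x)\<bar> * f (g x)))"
  shows "(LINT x|lborel. indicator T x * f x) \<le> (LINT x|lborel. indicator S x * (\<bar>idx_det (g' x)\<bar> * f (g x)))"
proof -
  define F where "F = (\<lambda>x. indicator S x * (\<bar>idx_det (g' x)\<bar> * f (g x)))"
  define S' T' where "S' = to_idx ` S" and "T' = to_idx ` T"
  have img: "to_idx ` X = of_idx -` X" for X :: "(real^'n) set"
    by (auto simp: image_iff) (metis to_of_idx)
  have mS': "S' \<in> sets borel" "T' \<in> sets borel"
    using measurable_sets_borel[OF measurable_of_idx] S T by (auto simp: S'_def T'_def img)
  define G G' f' where "G = (\<lambda>y. to_idx (g (of_idx y)))"
    and "G' = (\<lambda>y h. to_idx (g' (of_idx y) (of_idx h)))" and "f' = (\<lambda>y. f (of_idx y))"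
  have eqF: "indicator S' y * (\<bar>det (matrix (G' y))\<bar> * f' (G y)) = F (of_idx y)" for y
    by (simp add: F_def S'_def img G'_def f'_def G_def idx_det_def indicator_def)
  have "integrable (distr lborel borel to_idx) (\<lambda>y. F (of_idx y)) \<longleftrightarrow> integrable lborel (\<lambda>x. F (of_idx (to_idx x)))"
  proof (rule integrable_distr_eq)
    have "F \<in> borel_measurable borel" using borel_measurable_integrable[OF int] by (simp add: F_def)
    then show "(\<lambda>y. F (of_idx y)) \<in> borel_measurable borel" by measurable
  qed simp
  then have iF: "integrable lborel (\<lambda>y. F (of_idx y))" using int by (simp add: F_def lborel_distr_to_idx)
  have intF: "(LINT y|lborel. F (of_idx y)) = (LINT x|lborel. F x)"
  proof -
    have "F \<in> borel_measurable borel" using borel_measurable_integrable[OF int] by (simp add: F_def)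
    then have "(\<lambda>y. F (of_idx y)) \<in> borel_measurable borel" by measurable
    then have "(LINT y|distr lborel borel to_idx. F (of_idx y)) = (LINT x|lborel. F (of_idx (to_idx x)))"
      by (intro integral_distr) auto
    then show ?thesis by (simp add: lborel_distr_to_idx)
  qed
  have hi: "((\<lambda>y. indicator S' y * (\<bar>det (matrix (G' y))\<bar> * f' (G y))) has_integral (LINT x|lborel. F x)) UNIV"
    unfolding eqF using has_integral_integral_lborel[OF iF] intF by simp
  then have hiS: "((\<lambda>y. \<bar>det (matrix (G' y))\<bar> * f' (G y)) has_integral (LINT x|lborel. F x)) S'"
    by (subst has_integral_restrict_UNIV[symmetric], rule has_integral_eq[rotated])
       (auto simp: indicator_def)
  have derG: "(G has_derivative G' y) (at y within S')" if "y \<in> S'" for y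
  proof -
    have "of_idx y \<in> S" using that by (auto simp: S'_def)
    from g[OF this] have "((\<lambda>y. g (of_idx y)) has_derivative (\<lambda>h. g' (of_idx y) (of_idx h))) (at y)"
      by (rule has_derivative_compose[OF bounded_linear_imp_has_derivative[OF bounded_linear_of_idx]])
    from bounded_linear.has_derivative[OF bounded_linear_to_idx this]
    show ?thesis unfolding G_def G'_def by (rule has_derivative_at_withinI)
  qed
  have ub: "f' integrable_on G ` S'" "integral (G ` S') f' \<le> (LINT x|lborel. F x)"
    using integral_on_image_ubound_nonneg[of S' f' G G'] derG hiS f
    by (auto simp: f'_def has_integral_iff)
  have T'sub: "T' \<subseteq> G ` S'"
    using T by (force simp: T'_def G_def S'_def image_iff)
  have "f' absolutely_integrable_on G ` S'" using ub(1) f by (auto simp: f'_def absolutely_integrable_on_iff_nonneg)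
  then have absT: "f' absolutely_integrable_on T'"
    by (rule set_integrable_subset) (use T'sub mS' in auto)
  have "(\<lambda>y. indicator T' y * f' y) \<in> borel_measurable borel"
    using f mS' unfolding f'_def by measurable
  then have iT: "integrable lborel (\<lambda>y. indicator T' y * f' y)"
    using absT unfolding set_integrable_def by (simp add: integrable_completion)
  have eqT: "indicator T' (to_idx x) * f' (to_idx x) = indicator T x * f x" for x
    by (simp add: T'_def img f'_def indicator_def)
  have mT: "(\<lambda>y. indicator T' y * f' y) \<in> borel_measurable borel"
    using borel_measurable_integrable[OF iT] by simp
  have "(LINT x|lborel. indicator T x * f x) = (LINT y|lborel. indicator T' y * f' y)"
    using integral_distr[of to_idx lborel borel "\<lambda>y. indicator T' y * f' y"] mT
    by (simp add: lborel_distr_to_idx eqT)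
  also have "\<dots> = integral T' f'"
  proof -
    have "(\<lambda>y. indicator T' y * f' y) = (\<lambda>y. if y \<in> T' then f' y else 0)"
      by (auto simp: indicator_def fun_eq_iff)
    then have "integral UNIV (\<lambda>y. indicator T' y * f' y) = integral T' f'"
      by (simp only: integral_restrict_UNIV)
    then show ?thesis using integral_unique[OF has_integral_integral_lborel[OF iT]] by simp
  qed
  also have "\<dots> \<le> integral (G ` S') f'"
    using absT ub(1) T'sub f by (intro integral_subset_le) (auto simp: f'_def absolutely_integrable_on_def)
  finally show "(LINT x|lborel. indicator T x * f x) \<le> (LINT x|lborel. indicator S x * (\<bar>idx_det (g' x)\<bar> * f (g x)))"
    using ub(2) by (simp add: F_def)
qed

section \<open>Contact sets\<close>

text \<open>Along the line through \<open>x\<close> in direction \<open>h\<close>, the gap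
  \<open>p\<close> between \<open>w\<close> and its tangent plane vanishes at 0 together with its
  derivative \<open>d\<close>. A negative \<open>H h \<bullet> h\<close> makes \<open>d\<close>
  negative just after 0, and the mean value theorem then makes \<open>p\<close> negative. Only the
  differentiability of \<open>gw\<close> at the single point \<open>x\<close> enters.\<close>

lemma contact_point_psd:
  fixes w :: "'a::euclidean_space \<Rightarrow> real"
  assumes U: "open U" "x \<in> U"
    and dw: "\<And>y. y \<in> U \<Longrightarrow> (w has_derivative (\<lambda>h. gw y \<bullet> h)) (at y)"
    and dg: "(gw has_derivative H) (at x)"
    and min: "\<And>y. y \<in> U \<Longrightarrow> w x + gw x \<bullet> (y - x) \<le> w y"
  shows "0 \<le> H h \<bullet> h"
proof (rule ccontr)
  assume neg: "\<not> 0 \<le> H h \<bullet> h"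
  obtain e where e: "e > 0" "ball x e \<subseteq> U" using U open_contains_ball by blast
  define \<delta> where "\<delta> = e / (norm h + 1)"
  have d0: "\<delta> > 0" using e by (simp add: \<delta>_def add_nonneg_pos)
  have inU: "x + t *\<^sub>R h \<in> U" if "\<bar>t\<bar> < \<delta>" for t
  proof -
    have "\<bar>t\<bar> * norm h \<le> \<bar>t\<bar> * (norm h + 1)" by (simp add: mult_left_mono)
    also have "\<dots> < e" using that by (simp add: \<delta>_def pos_less_divide_eq add_nonneg_pos)
    finally have "x + t *\<^sub>R h \<in> ball x e" by (simp add: dist_norm)
    then show ?thesis using e by blast
  qed
  define p where "p t = w (x + t *\<^sub>R h) - w x - t * (gw x \<bullet> h)" for t
  define d where "d t = (gw (x + t *\<^sub>R h) - gw x) \<bullet> h" for t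
  have line: "((\<lambda>t. x + t *\<^sub>R h) has_derivative (\<lambda>s. s *\<^sub>R h)) (at t)" for t :: real
    by (auto intro!: derivative_eq_intros)
  have p': "(p has_real_derivative d t) (at t)" if "\<bar>t\<bar> < \<delta>" for t
  proof -
    have "((\<lambda>t. w (x + t *\<^sub>R h)) has_derivative (\<lambda>s. gw (x + t *\<^sub>R h) \<bullet> (s *\<^sub>R h))) (at t)"
      by (rule has_derivative_compose[OF line dw[OF inU[OF that]]])
    then have "((\<lambda>t. w (x + t *\<^sub>R h)) has_real_derivative gw (x + t *\<^sub>R h) \<bullet> h) (at t)"
      by (simp add: has_field_derivative_def mult.commute[of _ "gw (x + t *\<^sub>R h) \<bullet> h"])
    then show ?thesis unfolding p_def d_def
      by (auto intro!: derivative_eq_intros simp: inner_simps)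
  qed
  have d': "(d has_real_derivative H h \<bullet> h) (at 0)"
  proof -
    have "((\<lambda>t. gw (x + t *\<^sub>R h)) has_derivative (\<lambda>s. H (s *\<^sub>R h))) (at 0)"
      using has_derivative_compose[OF line, of gw H 0] dg by simp
    then have "(d has_derivative (\<lambda>s. H (s *\<^sub>R h) \<bullet> h)) (at 0)"
      unfolding d_def by (auto intro!: derivative_eq_intros)
    moreover have "H (s *\<^sub>R h) \<bullet> h = H h \<bullet> h * s" for s
      using has_derivative_linear[OF dg] by (simp add: linear_scale)
    ultimately show ?thesis by (simp add: has_field_derivative_def)
  qed
  obtain r where r: "r > 0" "\<And>s. 0 < s \<Longrightarrow> s < r \<Longrightarrow> d (0 + s) < d 0"
    using DERIV_neg_dec_right[OF d'] neg by auto
  define t where "t = min r \<delta> / 2"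
  have t: "0 < t" "t < r" "t < \<delta>" using r d0 by (auto simp: t_def min_def field_simps)
  obtain s where s: "0 < s" "s < t" "p t - p 0 = (t - 0) * d s"
    using MVT2[of 0 t p d] p' t by auto
  have "d s < 0" using r(2)[of s] s t by (simp add: d_def)
  then have "p t < 0" using s t by (simp add: p_def mult_pos_neg)
  moreover have "p t \<ge> 0" using min[OF inU[of t]] t by (simp add: p_def)
  ultimately show False by simp
qed

text \<open>Contact sets are cut out by uncountably many inequalities, so their measurability is
  drawn from relative closedness in an open set. A single inequality is the case
  \<open>I = {()}\<close>.\<close>

lemma closedin_Collect_ball_nonneg:
  fixes F :: "'b \<Rightarrow> 'a::topological_space \<Rightarrow> real"
  assumes "\<And>y. y \<in> I \<Longrightarrow> continuous_on U (F y)"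
  shows "closedin (top_of_set U) {x \<in> U. \<forall>y\<in>I. 0 \<le> F y x}"
proof -
  have "{x \<in> U. \<forall>y\<in>I. 0 \<le> F y x} = \<Inter> (insert U ((\<lambda>y. U \<inter> F y -` {0..}) ` I))" by auto
  moreover have "closedin (top_of_set U) \<dots>"
    using assms by (intro closedin_Inter) (auto intro!: continuous_closedin_preimage)
  ultimately show ?thesis by simp
qed

lemma borel_closedin_open:
  assumes "open U" "closedin (top_of_set U) S"
  shows "S \<in> sets borel"
proof -
  obtain C where "closed C" "S = U \<inter> C" using assms(2) by (auto simp: closedin_closed)
  then show ?thesis using assms(1) by auto
qed

text \<open>Nonempty open sets have positive measure. This promotes almost-everywhere equalities
  between continuous quantities to pointwise ones.\<close>

lemma AE_lborel_open_empty:
  fixes S :: "'a::euclidean_space set"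
  assumes "AE x in lborel. P x" "open S" "\<And>x. x \<in> S \<Longrightarrow> \<not> P x"
  shows "S = {}"
proof (rule ccontr)
  assume "S \<noteq> {}"
  have "AE x in lebesgue. P x" using assms(1) by (rule AE_completion)
  then have "AE x in lebesgue. x \<notin> S" by eventually_elim (use assms in auto)
  then have "S \<in> null_sets lebesgue" using assms(2) by (subst AE_iff_null_sets) auto
  then have "negligible S" by (simp add: negligible_iff_null_sets)
  then show False using open_not_negligible[OF assms(2) \<open>S \<noteq> {}\<close>] by blast
qed

text \<open>The area inequality and the determinant-trace inequality in one chain. The integrable
  majorant \<open>E\<close> also supplies the integrability that the area inequality asks for. The
  weight \<open>f\<close> is kept general because the constant 1 serves on balls and
  \<open>weight c\<close> on the global contact set.\<close>

lemma contact_set_bound: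
  fixes gw :: "real^'n \<Rightarrow> real^'n" and f :: "real^'n \<Rightarrow> real"
  assumes S: "S \<in> sets borel" and T: "T \<in> sets borel" "T \<subseteq> gw ` S"
    and gw: "\<And>x. x \<in> S \<Longrightarrow> (gw has_derivative H x) (at x)"
    and cont: "\<And>h. continuous_on S (\<lambda>x. H x h)"
    and sa: "\<And>x y z. x \<in> S \<Longrightarrow> H x y \<bullet> z = y \<bullet> H x z" and psd: "\<And>x y. x \<in> S \<Longrightarrow> 0 \<le> H x y \<bullet> y"
    and f: "continuous_on UNIV f" "\<And>x. 0 \<le> f x"
    and E: "integrable lborel E" "\<And>x. x \<in> S \<Longrightarrow> (op_trace (H x) / CARD('n)) ^ CARD('n) * f (gw x) \<le> E x"
  shows "integrable lborel (\<lambda>x. indicator S x * (\<bar>idx_det (H x)\<bar> * f (gw x)))" (is ?int)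
    and "\<And>x. x \<in> S \<Longrightarrow> \<bar>idx_det (H x)\<bar> * f (gw x) \<le> E x"
    and "(LINT x|lborel. indicator T x * f x) \<le> (LINT x|lborel. indicator S x * (\<bar>idx_det (H x)\<bar> * f (gw x)))"
    and "(LINT x|lborel. indicator S x * (\<bar>idx_det (H x)\<bar> * f (gw x))) \<le> (LINT x|lborel. indicator S x * E x)"
proof -
  show le: "\<bar>idx_det (H x)\<bar> * f (gw x) \<le> E x" if "x \<in> S" for x
  proof -
    have "\<bar>idx_det (H x)\<bar> \<le> (op_trace (H x) / CARD('n)) ^ CARD('n)"
      using gw[OF that] sa[OF that] psd[OF that] by (intro idx_det_le_trace_power) (auto dest: has_derivative_linear)
    then have "\<bar>idx_det (H x)\<bar> * f (gw x) \<le> (op_trace (H x) / CARD('n)) ^ CARD('n) * f (gw x)"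
      using f by (intro mult_right_mono) auto
    then show ?thesis using E(2)[OF that] by linarith
  qed
  have cg: "continuous_on S gw"
    by (intro continuous_at_imp_continuous_on ballI has_derivative_continuous[OF gw])
  have cF: "continuous_on S (\<lambda>x. \<bar>idx_det (H x)\<bar> * f (gw x))"
    by (intro continuous_intros continuous_on_idx_det cont continuous_on_compose2[OF f(1) cg]) auto
  have mF: "(\<lambda>x. indicator S x * (\<bar>idx_det (H x)\<bar> * f (gw x))) \<in> borel_measurable borel"
    using borel_measurable_continuous_on_indicator[OF S cF] by simp
  have iE: "integrable lborel (\<lambda>x. indicator S x * E x)"
    using integrable_mult_indicator[OF _ E(1), of S] S by simp
  show int: ?int
    by (rule Bochner_Integration.integrable_bound[OF iE])
       (use mF le f in \<open>auto simp: indicator_def abs_mult intro!: order_trans[OF le abs_ge_self]\<close>)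
  show "(LINT x|lborel. indicator S x * (\<bar>idx_det (H x)\<bar> * f (gw x))) \<le> (LINT x|lborel. indicator S x * E x)"
    using int iE by (intro integral_mono) (auto simp: indicator_def le)
  have mf: "f \<in> borel_measurable borel" using f(1) by (rule borel_measurable_continuous_onI)
  show "(LINT x|lborel. indicator T x * f x) \<le> (LINT x|lborel. indicator S x * (\<bar>idx_det (H x)\<bar> * f (gw x)))"
    using integral_le_integral_idx_det[OF S T gw mf f(2) int] by simp
qed

text \<open>For a solution \<open>\<phi>\<close> in dimension \<open>n\<close>, \<open>u\<close> is the positive part of \<open>\<phi>\<close> to the power \<open>2 / (n - 2)\<close>, and \<open>gv\<close>, \<open>Hv\<close>
  are the gradient and the Hessian of \<open>v = 1 / u\<close> on the set where \<open>u\<close> is positive (elsewhere \<open>1 / u\<close> has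
  the junk value 0). \<open>Hv_trace\<close> is what the equation becomes for \<open>v\<close>.\<close>

locale conformal_factor =
  fixes u :: "real^'n::finite \<Rightarrow> real" and gv :: "real^'n \<Rightarrow> real^'n"
    and Hv :: "real^'n \<Rightarrow> real^'n \<Rightarrow> real^'n" and c :: real
  assumes dim_ge_2: "2 \<le> CARD('n)" and c_pos: "0 < c"
    and u_cont: "continuous_on UNIV u" and u_nonneg: "0 \<le> u x"
    and u_int: "integrable lborel (\<lambda>x. u x ^ CARD('n))"
    and gv: "0 < u x \<Longrightarrow> ((\<lambda>x. 1 / u x) has_derivative (\<lambda>h. gv x \<bullet> h)) (at x)"
    and Hv: "0 < u x \<Longrightarrow> (gv has_derivative Hv x) (at x)"
    and Hv_cont: "continuous_on {x. 0 < u x} (\<lambda>x. Hv x h)"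
    and Hv_sym: "0 < u x \<Longrightarrow> Hv x y \<bullet> z = y \<bullet> Hv x z"
    and Hv_trace: "0 < u x \<Longrightarrow> op_trace (Hv x) = CARD('n) * (u x * ((norm (gv x))\<^sup>2 + c) / 2)"
begin

definition \<Omega> where "\<Omega> = {x. 0 < u x}"

lemma open_\<Omega>: "open \<Omega>"
proof -
  have "\<Omega> = u -` {0<..}" by (auto simp: \<Omega>_def)
  then show ?thesis using u_cont by (simp add: continuous_on_open_vimage[of UNIV] open_vimage)
qed

lemma gv_cont: "continuous_on \<Omega> gv"
  by (intro continuous_at_imp_continuous_on ballI has_derivative_continuous[OF Hv]) (simp add: \<Omega>_def)

lemma v_cont: "continuous_on \<Omega> (\<lambda>x. 1 / u x)"
  by (intro continuous_at_imp_continuous_on ballI has_derivative_continuous[OF gv]) (simp add: \<Omega>_def)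

text \<open>\<open>1 / u\<close> is continuous only where \<open>u\<close> is positive, so the
  minimization is confined to a compact superlevel set. The level \<delta> is to be chosen so small
  that points with smaller \<open>u\<close> have too large a value of \<open>1 / u\<close> to
  compete.\<close>

lemma superlevel_attains_inf:
  assumes "0 < \<delta>" "\<delta> \<le> u x1" "dist y0 x1 \<le> R" "continuous_on UNIV (g :: real^'n \<Rightarrow> real)"
  obtains x where "\<delta> \<le> u x" "dist y0 x \<le> R"
    "\<And>y. \<delta> \<le> u y \<Longrightarrow> dist y0 y \<le> R \<Longrightarrow> 1 / u x + g x \<le> 1 / u y + g y"
proof -
  define K where "K = cball y0 R \<inter> u -` {\<delta>..}"
  have "compact K" unfolding K_def
    using u_cont by (intro compact_Int_closed compact_cball) (auto intro: continuous_closed_vimage simp: continuous_on_eq_continuous_at)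
  moreover have "x1 \<in> K" using assms by (simp add: K_def)
  moreover have "K \<subseteq> \<Omega>" using assms(1) by (auto simp: K_def \<Omega>_def)
  then have "continuous_on K (\<lambda>x. 1 / u x + g x)"
    using v_cont assms(4) by (intro continuous_on_add) (auto intro: continuous_on_subset)
  ultimately obtain x where "x \<in> K" "\<forall>y\<in>K. 1 / u x + g x \<le> 1 / u y + g y"
    using continuous_attains_inf[of K "\<lambda>x. 1 / u x + g x"] by auto
  then show ?thesis using that[of x] by (auto simp: K_def)
qed

text \<open>The contact set of \<open>1 / u + (2 m / R) |x - y0|\<^sup>2\<close> on the ball carries a definite amount of mass,
  because its gradient takes all values of norm less than \<open>m / 2\<close> there.\<close>

lemma ball_mass_lower_bound:
  assumes u0: "0 < u y0" and R: "0 < R" and m: "m = 1 / (u y0 * R)"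
  shows "measure lborel (ball (0 :: real^'n) 1) * (m / 2) ^ CARD('n)
    \<le> ((25 * m\<^sup>2 + c) / 2 + 6 * m\<^sup>2) ^ CARD('n) * (LINT x|lborel. indicator (ball y0 R) x * u x ^ CARD('n))"
proof -
  have m0: "0 < m" using u0 R by (simp add: m)
  have vy0: "1 / u y0 = m * R" using u0 R by (simp add: m)
  define U where "U = \<Omega> \<inter> ball y0 R"
  have oU: "open U" using open_\<Omega> by (auto simp: U_def)
  \<comment> \<open>On the sphere of radius \<open>R\<close> the paraboloid equals
    \<open>2 * m * R\<close>, while \<open>w y0 = m * R\<close>. Tilting by a slope of norm below
    \<open>m / 2\<close> changes values by at most \<open>m * R / 2\<close>, so the minimum stays in
    the interior.\<close>
  define w where "w x = 1 / u x + (2 * m / R) * ((x - y0) \<bullet> (x - y0))" for x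
  define gw where "gw x = gv x + (4 * m / R) *\<^sub>R (x - y0)" for x
  define Hw where "Hw x h = Hv x h + (4 * m / R) *\<^sub>R h" for x h
  have dw: "(w has_derivative (\<lambda>h. gw x \<bullet> h)) (at x)" if "x \<in> \<Omega>" for x
  proof -
    have 1: "((\<lambda>x. 1 / u x) has_derivative (\<lambda>h. gv x \<bullet> h)) (at x)" using gv that by (simp add: \<Omega>_def)
    have 2: "((\<lambda>x. (2 * m / R) * ((x - y0) \<bullet> (x - y0))) has_derivative
        (\<lambda>h. (2 * m / R) * ((x - y0) \<bullet> h + h \<bullet> (x - y0)))) (at x)"
      by (rule has_derivative_mult_right) (auto intro!: derivative_eq_intros)
    have "gv x \<bullet> h + (2 * m / R) * ((x - y0) \<bullet> h + h \<bullet> (x - y0)) = gw x \<bullet> h" for h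
      by (simp add: gw_def inner_add_left inner_commute[of h])
    then show ?thesis using has_derivative_add[OF 1 2] unfolding w_def by simp
  qed
  have dgw: "(gw has_derivative Hw x) (at x)" if "x \<in> \<Omega>" for x
  proof -
    have "(gv has_derivative Hv x) (at x)" using Hv that by (simp add: \<Omega>_def)
    then show ?thesis unfolding gw_def Hw_def by (auto intro!: derivative_eq_intros)
  qed
  have UO: "U \<subseteq> \<Omega>" by (auto simp: U_def)
  have cw: "continuous_on U w"
    by (intro continuous_at_imp_continuous_on ballI has_derivative_continuous[OF dw]) (use UO in auto)
  have cgw: "continuous_on U gw"
    by (intro continuous_at_imp_continuous_on ballI has_derivative_continuous[OF dgw]) (use UO in auto)
  \<comment> \<open>\<open>S1\<close> is the contact condition; \<open>S2\<close> and
    \<open>S3\<close> record the bounds on the slope and on \<open>1 / u\<close> at the minimizers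
    found below, which control the trace later.\<close>
  define S1 S2 S3 where "S1 = {x \<in> U. \<forall>y\<in>U. 0 \<le> w y - w x - gw x \<bullet> (y - x)}"
    and "S2 = {x \<in> U. \<forall>y\<in>{()}. 0 \<le> m / 2 - norm (gw x)}"
    and "S3 = {x \<in> U. \<forall>y\<in>{()}. 0 \<le> 3 / 2 * m * R - 1 / u x}"
  define S where "S = S1 \<inter> S2 \<inter> S3"
  have "closedin (top_of_set U) S1" "closedin (top_of_set U) S2" "closedin (top_of_set U) S3"
    unfolding S1_def S2_def S3_def
    by (intro closedin_Collect_ball_nonneg continuous_intros cw cgw continuous_on_subset[OF v_cont UO])+
  then have bS: "S \<in> sets borel" unfolding S_def using borel_closedin_open[OF oU] by auto
  have SU: "S \<subseteq> U" by (auto simp: S_def S1_def)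
  define T :: "(real^'n) set" where "T = ball 0 (m / 2)"
  have TS: "T \<subseteq> gw ` S"
  proof
    fix p assume "p \<in> T"
    then have p: "norm p < m / 2" by (simp add: T_def)
    define g where "g x = (2 * m / R) * ((x - y0) \<bullet> (x - y0)) - p \<bullet> (x - y0)" for x
    have cg: "continuous_on UNIV g" unfolding g_def by (intro continuous_intros)
    have py: "\<bar>p \<bullet> (y - y0)\<bar> \<le> m / 2 * R" if "dist y0 y \<le> R" for y
    proof -
      have "\<bar>p \<bullet> (y - y0)\<bar> \<le> norm p * norm (y - y0)" by (rule Cauchy_Schwarz_ineq2)
      also have "\<dots> \<le> m / 2 * R" using p that m0 by (intro mult_mono) (auto simp: dist_norm norm_minus_commute)
      finally show ?thesis .
    qed
    \<comment> \<open>Where \<open>u\<close> is below this level, \<open>1 / u\<close> exceeds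
      \<open>3 / 2 * m * R\<close>; since \<open>g\<close> is at least \<open>- (m / 2 * R)\<close>,
      the sum exceeds the value \<open>m * R\<close> at \<open>y0\<close>.\<close>
    define \<delta> where "\<delta> = 1 / (3 / 2 * m * R)"
    have \<delta>: "\<delta> > 0" "\<delta> \<le> u y0" using m0 R u0 by (auto simp: \<delta>_def m field_simps)
    obtain x where x: "\<delta> \<le> u x" "dist y0 x \<le> R"
      "\<And>y. \<delta> \<le> u y \<Longrightarrow> dist y0 y \<le> R \<Longrightarrow> 1 / u x + g x \<le> 1 / u y + g y"
      using superlevel_attains_inf[OF \<delta> _ cg, of y0 R] R by auto
    have ux: "0 < u x" using x \<delta> by linarith
    have val: "1 / u x + g x \<le> m * R" using x(3)[of y0] \<delta> R vy0 by (simp add: g_def)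
    have xmin: "1 / u x + g x \<le> 1 / u y + g y" if "y \<in> U" for y
    proof (cases "\<delta> \<le> u y")
      case True then show ?thesis using x(3) that by (simp add: U_def)
    next
      case False
      have "0 < u y" "dist y0 y \<le> R" using that by (auto simp: U_def \<Omega>_def)
      then have "1 / u y > 3 / 2 * m * R" using False m0 R by (simp add: \<delta>_def field_simps)
      moreover have "g y \<ge> - (m / 2 * R)"
      proof -
        have "0 \<le> (2 * m / R) * ((y - y0) \<bullet> (y - y0))" using m0 R by simp
        then show ?thesis using py[OF \<open>dist y0 y \<le> R\<close>] unfolding g_def by linarith
      qed
      ultimately show ?thesis using val by simp
    qed
    have "dist y0 x < R"
    proof (rule ccontr)
      assume "\<not> dist y0 x < R"
      then have "norm (x - y0) = R" using x(2) by (simp add: dist_norm norm_minus_commute)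
      then have "(2 * m / R) * ((x - y0) \<bullet> (x - y0)) = 2 * m * R"
        using R by (simp add: dot_square_norm power2_eq_square)
      then have "g x \<ge> 2 * m * R - m / 2 * R" using py[OF x(2)] unfolding g_def by linarith
      then have "g x \<ge> 3 / 2 * (m * R)" by (simp add: algebra_simps)
      moreover have "1 / u x > 0" "m * R > 0" using ux m0 R by auto
      ultimately show False using val by linarith
    qed
    then have xU: "x \<in> U" using ux by (simp add: U_def \<Omega>_def)
    have "((\<lambda>y. 1 / u y + g y) has_derivative (\<lambda>h. gw x \<bullet> h - p \<bullet> h)) (at x)"
    proof -
      have "(\<lambda>y. 1 / u y + g y) = (\<lambda>y. w y - p \<bullet> (y - y0))" by (simp add: w_def g_def fun_eq_iff)
      moreover have "((\<lambda>y. w y - p \<bullet> (y - y0)) has_derivative (\<lambda>h. gw x \<bullet> h - p \<bullet> h)) (at x)"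
        using dw[of x] xU UO by (auto intro!: derivative_eq_intros)
      ultimately show ?thesis by simp
    qed
    then have "(\<lambda>h. gw x \<bullet> h - p \<bullet> h) = (\<lambda>h. 0)"
      using differential_zero_maxmin[OF xU oU] xmin by blast
    then have "(gw x - p) \<bullet> (gw x - p) = 0" by (metis inner_diff_left)
    then have gp: "gw x = p" by simp
    have "x \<in> S1"
    proof -
      have "w y - w x - gw x \<bullet> (y - x) = (1 / u y + g y) - (1 / u x + g x)" for y
        unfolding gp w_def g_def by (simp add: inner_simps)
      then have "0 \<le> w y - w x - gw x \<bullet> (y - x)" if "y \<in> U" for y using xmin[OF that] by simp
      then show ?thesis using xU by (simp add: S1_def)
    qed
    moreover have "x \<in> S2" using xU p by (simp add: S2_def gp)
    moreover have "x \<in> S3"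
      using xU x(1) m0 R ux by (simp add: S3_def \<delta>_def field_simps)
    ultimately show "p \<in> gw ` S" using gp by (auto simp: S_def)
  qed
  \<comment> \<open>On \<open>S\<close>, \<open>norm (gv x)\<close> is at most m / 2 + 4 * m,
    bounded by 5 * m, which gives 25; the trace of the paraboloid contributes
    \<open>4 * m / R\<close>, at most \<open>6 * m\<^sup>2 * u x\<close> by
    \<open>S3\<close>.\<close>
  define C where "C = (25 * m\<^sup>2 + c) / 2 + 6 * m\<^sup>2"
  define E where "E x = C ^ CARD('n) * (indicator (ball y0 R) x * u x ^ CARD('n))" for x
  have iE: "integrable lborel E" unfolding E_def
    using integrable_mult_indicator[OF _ u_int, of "ball y0 R"] by (intro integrable_mult_right) simp
  have E: "(op_trace (Hw x) / CARD('n)) ^ CARD('n) * 1 \<le> E x" if xS: "x \<in> S" for x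
  proof -
    have xU: "x \<in> U" and ux: "0 < u x" using xS SU by (auto simp: U_def \<Omega>_def)
    have tr: "op_trace (Hw x) / CARD('n) = u x * ((norm (gv x))\<^sup>2 + c) / 2 + 4 * m / R"
    proof -
      have "op_trace (Hw x) = op_trace (Hv x) + CARD('n) * (4 * m / R)"
        by (simp add: op_trace_def Hw_def inner_simps sum.distrib)
      then show ?thesis using Hv_trace[OF ux] by (simp add: field_simps)
    qed
    have "norm (gv x) \<le> 5 * m"
    proof -
      have "gv x = gw x - (4 * m / R) *\<^sub>R (x - y0)" by (simp add: gw_def)
      then have "norm (gv x) \<le> norm (gw x) + norm ((4 * m / R) *\<^sub>R (x - y0))"
        by (metis norm_triangle_ineq4)
      also have "norm ((4 * m / R) *\<^sub>R (x - y0)) \<le> (4 * m / R) * R"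
      proof -
        have "norm ((4 * m / R) *\<^sub>R (x - y0)) = (4 * m / R) * norm (x - y0)" using m0 R by simp
        also have "\<dots> \<le> (4 * m / R) * R"
          using xU m0 R by (intro mult_left_mono) (auto simp: U_def dist_norm norm_minus_commute)
        finally show ?thesis .
      qed
      also have "\<dots> = 4 * m" using R by simp
      also have "norm (gw x) \<le> m / 2" using xS by (simp add: S_def S2_def)
      finally show ?thesis using m0 by simp
    qed
    then have "(norm (gv x))\<^sup>2 \<le> 25 * m\<^sup>2" using power_mono[of "norm (gv x)" "5 * m" 2] by (simp add: power_mult_distrib)
    then have 1: "u x * ((norm (gv x))\<^sup>2 + c) / 2 \<le> (25 * m\<^sup>2 + c) / 2 * u x" using ux by (simp add: field_simps mult_left_mono)
    have "1 / u x \<le> 3 / 2 * m * R" using xS by (simp add: S_def S3_def)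
    then have "1 \<le> 3 / 2 * m * R * u x" using ux by (simp add: field_simps)
    then have "4 * m / R * 1 \<le> 4 * m / R * (3 / 2 * m * R * u x)" using m0 R by (intro mult_left_mono) auto
    then have 2: "4 * m / R \<le> 6 * m\<^sup>2 * u x" using R by (simp add: power2_eq_square)
    have "0 \<le> op_trace (Hw x) / CARD('n)" unfolding tr using ux m0 R c_pos by (intro add_nonneg_nonneg) auto
    moreover have "op_trace (Hw x) / CARD('n) \<le> C * u x"
      unfolding tr C_def distrib_right[of _ _ "u x"] using 1 2 by (rule add_mono)
    ultimately have "(op_trace (Hw x) / CARD('n)) ^ CARD('n) \<le> (C * u x) ^ CARD('n)" by (rule power_mono[rotated])
    then show ?thesis using xU by (simp add: E_def U_def power_mult_distrib)
  qed
  have bd: "(LINT x|lborel. indicator T x * (1::real)) \<le> (LINT x|lborel. indicator S x * (\<bar>idx_det (Hw x)\<bar> * 1))"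
    "(LINT x|lborel. indicator S x * (\<bar>idx_det (Hw x)\<bar> * 1)) \<le> (LINT x|lborel. indicator S x * E x)"
  proof -
    have h1: "T \<in> sets borel" by (simp add: T_def)
    have h2: "(gw has_derivative Hw x) (at x)" if "x \<in> S" for x using dgw that SU UO by auto
    have h3: "continuous_on S (\<lambda>x. Hw x h)" for h unfolding Hw_def
      using Hv_cont[of h] SU UO by (intro continuous_intros) (auto simp: \<Omega>_def intro: continuous_on_subset)
    have h4: "Hw x y \<bullet> z = y \<bullet> Hw x z" if "x \<in> S" for x y z
    proof -
      have "0 < u x" using that SU UO by (auto simp: \<Omega>_def)
      then show ?thesis using Hv_sym by (simp add: Hw_def inner_simps)
    qed
    have h5: "0 \<le> Hw x y \<bullet> y" if "x \<in> S" for x y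
    proof (rule contact_point_psd[OF oU, of x w gw])
      show "x \<in> U" using that SU by auto
      show "w x + gw x \<bullet> (y - x) \<le> w y" if "y \<in> U" for y
        using that \<open>x \<in> S\<close> by (auto simp: S_def S1_def)
    qed (use that SU UO dw dgw in auto)
    have h6: "continuous_on UNIV (\<lambda>x::real^'n. 1::real)" by simp
    show "(LINT x|lborel. indicator T x * (1::real)) \<le> (LINT x|lborel. indicator S x * (\<bar>idx_det (Hw x)\<bar> * 1))"
      using contact_set_bound(3)[OF bS h1 TS h2 h3 h4 h5 h6 _ iE E] by simp
    show "(LINT x|lborel. indicator S x * (\<bar>idx_det (Hw x)\<bar> * 1)) \<le> (LINT x|lborel. indicator S x * E x)"
      using contact_set_bound(4)[OF bS h1 TS h2 h3 h4 h5 h6 _ iE E] by simp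
  qed
  have "measure lborel (ball (0 :: real^'n) 1) * (m / 2) ^ CARD('n) = measure lborel T"
    unfolding T_def using content_ball_conv_unit_ball[of "m / 2" "0 :: real^'n"] m0 by simp
  also have "\<dots> = (LINT x|lborel. indicator T x * (1::real))" by (simp add: T_def)
  also have "\<dots> \<le> (LINT x|lborel. indicator S x * E x)" using bd by linarith
  also have "\<dots> \<le> (LINT x|lborel. E x)"
  proof -
    have "m\<^sup>2 \<ge> 0" by simp
    then have "C \<ge> 0" using c_pos by (simp add: C_def)
    then have "0 \<le> E x" for x by (simp add: E_def u_nonneg)
    moreover have "integrable lborel (\<lambda>x. indicator S x * E x)"
      using integrable_mult_indicator[OF _ iE, of S] bS by simp
    ultimately show ?thesis using iE by (intro integral_mono) (auto simp: indicator_def)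
  qed
  also have "\<dots> = C ^ CARD('n) * (LINT x|lborel. indicator (ball y0 R) x * u x ^ CARD('n))"
    unfolding E_def by simp
  finally show ?thesis unfolding C_def .
qed

end

text \<open>For \<open>c = 1\<close> this is, up to a constant factor, the Jacobian of inverse
  stereographic projection; other \<open>c\<close> correspond to a rescaling.\<close>

definition weight :: "real \<Rightarrow> real^'n::finite \<Rightarrow> real" where
  "weight c p = 1 / ((norm p)\<^sup>2 + c) ^ CARD('n)"

lemma weight_pos: "0 < c \<Longrightarrow> 0 < weight c p"
  by (simp add: weight_def add_nonneg_pos)

lemma weight_cont:
  assumes "0 < c"
  shows "continuous_on UNIV (weight c :: real^'n::finite \<Rightarrow> real)"
proof -
  have "((norm p)\<^sup>2 + c) ^ CARD('n) \<noteq> 0" for p :: "real^'n"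
    using add_nonneg_pos[OF zero_le_power2[of "norm p"] assms] by simp
  then show ?thesis unfolding weight_def by (intro continuous_intros) auto
qed

section \<open>The global contact set: decay, lower mass bound and rigidity\<close>

context conformal_factor begin

lemma integrable_indicator_mass:
  "A \<in> sets borel \<Longrightarrow> integrable lborel (\<lambda>x. indicator A x * u x ^ CARD('n))"
  using integrable_mult_indicator[OF _ u_int, of A] by simp

text \<open>Dominated convergence makes the mass outside a large ball small, and a ball about
  \<open>y\<close> of radius \<open>norm y / 2\<close> keeps the distance \<open>norm y / 2\<close>
  from the origin.\<close>

lemma tail_mass_small:
  assumes "0 < \<epsilon>"
  obtains R where "0 < R" "\<And>y. 2 * R < norm y \<Longrightarrow>
    (LINT x|lborel. indicator (ball y (norm y / 2)) x * u x ^ CARD('n)) < \<epsilon>"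
proof -
  define I where "I k = {x :: real^'n. real k < norm x}" for k :: nat
  have oI: "open (I k)" for k unfolding I_def by (intro open_Collect_less continuous_intros)
  have "(\<lambda>k. LINT x|lborel. indicator (I k) x * u x ^ CARD('n)) \<longlonglongrightarrow> (LINT x|(lborel :: (real^'n) measure). 0)"
  proof (rule integral_dominated_convergence)
    show "integrable lborel (\<lambda>x. u x ^ CARD('n))" by (rule u_int)
    show "(\<lambda>x. indicator (I k) x * u x ^ CARD('n)) \<in> borel_measurable lborel" for k
      using borel_measurable_integrable[OF integrable_indicator_mass[of "I k"]] oI by simp
    show "AE x in lborel. (\<lambda>k. indicator (I k) x * u x ^ CARD('n)) \<longlonglongrightarrow> 0"
    proof (rule AE_I2)
      fix x :: "real^'n"
      have "\<forall>\<^sub>F k in sequentially. indicator (I k) x * u x ^ CARD('n) = 0"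
        using eventually_ge_at_top[of "nat \<lceil>norm x\<rceil>"]
        by eventually_elim (auto simp: I_def indicator_def nat_ceiling_le_eq)
      then show "(\<lambda>k. indicator (I k) x * u x ^ CARD('n)) \<longlonglongrightarrow> 0" by (rule tendsto_eventually)
    qed
  qed (auto simp: indicator_def u_nonneg)
  then have "\<forall>\<^sub>F k in sequentially. (LINT x|lborel. indicator (I k) x * u x ^ CARD('n)) < \<epsilon>"
    using assms by (auto dest: order_tendstoD(2))
  then obtain k0 where "\<forall>k\<ge>k0. (LINT x|lborel. indicator (I k) x * u x ^ CARD('n)) < \<epsilon>"
    by (auto simp: eventually_sequentially)
  then have k: "(LINT x|lborel. indicator (I (Suc k0)) x * u x ^ CARD('n)) < \<epsilon>" by simp
  show ?thesis
  proof (rule that[of "real (Suc k0)"])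
    fix y :: "real^'n" assume y: "2 * real (Suc k0) < norm y"
    have "ball y (norm y / 2) \<subseteq> I (Suc k0)"
    proof
      fix x assume "x \<in> ball y (norm y / 2)"
      then have "norm (y - x) < norm y / 2" by (simp add: dist_norm)
      then show "x \<in> I (Suc k0)" using y norm_triangle_ineq2[of y x] unfolding I_def by simp
    qed
    then have "(LINT x|lborel. indicator (ball y (norm y / 2)) x * u x ^ CARD('n))
        \<le> (LINT x|lborel. indicator (I (Suc k0)) x * u x ^ CARD('n))"
      using oI by (intro integral_mono integrable_indicator_mass) (auto simp: indicator_def u_nonneg)
    then show "(LINT x|lborel. indicator (ball y (norm y / 2)) x * u x ^ CARD('n)) < \<epsilon>" using k by linarith
  qed simp
qed

text \<open>By the lower mass bound, \<open>|x| u x\<close> avoids any given value outside a large ball. The complement of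
  the ball is connected, so \<open>|x| u x\<close> stays on one side of that value; it cannot stay above, since
  \<open>|x|\<close> to the power minus the dimension is not integrable at infinity.\<close>

lemma decay:
  assumes m0: "0 < m0"
  obtains R where "0 < R" "\<And>x. R < norm x \<Longrightarrow> m0 * norm x * u x < 1"
proof -
  let ?\<kappa> = "measure lborel (ball (0 :: real^'n) 1)"
  have kap: "?\<kappa> > 0" by (simp add: content_ball_pos)
  \<comment> \<open>If \<open>m0 * norm y * u y = 1\<close>, then
    \<open>1 / u y = m * (norm y / 2)\<close>, which is the normalization of
    \<open>ball_mass_lower_bound\<close> at radius \<open>norm y / 2\<close>.\<close>
  define m where "m = 2 * m0"
  define C where "C = (25 * m\<^sup>2 + c) / 2 + 6 * m\<^sup>2"
  have C: "C > 0" unfolding C_def using c_pos by (intro add_pos_nonneg divide_pos_pos add_nonneg_pos) auto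
  have mpos: "m > 0" using m0 by (simp add: m_def)
  \<comment> \<open>The first bound contradicts the local mass bound when the product equals 1
    somewhere, the second contradicts the mass of a ball on which the product stays above 1. Neither
    depends on the radius of the ball.\<close>
  define \<epsilon> where "\<epsilon> = min (?\<kappa> * (m / 2) ^ CARD('n) / C ^ CARD('n)) (?\<kappa> * (1 / (3 * m0)) ^ CARD('n))"
  have eps: "\<epsilon> > 0" using kap C mpos m0 by (simp add: \<epsilon>_def)
  obtain R where R: "0 < R" and tail: "\<And>y. 2 * R < norm y \<Longrightarrow>
    (LINT x|lborel. indicator (ball y (norm y / 2)) x * u x ^ CARD('n)) < \<epsilon>"
    using tail_mass_small[OF eps] by blast
  define h where "h x = m0 * norm x * u x" for x
  have ne: "h y \<noteq> 1" if y: "2 * R < norm y" for y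
  proof
    assume h1: "h y = 1"
    have ny: "norm y > 0" using y R by linarith
    then have uy: "u y > 0" using h1 m0 u_nonneg[of y] by (cases "u y = 0") (auto simp: h_def)
    have "m = 1 / (u y * (norm y / 2))" using h1 ny uy by (simp add: m_def h_def field_simps)
    from ball_mass_lower_bound[OF uy _ this]
    have "?\<kappa> * (m / 2) ^ CARD('n) \<le> C ^ CARD('n) * (LINT x|lborel. indicator (ball y (norm y / 2)) x * u x ^ CARD('n))"
      using ny unfolding C_def by simp
    also have "\<dots> < C ^ CARD('n) * \<epsilon>" using tail[OF y] C by (intro mult_strict_left_mono) auto
    also have "\<dots> \<le> C ^ CARD('n) * (?\<kappa> * (m / 2) ^ CARD('n) / C ^ CARD('n))"
      unfolding \<epsilon>_def using C by (intro mult_left_mono) auto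
    also have "\<dots> = ?\<kappa> * (m / 2) ^ CARD('n)" using C by simp
    finally show False by simp
  qed
  have conn: "connected (h ` (- cball 0 (2 * R)))"
  proof (rule connected_continuous_image)
    show "continuous_on (- cball 0 (2 * R)) h" unfolding h_def
      by (intro continuous_intros continuous_on_subset[OF u_cont]) auto
    show "connected (- cball (0 :: real^'n) (2 * R))"
      using dim_ge_2 by (intro connected_complement_bounded_convex) auto
  qed
  have less: "h x < 1" if x: "2 * R < norm x" for x
  proof (rule ccontr)
    assume "\<not> h x < 1"
    have all: "h y > 1" if "2 * R < norm y" for y
    proof (rule ccontr)
      assume "\<not> h y > 1"
      then have "1 \<in> {h y..h x}" using \<open>\<not> h x < 1\<close> by simp
      moreover have "{h y..h x} \<subseteq> h ` (- cball 0 (2 * R))"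
        using x that by (intro connected_contains_Icc[OF conn]) auto
      ultimately show False using ne by auto
    qed
    \<comment> \<open>With \<open>norm y = 5 * R\<close> the ball of radius
      \<open>norm y / 2\<close> stays outside radius \<open>2 * R\<close>. Its points have norm at
      most \<open>3 / 2 * norm y\<close>, so \<open>b\<close> bounds \<open>u\<close> from below
      there, and \<open>norm y / 2 * b = 1 / (3 * m0)\<close>.\<close>
    obtain y :: "real^'n" where y: "norm y = 5 * R" using vector_choose_size[of "5 * R"] R by auto
    define b where "b = 1 / (m0 * (3 / 2 * norm y))"
    have ub: "b \<le> u z" if "z \<in> ball y (norm y / 2)" for z
    proof -
      have d: "norm (y - z) < norm y / 2" using that by (simp add: dist_norm)
      have z1: "2 * R < norm z" using d y R norm_triangle_ineq2[of y z] by linarith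
      have z2: "norm z \<le> 3 / 2 * norm y" using d norm_triangle_ineq2[of z y] by (simp add: norm_minus_commute)
      have "1 < m0 * norm z * u z" using all[OF z1] by (simp add: h_def)
      also have "\<dots> \<le> m0 * (3 / 2 * norm y) * u z"
        using z2 m0 u_nonneg by (intro mult_right_mono mult_left_mono) auto
      finally show ?thesis using m0 y R by (simp add: b_def field_simps)
    qed
    have "?\<kappa> * (1 / (3 * m0)) ^ CARD('n) = measure lborel (ball y (norm y / 2)) * b ^ CARD('n)"
    proof -
      have "(norm y / 2) ^ CARD('n) * b ^ CARD('n) = (1 / (3 * m0)) ^ CARD('n)"
        unfolding power_mult_distrib[symmetric] b_def using y R m0 by (simp add: field_simps)
      then show ?thesis using content_ball_conv_unit_ball[of "norm y / 2" y] by simp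
    qed
    also have "\<dots> = (LINT x|lborel. indicator (ball y (norm y / 2)) x * b ^ CARD('n))" by simp
    also have "\<dots> \<le> (LINT x|lborel. indicator (ball y (norm y / 2)) x * u x ^ CARD('n))"
    proof (rule integral_mono)
      show "integrable lborel (\<lambda>x. indicator (ball y (norm y / 2)) x * b ^ CARD('n))"
        by (intro integrable_mult_left integrable_real_indicator emeasure_lborel_ball_finite) auto
      show "integrable lborel (\<lambda>x. indicator (ball y (norm y / 2)) x * u x ^ CARD('n))"
        by (rule integrable_indicator_mass) simp
      show "indicator (ball y (norm y / 2)) x * b ^ CARD('n) \<le> indicator (ball y (norm y / 2)) x * u x ^ CARD('n)" for x
        using ub[of x] m0 by (auto simp: indicator_def b_def intro!: power_mono)
    qed
    also have "\<dots> < \<epsilon>" using y R by (intro tail) simp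
    also have "\<dots> \<le> ?\<kappa> * (1 / (3 * m0)) ^ CARD('n)" by (simp add: \<epsilon>_def)
    finally show False by simp
  qed
  show ?thesis
  proof (rule that[of "2 * R"])
    show "m0 * norm x * u x < 1" if "2 * R < norm x" for x using less[OF that] by (simp add: h_def)
  qed (use R in simp)
qed

definition contact where
  "contact = {x \<in> \<Omega>. \<forall>y\<in>\<Omega>. 0 \<le> 1 / u y - 1 / u x - gv x \<bullet> (y - x)}"

lemma closedin_contact: "closedin (top_of_set \<Omega>) contact"
  unfolding contact_def
  by (intro closedin_Collect_ball_nonneg continuous_intros v_cont gv_cont)

text \<open>Any minimizer of \<open>1 / u x - p \<bullet> x\<close> over the positivity set is a
  contact point with gradient \<open>p\<close>. It exists because \<open>1 / u\<close> outgrows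
  \<open>(norm p + 1) * norm x\<close> at infinity and becomes arbitrarily large near the
  boundary.\<close>

lemma contact_gradients_surj:
  assumes x1: "0 < u x1"
  shows "gv ` contact = UNIV"
proof -
  have "p \<in> gv ` contact" for p
  proof -
    define m0 where "m0 = norm p + 1"
    have m0: "m0 > 0" by (simp add: m0_def add_nonneg_pos)
    obtain R where R: "0 < R" "\<And>x. R < norm x \<Longrightarrow> m0 * norm x * u x < 1" using decay[OF m0] by blast
    define a where "a = 1 / u x1 - p \<bullet> x1"
    \<comment> \<open>Beyond \<open>R'\<close> the function exceeds \<open>norm y\<close>, hence
      \<open>R'\<close>, hence the comparison value \<open>a\<close> at \<open>x1\<close>; the last
      summand keeps \<open>x1\<close> inside the ball.\<close>
    define R' where "R' = R + \<bar>a\<bar> + norm x1"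
    \<comment> \<open>Inside the ball, \<open>1 / u y > M\<close> forces a value above
      \<open>\<bar>a\<bar> + 1\<close>, so such points cannot compete with
      \<open>x1\<close>.\<close>
    define M where "M = \<bar>a\<bar> + norm p * R' + 1"
    have R'0: "R' > 0" using R by (simp add: R'_def add_pos_nonneg)
    have M0: "M > 0" using R'0 by (simp add: M_def add_nonneg_pos)
    have np: "\<bar>p \<bullet> y\<bar> \<le> norm p * norm y" for y by (rule Cauchy_Schwarz_ineq2)
    have "1 / u x1 \<le> M"
    proof -
      have "norm p * norm x1 \<le> norm p * R'" using R by (intro mult_left_mono) (auto simp: R'_def)
      then show ?thesis using np[of x1] by (simp add: M_def a_def)
    qed
    then have \<delta>: "0 < 1 / M" "1 / M \<le> u x1" using M0 x1 by (auto simp: field_simps)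
    have cg: "continuous_on UNIV (\<lambda>x. - (p \<bullet> x))" by (intro continuous_intros)
    obtain x where x: "1 / M \<le> u x" "dist 0 x \<le> R'"
      "\<And>y. 1 / M \<le> u y \<Longrightarrow> dist 0 y \<le> R' \<Longrightarrow> 1 / u x + - (p \<bullet> x) \<le> 1 / u y + - (p \<bullet> y)"
      using superlevel_attains_inf[OF \<delta> _ cg, of 0 R'] R by (auto simp: R'_def)
    have ux: "0 < u x" using x \<delta> by linarith
    have val: "1 / u x - p \<bullet> x \<le> a" using x(3)[of x1] \<delta> R by (simp add: a_def R'_def)
    have xmin: "1 / u x - p \<bullet> x \<le> 1 / u y - p \<bullet> y" if "y \<in> \<Omega>" for y
    proof -
      have uy: "0 < u y" using that by (simp add: \<Omega>_def)
      consider "1 / M \<le> u y" "norm y \<le> R'" | "norm y > R'" | "1 / M > u y" "norm y \<le> R'" by linarith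
      then show ?thesis
      proof cases
        case 1 then show ?thesis using x(3)[of y] by simp
      next
        case 2
        have "R < norm y" using 2 norm_ge_zero[of x1] unfolding R'_def by linarith
        then have "m0 * norm y < 1 / u y" using R(2) uy by (simp add: field_simps)
        then have "norm y < 1 / u y - p \<bullet> y" using np[of y] by (simp add: m0_def algebra_simps)
        moreover have "a \<le> R'" using R norm_ge_zero[of x1] unfolding R'_def by linarith
        ultimately show ?thesis using val 2 by linarith
      next
        case 3
        have "M < 1 / u y" using 3 uy M0 by (simp add: field_simps)
        moreover have "norm p * norm y \<le> norm p * R'" using 3 by (simp add: mult_left_mono)
        ultimately show ?thesis using val np[of y] by (simp add: M_def)
      qed
    qed
    have xO: "x \<in> \<Omega>" using ux by (simp add: \<Omega>_def)
    have "((\<lambda>y. 1 / u y - p \<bullet> y) has_derivative (\<lambda>h. gv x \<bullet> h - p \<bullet> h)) (at x)"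
      by (intro has_derivative_diff gv[OF ux] has_derivative_inner_right has_derivative_ident)
    then have "(\<lambda>h. gv x \<bullet> h - p \<bullet> h) = (\<lambda>h. 0)"
      using differential_zero_maxmin[OF xO open_\<Omega>] xmin by blast
    then have "(gv x - p) \<bullet> (gv x - p) = 0" by (metis inner_diff_left)
    then have gp: "gv x = p" by simp
    have "x \<in> contact" using xO xmin by (auto simp: contact_def gp inner_diff_right algebra_simps)
    then show ?thesis using gp by auto
  qed
  then show ?thesis by auto
qed

lemma trace_weight_eq:
  assumes "0 < u x"
  shows "(op_trace (Hv x) / CARD('n)) ^ CARD('n) * weight c (gv x) = (u x / 2) ^ CARD('n)"
proof -
  have p: "(norm (gv x))\<^sup>2 + c > 0" using c_pos by (simp add: add_nonneg_pos)
  have tr: "op_trace (Hv x) / CARD('n) = (u x / 2) * ((norm (gv x))\<^sup>2 + c)"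
    using Hv_trace[OF assms] by simp
  show ?thesis unfolding tr weight_def power_mult_distrib using p by simp
qed

text \<open>This is \<open>contact_set_bound\<close> with the full space as target, available
  because \<open>gv\<close> maps \<open>contact\<close> onto it; by \<open>trace_weight_eq\<close>
  the majorant no longer contains the gradient.\<close>

lemma contact_bound_facts:
  assumes x1: "0 < u x1"
  shows "integrable lborel (\<lambda>x. indicator contact x * (\<bar>idx_det (Hv x)\<bar> * weight c (gv x)))"
    and "x \<in> contact \<Longrightarrow> \<bar>idx_det (Hv x)\<bar> * weight c (gv x) \<le> (u x / 2) ^ CARD('n)"
    and "(LINT (p::real^'n)|lborel. weight c p) \<le> (LINT x|lborel. indicator contact x * (\<bar>idx_det (Hv x)\<bar> * weight c (gv x)))"
    and "(LINT x|lborel. indicator contact x * (\<bar>idx_det (Hv x)\<bar> * weight c (gv x))) \<le> (LINT x|lborel. indicator contact x * (u x / 2) ^ CARD('n))"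
    and "integrable lborel (\<lambda>x. (u x / 2) ^ CARD('n))"
    and "contact \<in> sets borel"
    and "x \<in> contact \<Longrightarrow> 0 \<le> Hv x h \<bullet> h"
proof -
  have cO: "contact \<subseteq> \<Omega>" by (auto simp: contact_def)
  show bS: "contact \<in> sets borel" by (rule borel_closedin_open[OF open_\<Omega> closedin_contact])
  have dg: "(gv has_derivative Hv x) (at x)" if "x \<in> contact" for x using Hv that cO by (auto simp: \<Omega>_def)
  have cH: "continuous_on contact (\<lambda>x. Hv x h)" for h
    using Hv_cont[of h] cO by (auto simp: \<Omega>_def intro: continuous_on_subset)
  have sa: "Hv x y \<bullet> z = y \<bullet> Hv x z" if "x \<in> contact" for x y z using Hv_sym that cO by (auto simp: \<Omega>_def)
  show psd: "0 \<le> Hv x h \<bullet> h" if "x \<in> contact" for x h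
  proof (rule contact_point_psd[OF open_\<Omega>, of x "\<lambda>x. 1 / u x" gv])
    show "x \<in> \<Omega>" "(gv has_derivative Hv x) (at x)" using that cO dg by auto
    show "((\<lambda>x. 1 / u x) has_derivative (\<lambda>h. gv y \<bullet> h)) (at y)" if "y \<in> \<Omega>" for y
      using gv that by (simp add: \<Omega>_def)
    show "1 / u x + gv x \<bullet> (y - x) \<le> 1 / u y" if "y \<in> \<Omega>" for y
      using that \<open>x \<in> contact\<close> by (auto simp: contact_def)
  qed
  show iE: "integrable lborel (\<lambda>x. (u x / 2) ^ CARD('n))" using u_int by (simp add: power_divide)
  have E: "(op_trace (Hv x) / CARD('n)) ^ CARD('n) * weight c (gv x) \<le> (u x / 2) ^ CARD('n)" if "x \<in> contact" for x
    using trace_weight_eq[of x] that cO by (auto simp: \<Omega>_def)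
  note * = contact_set_bound[OF bS _ _ dg cH sa psd weight_cont[OF c_pos] less_imp_le[OF weight_pos[OF c_pos]] iE E, of UNIV,
      unfolded contact_gradients_surj[OF x1], simplified]
  show "integrable lborel (\<lambda>x. indicator contact x * (\<bar>idx_det (Hv x)\<bar> * weight c (gv x)))"
    and "x \<in> contact \<Longrightarrow> \<bar>idx_det (Hv x)\<bar> * weight c (gv x) \<le> (u x / 2) ^ CARD('n)"
    and "(LINT (p::real^'n)|lborel. weight c p) \<le> (LINT x|lborel. indicator contact x * (\<bar>idx_det (Hv x)\<bar> * weight c (gv x)))"
    and "(LINT x|lborel. indicator contact x * (\<bar>idx_det (Hv x)\<bar> * weight c (gv x))) \<le> (LINT x|lborel. indicator contact x * (u x / 2) ^ CARD('n))"
    using * by auto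
qed

theorem mass_lower_bound:
  assumes x1: "0 < u x1"
  shows "(LINT (p::real^'n)|lborel. weight c p) \<le> (LINT x|lborel. (u x / 2) ^ CARD('n))"
proof -
  note f = contact_bound_facts[OF x1]
  have "(LINT x|lborel. indicator contact x * (u x / 2) ^ CARD('n)) \<le> (LINT x|lborel. (u x / 2) ^ CARD('n))"
    using integrable_mult_indicator[OF _ f(5), of contact] f(5,6)
    by (intro integral_mono) (auto simp: indicator_def u_nonneg)
  then show ?thesis using f(3,4) by linarith
qed

text \<open>Equality of the outer integrals forces the integrand \<open>F\<close> of the area
  inequality to agree almost everywhere with its majorant \<open>E\<close>. Openness of the relevant
  exceptional sets turns this into a pointwise equality, where the rigidity of the determinant-trace
  inequality applies.\<close>

lemma hessian_scalar_of_equality: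
  assumes eq: "(LINT (p::real^'n)|lborel. weight c p) = (LINT x|lborel. (u x / 2) ^ CARD('n))" and ux: "0 < u x"
  shows "Hv x h = (u x * ((norm (gv x))\<^sup>2 + c) / 2) *\<^sub>R h"
proof -
  note f = contact_bound_facts[OF ux]
  define F where "F = (\<lambda>x. indicator contact x * (\<bar>idx_det (Hv x)\<bar> * weight c (gv x)))"
  define E where "E = (\<lambda>x. (u x / 2) ^ CARD('n))"
  have FE: "F x \<le> E x" for x using f(2)[of x] by (auto simp: F_def E_def indicator_def u_nonneg)
  have iF: "integrable lborel F" and iE: "integrable lborel E" using f(1,5) by (simp_all only: F_def E_def)
  have "(LINT x|lborel. E x - F x) = 0"
  proof -
    have "(LINT x|lborel. E x) \<le> (LINT x|lborel. F x)" using f(3) eq unfolding E_def F_def by simp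
    moreover have "(LINT x|lborel. F x) \<le> (LINT x|lborel. E x)" by (intro integral_mono iF iE FE)
    ultimately show ?thesis using iE iF by simp
  qed
  then have "AE x in lborel. E x - F x = 0"
    using iE iF FE by (subst integral_nonneg_eq_0_iff_AE[symmetric]) auto
  then have ae: "AE x in lborel. E x = F x" by simp
  \<comment> \<open>Off \<open>contact\<close> the integrand \<open>F\<close> is zero while
    \<open>E\<close> is positive on \<Omega>, and the difference set is open.\<close>
  have "\<Omega> - contact = {}"
  proof (rule AE_lborel_open_empty[OF ae])
    have "openin (top_of_set \<Omega>) (\<Omega> - contact)"
      using closedin_contact openin_diff[OF openin_subtopology_self] by auto
    then show "open (\<Omega> - contact)" using open_\<Omega> openin_open_trans by blast
    show "E x \<noteq> F x" if "x \<in> \<Omega> - contact" for x using that by (auto simp: E_def F_def \<Omega>_def)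
  qed
  then have OC: "\<Omega> \<subseteq> contact" by auto
  \<comment> \<open>Without the indicator the deficit is continuous on \<Omega>, so the set where it
    is positive is open.\<close>
  define G where "G x = E x - \<bar>idx_det (Hv x)\<bar> * weight c (gv x)" for x
  have cG: "continuous_on \<Omega> G" unfolding G_def E_def
    using Hv_cont
    by (intro continuous_intros continuous_on_idx_det continuous_on_compose2[OF weight_cont[OF c_pos] gv_cont]
        continuous_on_subset[OF u_cont]) (auto simp: \<Omega>_def)
  have "\<Omega> \<inter> G -` {0<..} = {}"
  proof (rule AE_lborel_open_empty[OF ae])
    show "open (\<Omega> \<inter> G -` {0<..})" using cG open_\<Omega> by (rule continuous_open_preimage) auto
    show "E x \<noteq> F x" if "x \<in> \<Omega> \<inter> G -` {0<..}" for x using that OC by (auto simp: G_def F_def indicator_def)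
  qed
  moreover have xO: "x \<in> \<Omega>" using ux by (simp add: \<Omega>_def)
  ultimately have "E x \<le> \<bar>idx_det (Hv x)\<bar> * weight c (gv x)" by (auto simp: G_def)
  moreover have xc: "x \<in> contact" using xO OC by auto
  ultimately have "\<bar>idx_det (Hv x)\<bar> * weight c (gv x) = (op_trace (Hv x) / CARD('n)) ^ CARD('n) * weight c (gv x)"
    using f(2)[OF xc] unfolding trace_weight_eq[OF ux] E_def by (intro order_antisym)
  then have "\<bar>idx_det (Hv x)\<bar> = (op_trace (Hv x) / CARD('n)) ^ CARD('n)"     using weight_pos[OF c_pos, of "gv x"] by (metis less_irrefl mult_cancel_right)
  moreover have "op_trace (Hv x) > 0"
    unfolding Hv_trace[OF ux] using ux c_pos by (intro mult_pos_pos divide_pos_pos add_nonneg_pos) auto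
  ultimately have "Hv x h = (op_trace (Hv x) / CARD('n)) *\<^sub>R h"
    using Hv_sym[OF ux] f(7)[OF xc] has_derivative_linear[OF Hv[OF ux]] by (intro idx_det_le_trace_power(2)) auto
  then show ?thesis using Hv_trace[OF ux] by simp
qed

text \<open>A Hessian \<open>\<alpha> x\<close> times the identity with constant \<alpha> integrates
  to a quadratic polynomial \<open>Q\<close> on every ball about \<open>x1\<close> inside \<Omega>.
  The largest such ball would touch a zero of \<open>u\<close>, yet \<open>u x * Q x = 1\<close>
  persists on its closure; hence \<Omega> is the whole space.\<close>

theorem quadratic_of_equality:
  assumes eq: "(LINT (p::real^'n)|lborel. weight c p) = (LINT x|lborel. (u x / 2) ^ CARD('n))" and x1: "0 < u x1"
  obtains a b x0 where "0 < a" "0 < b" "\<And>x. u x = 1 / (a * (norm (x - x0))\<^sup>2 + b)"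
proof -
  define \<alpha> where "\<alpha> x = u x * ((norm (gv x))\<^sup>2 + c) / 2" for x
  have dgv: "(gv has_derivative (\<lambda>h. \<alpha> x *\<^sub>R h)) (at x)" if "x \<in> \<Omega>" for x
  proof -
    have "0 < u x" using that by (simp add: \<Omega>_def)
    then have "Hv x = (\<lambda>h. \<alpha> x *\<^sub>R h)" using hessian_scalar_of_equality[OF eq] by (auto simp: \<alpha>_def)
    then show ?thesis using Hv[OF \<open>0 < u x\<close>] by simp
  qed
  have du: "(u has_derivative (\<lambda>h. - (u x)\<^sup>2 * (gv x \<bullet> h))) (at x)" if "x \<in> \<Omega>" for x
  proof -
    have ux: "0 < u x" using that by (simp add: \<Omega>_def)
    have "((\<lambda>x. inverse (1 / u x)) has_derivative (\<lambda>h. - (inverse (1 / u x) * (gv x \<bullet> h) * inverse (1 / u x)))) (at x)"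
      using ux by (intro Deriv.has_derivative_inverse[OF _ gv[OF ux]]) auto
    then show ?thesis by (simp add: power2_eq_square mult_ac)
  qed
  \<comment> \<open>Third derivatives are avoided by differentiating the explicit formula for
    \<alpha>: the derivative is \<open>2 * u x * (gv x \<bullet> h)\<close> times the difference of
    \<open>\<alpha> x\<close> and that same formula, so it vanishes.\<close>
  have d\<alpha>: "(\<alpha> has_derivative (\<lambda>h. 0)) (at x)" if "x \<in> \<Omega>" for x
  proof -
    have "((\<lambda>x. u x * (gv x \<bullet> gv x + c) / 2) has_derivative
       (\<lambda>h. (u x * (gv x \<bullet> (\<alpha> x *\<^sub>R h) + (\<alpha> x *\<^sub>R h) \<bullet> gv x) + (- (u x)\<^sup>2 * (gv x \<bullet> h)) * (gv x \<bullet> gv x + c)) / 2)) (at x)"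
      using du[OF that] dgv[OF that] by (auto intro!: derivative_eq_intros)
    moreover have "(u x * (gv x \<bullet> (\<alpha> x *\<^sub>R h) + (\<alpha> x *\<^sub>R h) \<bullet> gv x) + (- (u x)\<^sup>2 * (gv x \<bullet> h)) * (gv x \<bullet> gv x + c)) / 2 = 0" for h
      by (simp add: \<alpha>_def dot_square_norm power2_eq_square inner_commute[of h] algebra_simps add_divide_distrib)
    ultimately show ?thesis unfolding \<alpha>_def by (simp add: dot_square_norm)
  qed
  define a where "a = \<alpha> x1"
  have a0: "a > 0" using x1 c_pos by (simp add: a_def \<alpha>_def add_nonneg_pos)
  define Q where "Q x = 1 / u x1 + gv x1 \<bullet> (x - x1) + a / 2 * ((x - x1) \<bullet> (x - x1))" for x
  have local: "1 / u x = Q x" if S: "ball x1 r \<subseteq> \<Omega>" "x \<in> ball x1 r" for x r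
  proof -
    have x1S: "x1 \<in> ball x1 r" using S(2) by (auto intro: le_less_trans[OF zero_le_dist])
    have \<alpha>c: "\<alpha> y = a" if "y \<in> ball x1 r" for y
      unfolding a_def
    proof (rule has_derivative_zero_unique[of "ball x1 r" \<alpha>])
      show "(\<alpha> has_derivative (\<lambda>h. 0)) (at z within ball x1 r)" if "z \<in> ball x1 r" for z
        using d\<alpha> S that by (blast intro: has_derivative_at_withinI)
    qed (use x1S that in auto)
    have gvc: "gv y = gv x1 + a *\<^sub>R (y - x1)" if y: "y \<in> ball x1 r" for y
    proof -
      have "((\<lambda>y. gv y - a *\<^sub>R y) has_derivative (\<lambda>h. 0)) (at z)" if "z \<in> ball x1 r" for z
        using dgv[of z] S that \<alpha>c[OF that] by (auto intro!: derivative_eq_intros)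
      then have "gv y - a *\<^sub>R y = gv x1 - a *\<^sub>R x1"
        using x1S y by (intro has_derivative_zero_unique[of "ball x1 r" "\<lambda>y. gv y - a *\<^sub>R y"])
          (auto intro: has_derivative_at_withinI)
      then show ?thesis by (simp add: algebra_simps)
    qed
    have "((\<lambda>y. 1 / u y - Q y) has_derivative (\<lambda>h. 0)) (at z)" if z: "z \<in> ball x1 r" for z
    proof -
      have uz: "0 < u z" using S z by (auto simp: \<Omega>_def)
      have "((\<lambda>y. 1 / u y - Q y) has_derivative
          (\<lambda>h. gv z \<bullet> h - (gv x1 \<bullet> h + a / 2 * ((z - x1) \<bullet> h + h \<bullet> (z - x1))))) (at z)"
        unfolding Q_def by (rule has_derivative_diff[OF gv[OF uz]]) (auto intro!: derivative_eq_intros)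
      moreover have "gv z \<bullet> h - (gv x1 \<bullet> h + a / 2 * ((z - x1) \<bullet> h + h \<bullet> (z - x1))) = 0" for h
        using gvc[OF z] by (simp add: inner_simps inner_commute[of h])
      ultimately show ?thesis by simp
    qed
    then have "1 / u x - Q x = 1 / u x1 - Q x1"
      using x1S S(2) by (intro has_derivative_zero_unique[of "ball x1 r" "\<lambda>y. 1 / u y - Q y"])
        (auto intro: has_derivative_at_withinI)
    then show ?thesis by (simp add: Q_def)
  qed
  \<comment> \<open>The identity is passed to the closure as \<open>u x * Q x = 1\<close>, because
    \<open>1 / u\<close> has the value 0 where \<open>u\<close> vanishes and is not continuous
    there.\<close>
  have cQ: "continuous_on UNIV (\<lambda>x. u x * Q x)" unfolding Q_def by (intro continuous_intros u_cont)
  have O: "\<Omega> = UNIV"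
  proof (rule ccontr)
    assume "\<Omega> \<noteq> UNIV"
    then have "- \<Omega> \<noteq> {}" by auto
    then obtain z where z: "z \<in> - \<Omega>" "\<And>y. y \<in> - \<Omega> \<Longrightarrow> dist x1 z \<le> dist x1 y"
      using distance_attains_inf[of "- \<Omega>" x1] open_\<Omega> by (auto simp: closed_def)
    define r where "r = dist x1 z"
    have r: "r > 0" using z(1) x1 by (auto simp: r_def \<Omega>_def)
    have rO: "ball x1 r \<subseteq> \<Omega>" using z(2) by (force simp: r_def)
    have "ball x1 r \<subseteq> (\<lambda>x. u x * Q x) -` {1}"
    proof
      fix x assume x: "x \<in> ball x1 r"
      then have "0 < u x" using rO by (auto simp: \<Omega>_def)
      then show "x \<in> (\<lambda>x. u x * Q x) -` {1}" using local[OF rO x] by (simp flip: \<open>1 / u x = Q x\<close>)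
    qed
    moreover have "closed ((\<lambda>x. u x * Q x) -` {1})" using cQ by (auto intro!: continuous_closed_vimage simp: continuous_on_eq_continuous_at)
    ultimately have "closure (ball x1 r) \<subseteq> (\<lambda>x. u x * Q x) -` {1}" by (rule closure_minimal)
    then have "z \<in> (\<lambda>x. u x * Q x) -` {1}" using r by (auto simp: r_def)
    then have "u z \<noteq> 0" by auto
    then show False using z(1) u_nonneg[of z] by (simp add: \<Omega>_def)
  qed
  have uQ: "1 / u x = Q x" for x
    by (rule local[of "dist x1 x + 1"]) (auto simp: O)
  \<comment> \<open>Completing the square: \<open>x0\<close> is the vertex of the paraboloid and
    \<open>b\<close> its minimum value.\<close>
  define x0 where "x0 = x1 - (1 / a) *\<^sub>R gv x1"
  define b where "b = 1 / u x1 - (gv x1 \<bullet> gv x1) / (2 * a)"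
  have Qs: "Q x = a / 2 * (norm (x - x0))\<^sup>2 + b" for x
  proof -
    define d g where "d = x - x1" and "g = gv x1"
    have "x - x0 = d + (1 / a) *\<^sub>R g" by (simp add: x0_def d_def g_def)
    then have "(norm (x - x0))\<^sup>2 = d \<bullet> d + 2 / a * (g \<bullet> d) + (g \<bullet> g) / a\<^sup>2"
      by (simp only: power2_norm_eq_inner)
         (simp add: inner_add_left inner_add_right inner_commute[of d g] power2_eq_square add_divide_distrib)
    then have "a / 2 * (norm (x - x0))\<^sup>2 = a / 2 * (d \<bullet> d) + g \<bullet> d + (g \<bullet> g) / (2 * a)"
      using a0 by (simp add: field_simps power2_eq_square)
    then show ?thesis unfolding Q_def b_def d_def g_def by linarith
  qed
  have b0: "b > 0"
  proof -
    have "0 < 1 / u x0" using O by (simp add: \<Omega>_def set_eq_iff)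
    then show ?thesis using uQ[of x0] Qs[of x0] by simp
  qed
  show ?thesis
  proof (rule that[of "a / 2" b x0])
    fix x
    have "u x = 1 / (1 / u x)" by simp
    then show "u x = 1 / (a / 2 * (norm (x - x0))\<^sup>2 + b)" unfolding uQ Qs .
  qed (use a0 b0 in auto)
qed

end

section \<open>Second derivatives and the equation for the conformal factor\<close>

lemma partial_line:
  assumes "f differentiable (at (x + t *\<^sub>R b))"
  shows "((\<lambda>t. f (x + t *\<^sub>R b)) has_real_derivative partial b f (x + t *\<^sub>R b)) (at t)"
proof -
  have d: "(f has_derivative frechet_derivative f (at (x + t *\<^sub>R b))) (at (x + t *\<^sub>R b))"
    using assms by (simp add: frechet_derivative_works)
  have "((\<lambda>t. x + t *\<^sub>R b) has_derivative (\<lambda>s. s *\<^sub>R b)) (at t)"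
    by (auto intro!: derivative_eq_intros)
  from has_derivative_compose[OF this d]
  have "((\<lambda>t. f (x + t *\<^sub>R b)) has_derivative (\<lambda>s. frechet_derivative f (at (x + t *\<^sub>R b)) (s *\<^sub>R b))) (at t)" .
  moreover have "frechet_derivative f (at (x + t *\<^sub>R b)) (s *\<^sub>R b) = partial b f (x + t *\<^sub>R b) * s" for s
    using has_derivative_linear[OF d] by (simp add: partial_def linear_scale)
  ultimately show ?thesis by (simp add: has_field_derivative_def)
qed

lemma C2D:
  assumes "C2 f"
  shows "f differentiable (at x)"
    and "b \<in> Basis \<Longrightarrow> partial b f differentiable (at x)"
    and "b \<in> Basis \<Longrightarrow> c \<in> Basis \<Longrightarrow> continuous_on UNIV (partial c (partial b f))"
  using assms by (auto simp: C2_def)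

text \<open>The mean value theorem is applied in direction \<open>b\<close> to a difference of two
  values of \<open>f\<close>, then in direction \<open>c\<close> to the resulting difference of
  partial derivatives.\<close>

lemma C2_second_difference:
  assumes f: "C2 f" and b: "b \<in> Basis" and s: "0 < s"
  shows "\<exists>y. dist y x \<le> s * (norm b + norm c) \<and>
    f (x + s *\<^sub>R b + s *\<^sub>R c) - f (x + s *\<^sub>R b) - f (x + s *\<^sub>R c) + f x = s\<^sup>2 * partial c (partial b f) y"
proof -
  define p where "p t = f ((x + s *\<^sub>R c) + t *\<^sub>R b) - f (x + t *\<^sub>R b)" for t
  have "(p has_real_derivative (partial b f ((x + s *\<^sub>R c) + t *\<^sub>R b) - partial b f (x + t *\<^sub>R b))) (at t)" for t
    unfolding p_def by (intro DERIV_diff partial_line C2D[OF f])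
  from MVT2[OF s this] obtain r where r: "0 < r" "r < s"
    "p s - p 0 = (s - 0) * (partial b f ((x + s *\<^sub>R c) + r *\<^sub>R b) - partial b f (x + r *\<^sub>R b))"
    by blast
  have "((\<lambda>t. partial b f ((x + r *\<^sub>R b) + t *\<^sub>R c)) has_real_derivative partial c (partial b f) ((x + r *\<^sub>R b) + t *\<^sub>R c)) (at t)" for t
    by (intro partial_line C2D[OF f] b)
  from MVT2[OF s this] obtain t where t: "0 < t" "t < s"
    "partial b f ((x + r *\<^sub>R b) + s *\<^sub>R c) - partial b f ((x + r *\<^sub>R b) + 0 *\<^sub>R c) =
       (s - 0) * partial c (partial b f) ((x + r *\<^sub>R b) + t *\<^sub>R c)"
    by blast
  have "p s - p 0 = s * (s * partial c (partial b f) ((x + r *\<^sub>R b) + t *\<^sub>R c))"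
    using r(3) t(3) by (simp add: add_ac)
  moreover have "p s - p 0 = f (x + s *\<^sub>R b + s *\<^sub>R c) - f (x + s *\<^sub>R b) - f (x + s *\<^sub>R c) + f x"
    by (simp add: p_def add_ac)
  moreover have "dist ((x + r *\<^sub>R b) + t *\<^sub>R c) x \<le> s * (norm b + norm c)"
  proof -
    have "dist ((x + r *\<^sub>R b) + t *\<^sub>R c) x = norm (r *\<^sub>R b + t *\<^sub>R c)" by (simp add: dist_norm)
    also have "\<dots> \<le> norm (r *\<^sub>R b) + norm (t *\<^sub>R c)" by (rule norm_triangle_ineq)
    also have "\<dots> \<le> s * norm b + s * norm c"
      using r t by (intro add_mono) (auto intro: mult_right_mono)
    finally show ?thesis by (simp add: distrib_left)
  qed
  ultimately show ?thesis by (intro exI[of _ "(x + r *\<^sub>R b) + t *\<^sub>R c"]) (simp add: power2_eq_square)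
qed

text \<open>The second difference does not change when \<open>b\<close> and \<open>c\<close> are
  exchanged, so the two mixed derivatives agree at points within distance \<open>2 * s k\<close> of
  \<open>x\<close>; continuity gives equality at \<open>x\<close>.\<close>

lemma mixed_partials_commute:
  assumes f: "C2 f" and b: "b \<in> Basis" "c \<in> Basis"
  shows "partial c (partial b f) x = partial b (partial c f) x"
proof -
  define s where "s k = inverse (real (Suc k))" for k
  have s: "s k > 0" for k by (simp add: s_def)
  have "\<forall>k. \<exists>y z. dist y x \<le> s k * 2 \<and> dist z x \<le> s k * 2 \<and> partial c (partial b f) y = partial b (partial c f) z"
  proof
    fix k
    obtain y where y: "dist y x \<le> s k * 2"
      "f (x + s k *\<^sub>R b + s k *\<^sub>R c) - f (x + s k *\<^sub>R b) - f (x + s k *\<^sub>R c) + f x = (s k)\<^sup>2 * partial c (partial b f) y"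
      using C2_second_difference[OF f b(1) s[of k], where x = x and c = c] b by auto
    obtain z where z: "dist z x \<le> s k * 2"
      "f (x + s k *\<^sub>R c + s k *\<^sub>R b) - f (x + s k *\<^sub>R c) - f (x + s k *\<^sub>R b) + f x = (s k)\<^sup>2 * partial b (partial c f) z"
      using C2_second_difference[OF f b(2) s[of k], where x = x and c = b] b by auto
    have "(s k)\<^sup>2 * partial c (partial b f) y = (s k)\<^sup>2 * partial b (partial c f) z"
    proof -
      have "f (x + s k *\<^sub>R c + s k *\<^sub>R b) = f (x + s k *\<^sub>R b + s k *\<^sub>R c)" by (simp add: add_ac)
      then show ?thesis using y(2) z(2) by linarith
    qed
    then have "partial c (partial b f) y = partial b (partial c f) z" using s[of k] by simp
    then show "\<exists>y z. dist y x \<le> s k * 2 \<and> dist z x \<le> s k * 2 \<and> partial c (partial b f) y = partial b (partial c f) z"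
      using y(1) z(1) by blast
  qed
  then obtain Y where "\<forall>k. \<exists>z. dist (Y k) x \<le> s k * 2 \<and> dist z x \<le> s k * 2 \<and> partial c (partial b f) (Y k) = partial b (partial c f) z"
    by (rule choice[THEN exE]) blast
  from choice[OF this] obtain Z where YZ: "\<And>k. dist (Y k) x \<le> s k * 2" "\<And>k. dist (Z k) x \<le> s k * 2"
    "\<And>k. partial c (partial b f) (Y k) = partial b (partial c f) (Z k)" by blast
  have s0: "(\<lambda>k. s k * 2) \<longlonglongrightarrow> 0"
    unfolding s_def using LIMSEQ_inverse_real_of_nat by (rule tendsto_mult_left_zero)
  have Y: "Y \<longlonglongrightarrow> x"
    by (rule metric_tendsto_imp_tendsto[OF s0]) (use YZ(1) s in \<open>auto simp: dist_real_def less_imp_le abs_of_pos\<close>)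
  have Z: "Z \<longlonglongrightarrow> x"
    by (rule metric_tendsto_imp_tendsto[OF s0]) (use YZ(2) s in \<open>auto simp: dist_real_def less_imp_le abs_of_pos\<close>)
  have 1: "(\<lambda>k. partial c (partial b f) (Y k)) \<longlonglongrightarrow> partial c (partial b f) x"
    using C2D(3)[OF f b] Y by (auto intro: continuous_on_tendsto_compose)
  have 2: "(\<lambda>k. partial c (partial b f) (Y k)) \<longlonglongrightarrow> partial b (partial c f) x"
    unfolding YZ(3) using C2D(3)[OF f b(2) b(1)] Z by (auto intro: continuous_on_tendsto_compose)
  show ?thesis using LIMSEQ_unique[OF 1 2] .
qed

lemma frechet_derivative_eq_partials:
  assumes "f differentiable (at x)"
  shows "frechet_derivative f (at x) h = (\<Sum>b\<in>Basis. (h \<bullet> b) * partial b f x)"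
proof -
  have lin: "linear (frechet_derivative f (at x))"
    using assms by (meson frechet_derivative_works has_derivative_linear)
  have "frechet_derivative f (at x) h = frechet_derivative f (at x) (\<Sum>b\<in>Basis. (h \<bullet> b) *\<^sub>R b)"
    by (simp add: euclidean_representation)
  also have "\<dots> = (\<Sum>b\<in>Basis. (h \<bullet> b) * partial b f x)"
    by (simp add: linear_sum[OF lin] linear_scale[OF lin] partial_def)
  finally show ?thesis .
qed

lemma has_derivative_grad:
  assumes "f differentiable (at x)"
  shows "(f has_derivative (\<lambda>h. grad f x \<bullet> h)) (at x)"
proof -
  have "frechet_derivative f (at x) = (\<lambda>h. grad f x \<bullet> h)"
    using frechet_derivative_eq_partials[OF assms]
    by (auto simp: grad_def inner_sum_left inner_sum_right inner_commute mult.commute)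
  then show ?thesis using assms by (simp add: frechet_derivative_works)
qed

definition hessian :: "('a::euclidean_space \<Rightarrow> real) \<Rightarrow> 'a \<Rightarrow> 'a \<Rightarrow> 'a" where
  "hessian f x h = (\<Sum>b\<in>Basis. (\<Sum>c\<in>Basis. (h \<bullet> c) * partial c (partial b f) x) *\<^sub>R b)"

lemma grad_has_derivative_hessian:
  assumes "C2 f"
  shows "(grad f has_derivative hessian f x) (at x)"
proof -
  have "(partial b f has_derivative (\<lambda>h. \<Sum>c\<in>Basis. (h \<bullet> c) * partial c (partial b f) x)) (at x)" if "b \<in> Basis" for b
  proof -
    have d: "partial b f differentiable (at x)" using C2D(2)[OF assms that] .
    have "frechet_derivative (partial b f) (at x) = (\<lambda>h. \<Sum>c\<in>Basis. (h \<bullet> c) * partial c (partial b f) x)"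
      using frechet_derivative_eq_partials[OF d] by auto
    then show ?thesis using d by (simp add: frechet_derivative_works)
  qed
  then have "((\<lambda>x. \<Sum>b\<in>Basis. partial b f x *\<^sub>R b) has_derivative hessian f x) (at x)"
    unfolding hessian_def by (intro has_derivative_sum has_derivative_scaleR_left)
  then show ?thesis by (simp add: grad_def[abs_def])
qed

lemma hessian_symmetric:
  assumes "C2 f"
  shows "hessian f x h \<bullet> k = h \<bullet> hessian f x k"
proof -
  have "hessian f x h \<bullet> k = (\<Sum>b\<in>Basis. \<Sum>c\<in>Basis. (h \<bullet> c) * partial c (partial b f) x * (b \<bullet> k))"
    by (simp add: hessian_def inner_sum_left sum_distrib_right)
  also have "\<dots> = (\<Sum>b\<in>Basis. \<Sum>c\<in>Basis. (h \<bullet> c) * partial b (partial c f) x * (b \<bullet> k))"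
    by (intro sum.cong refl) (simp add: mixed_partials_commute[OF assms])
  also have "\<dots> = (\<Sum>c\<in>Basis. \<Sum>b\<in>Basis. (h \<bullet> c) * partial b (partial c f) x * (b \<bullet> k))"
    by (rule sum.swap)
  also have "\<dots> = h \<bullet> hessian f x k"
    by (simp add: hessian_def inner_sum_right sum_distrib_right sum_distrib_left inner_commute mult_ac)
  finally show ?thesis .
qed

lemma hessian_continuous:
  assumes "C2 f"
  shows "continuous_on S (\<lambda>x. hessian f x h)"
  unfolding hessian_def
  by (intro continuous_intros continuous_on_subset[OF C2D(3)[OF assms]]) auto

lemma hessian_trace: "op_trace (hessian f x) = laplacian f x"
proof -
  have "hessian f x b \<bullet> b = partial b (partial b f) x" if b: "b \<in> Basis" for b
  proof -
    have "hessian f x b \<bullet> b = (\<Sum>c\<in>Basis. (b \<bullet> c) * partial c (partial b f) x)"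
      unfolding hessian_def using b by (simp add: inner_sum_left_Basis)
    also have "\<dots> = (\<Sum>c\<in>Basis. if c = b then partial c (partial b f) x else 0)"
      using b by (intro sum.cong) (auto simp: inner_Basis)
    finally show ?thesis using b by simp
  qed
  then show ?thesis by (simp add: op_trace_def laplacian_def)
qed

lemma C2_grad_continuous: "C2 f \<Longrightarrow> continuous_on S (grad f)"
  by (intro continuous_at_imp_continuous_on ballI has_derivative_continuous[OF grad_has_derivative_hessian])

lemma C2_continuous: "C2 f \<Longrightarrow> continuous_on S f"
  by (intro continuous_at_imp_continuous_on ballI differentiable_imp_continuous_within C2D(1))

lemma partial_uminus:
  assumes "f differentiable (at x)"
  shows "partial b (\<lambda>x. - f x) x = - partial b f x"
proof -
  have "((\<lambda>x. - f x) has_derivative (\<lambda>h. - frechet_derivative f (at x) h)) (at x)"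
    using assms by (intro has_derivative_minus) (simp add: frechet_derivative_works)
  then show ?thesis unfolding partial_def using frechet_derivative_at by metis
qed

lemma uminus_solution_facts:
  assumes f: "C2 f"
  shows "C2 (\<lambda>x. - f x)" and "laplacian (\<lambda>x. - f x) x = - laplacian f x" and "grad (\<lambda>x. - f x) x = - grad f x"
proof -
  have p1: "partial b (\<lambda>x. - f x) = (\<lambda>x. - partial b f x)" for b
    using partial_uminus[OF C2D(1)[OF f]] by auto
  have p2: "partial c (partial b (\<lambda>x. - f x)) = (\<lambda>x. - partial c (partial b f) x)" if "b \<in> Basis" for b c
    unfolding p1 using partial_uminus[OF C2D(2)[OF f that]] by auto
  show "C2 (\<lambda>x. - f x)"
    unfolding C2_def
  proof (intro conjI ballI allI)
    show "(\<lambda>x. - f x) differentiable at x" for x using C2D(1)[OF f] by simp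
    show "partial b (\<lambda>x. - f x) differentiable at x" if "b \<in> Basis" for b x
      unfolding p1 using C2D(2)[OF f that] by simp
    show "continuous_on UNIV (partial c (partial b (\<lambda>x. - f x)))" if "b \<in> Basis" "c \<in> Basis" for b c
      unfolding p2[OF that(1)] using C2D(3)[OF f that] by (intro continuous_intros)
  qed
  show "laplacian (\<lambda>x. - f x) x = - laplacian f x" by (simp add: laplacian_def p2 sum_negf)
  show "grad (\<lambda>x. - f x) x = - grad f x" by (simp add: grad_def p1 sum_negf)
qed

section \<open>The equation satisfied by the conformal factor\<close>

lemma op_trace_rank_one_plus:
  "op_trace (\<lambda>h. (a * (G \<bullet> h)) *\<^sub>R G + b *\<^sub>R H h) = a * (norm G)\<^sup>2 + b * op_trace H"
proof -
  have "op_trace (\<lambda>h. (a * (G \<bullet> h)) *\<^sub>R G + b *\<^sub>R H h) = (\<Sum>i\<in>Basis. a * ((G \<bullet> i) * (G \<bullet> i)) + b * (H i \<bullet> i))"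
    by (simp add: op_trace_def inner_add_left mult.assoc)
  also have "\<dots> = a * (\<Sum>i\<in>Basis. (G \<bullet> i) * (G \<bullet> i)) + b * op_trace H"
    by (simp add: sum.distrib sum_distrib_left op_trace_def)
  finally show ?thesis by (simp add: power2_norm_eq_inner euclidean_inner[of G G])
qed

text \<open>The truncation \<open>max 0\<close> extends the factor continuously by zero, since
  \<open>q\<close> is positive. The constant \<open>2 * q * k / CARD('n)\<close> is read off from
  the term with the Laplacian, which becomes \<open>q * k * \<phi> x powr q\<close>.\<close>

lemma conformal_factor_of_solution:
  fixes \<phi> :: "real^'n::finite \<Rightarrow> real"
  assumes dim: "2 < CARD('n)" and q: "q = 2 / (real CARD('n) - 2)" and k: "0 < k"
    and \<phi>: "C2 \<phi>" and pde: "\<And>x. laplacian \<phi> x = - k * \<bar>\<phi> x\<bar> powr (2 * q) * \<phi> x"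
    and int: "integrable lborel (\<lambda>x. \<bar>\<phi> x\<bar> powr (q * CARD('n)))"
  shows "conformal_factor (\<lambda>x. (max 0 (\<phi> x)) powr q)
    (\<lambda>x. (- q * \<phi> x powr (- q - 1)) *\<^sub>R grad \<phi> x)
    (\<lambda>x h. (q * (q + 1) * \<phi> x powr (- q - 2) * (grad \<phi> x \<bullet> h)) *\<^sub>R grad \<phi> x
        + (- q * \<phi> x powr (- q - 1)) *\<^sub>R hessian \<phi> x h)
    (2 * q * k / CARD('n))"
proof -
  have n2: "real CARD('n) - 2 > 0" using dim by simp
  have q0: "q > 0" using n2 by (simp add: q)
  have pos: "0 < (max 0 (\<phi> x)) powr q \<longleftrightarrow> 0 < \<phi> x" for x by (auto simp: max_def)
  have c\<phi>: "continuous_on S \<phi>" for S by (rule C2_continuous[OF \<phi>])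
  have oP: "open {x. 0 < \<phi> x}" using c\<phi> by (intro open_Collect_less) auto
  have dpow: "((\<lambda>x. \<phi> x powr r) has_derivative (\<lambda>h. (r * \<phi> x powr (r - 1)) * (grad \<phi> x \<bullet> h))) (at x)"
    if "0 < \<phi> x" for x r
    using has_derivative_compose[OF has_derivative_grad[OF C2D(1)[OF \<phi>]],
        of "\<lambda>z. z powr r" "\<lambda>h. (r * \<phi> x powr (r - 1)) * h"]
      has_real_derivative_powr[OF that, of r] by (simp add: has_field_derivative_def)
  show ?thesis
  proof (unfold_locales, unfold pos)
    show "2 \<le> CARD('n)" using dim by simp
    show "0 < 2 * q * k / CARD('n)" using q0 k dim by simp
    show "continuous_on UNIV (\<lambda>x. (max 0 (\<phi> x)) powr q)"
      using q0 by (intro continuous_on_powr' continuous_intros c\<phi>) auto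
    show "0 \<le> (max 0 (\<phi> x)) powr q" for x by simp
    have eqp: "((max 0 (\<phi> x)) powr q) ^ CARD('n) = (max 0 (\<phi> x)) powr (q * CARD('n))" for x
      by (cases "max 0 (\<phi> x) = 0") (auto simp: powr_power mult.commute)
    show "integrable lborel (\<lambda>x. ((max 0 (\<phi> x)) powr q) ^ CARD('n))"
      unfolding eqp
    proof (rule Bochner_Integration.integrable_bound[OF int])
      have "(\<lambda>x. max 0 (\<phi> x)) \<in> borel_measurable borel"
        by (intro borel_measurable_continuous_onI continuous_intros c\<phi>)
      then show "(\<lambda>x. (max 0 (\<phi> x)) powr (q * CARD('n))) \<in> borel_measurable lborel" by simp
      show "AE x in lborel. norm ((max 0 (\<phi> x)) powr (q * CARD('n))) \<le> norm (\<bar>\<phi> x\<bar> powr (q * CARD('n)))"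
        using q0 by (intro AE_I2) (auto intro!: powr_mono2)
    qed
    fix x
    show "((\<lambda>x. 1 / (max 0 (\<phi> x)) powr q) has_derivative (\<lambda>h. ((- q * \<phi> x powr (- q - 1)) *\<^sub>R grad \<phi> x) \<bullet> h)) (at x)"
      if "0 < \<phi> x"
    proof (rule has_derivative_transform_within_open[OF _ oP])
      show "((\<lambda>x. \<phi> x powr (- q)) has_derivative (\<lambda>h. ((- q * \<phi> x powr (- q - 1)) *\<^sub>R grad \<phi> x) \<bullet> h)) (at x)"
        using dpow[OF that, of "- q"] by simp
      show "\<phi> y powr (- q) = 1 / (max 0 (\<phi> y)) powr q" if "y \<in> {x. 0 < \<phi> x}" for y
        using that by (simp add: powr_minus_divide)
    qed (use that in auto)
    show "((\<lambda>x. (- q * \<phi> x powr (- q - 1)) *\<^sub>R grad \<phi> x) has_derivative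
       (\<lambda>h. (q * (q + 1) * \<phi> x powr (- q - 2) * (grad \<phi> x \<bullet> h)) *\<^sub>R grad \<phi> x
        + (- q * \<phi> x powr (- q - 1)) *\<^sub>R hessian \<phi> x h)) (at x)" if "0 < \<phi> x"
    proof -
      have A: "((\<lambda>x. (- q * \<phi> x powr (- q - 1)) *\<^sub>R grad \<phi> x) has_derivative
        (\<lambda>h. (- q * \<phi> x powr (- q - 1)) *\<^sub>R hessian \<phi> x h
           + (- q * (((- q - 1) * \<phi> x powr ((- q - 1) - 1)) * (grad \<phi> x \<bullet> h))) *\<^sub>R grad \<phi> x)) (at x)"
        by (intro has_derivative_scaleR has_derivative_mult_right dpow[OF that] grad_has_derivative_hessian[OF \<phi>])
      have e: "- q * (((- q - 1) * \<phi> x powr ((- q - 1) - 1)) * (grad \<phi> x \<bullet> h))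
          = q * (q + 1) * \<phi> x powr (- q - 2) * (grad \<phi> x \<bullet> h)" for h by (simp add: algebra_simps)
      show ?thesis by (rule has_derivative_eq_rhs[OF A], unfold e) (rule ext, rule add.commute)
    qed
    show "continuous_on {x. 0 < \<phi> x} (\<lambda>x. (q * (q + 1) * \<phi> x powr (- q - 2) * (grad \<phi> x \<bullet> h)) *\<^sub>R grad \<phi> x
        + (- q * \<phi> x powr (- q - 1)) *\<^sub>R hessian \<phi> x h)" for h
      by (intro continuous_intros c\<phi> C2_grad_continuous[OF \<phi>] hessian_continuous[OF \<phi>]) auto
    show "((q * (q + 1) * \<phi> x powr (- q - 2) * (grad \<phi> x \<bullet> y)) *\<^sub>R grad \<phi> x
        + (- q * \<phi> x powr (- q - 1)) *\<^sub>R hessian \<phi> x y) \<bullet> z =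
      y \<bullet> ((q * (q + 1) * \<phi> x powr (- q - 2) * (grad \<phi> x \<bullet> z)) *\<^sub>R grad \<phi> x
        + (- q * \<phi> x powr (- q - 1)) *\<^sub>R hessian \<phi> x z)" for y z
      using hessian_symmetric[OF \<phi>, of x y z]
      by (simp add: inner_diff_left inner_diff_right inner_commute[of y "grad \<phi> x"])
    show "op_trace (\<lambda>h. (q * (q + 1) * \<phi> x powr (- q - 2) * (grad \<phi> x \<bullet> h)) *\<^sub>R grad \<phi> x
        + (- q * \<phi> x powr (- q - 1)) *\<^sub>R hessian \<phi> x h) =
      CARD('n) * ((max 0 (\<phi> x)) powr q * ((norm ((- q * \<phi> x powr (- q - 1)) *\<^sub>R grad \<phi> x))\<^sup>2 + 2 * q * k / CARD('n)) / 2)"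
      if "0 < \<phi> x"
    proof -
      let ?G = "grad \<phi> x" and ?f = "\<phi> x" and ?n = "real CARD('n)"
      have "op_trace (\<lambda>h. (q * (q + 1) * ?f powr (- q - 2) * (?G \<bullet> h)) *\<^sub>R ?G
        + (- q * ?f powr (- q - 1)) *\<^sub>R hessian \<phi> x h)
        = q * (q + 1) * ?f powr (- q - 2) * (norm ?G)\<^sup>2 + (- q * ?f powr (- q - 1)) * laplacian \<phi> x"
        unfolding hessian_trace[symmetric] by (rule op_trace_rank_one_plus)
      also have "(- q * ?f powr (- q - 1)) * laplacian \<phi> x = q * k * ?f powr q"
      proof -
        have "?f powr q = ?f powr ((- q - 1) + 2 * q + 1)" by simp
        also have "\<dots> = ?f powr (- q - 1) * ?f powr (2 * q) * ?f powr 1" by (simp only: powr_add)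
        finally have "?f powr (- q - 1) * (?f powr (2 * q) * ?f) = ?f powr q" using that by (simp add: mult.assoc)
        moreover have "(- q * ?f powr (- q - 1)) * laplacian \<phi> x = q * k * (?f powr (- q - 1) * (?f powr (2 * q) * ?f))"
          unfolding pde using that by simp
        ultimately show ?thesis by simp
      qed
      \<comment> \<open>The relation \<open>q + 1 = CARD('n) / 2 * q\<close>, special to the
        critical exponent, gives the gradient term the same factor \<open>CARD('n) / 2 * u x\<close>
        as the constant term.\<close>
      also have "q * (q + 1) * ?f powr (- q - 2) * (norm ?G)\<^sup>2 = ?n / 2 * (?f powr q * (q * ?f powr (- q - 1))\<^sup>2 * (norm ?G)\<^sup>2)"
      proof -
        have 1: "?f powr (- q - 2) = ?f powr q * (?f powr (- q - 1))\<^sup>2"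
          by (simp add: power2_eq_square powr_add[symmetric])
        have 2: "q * (q + 1) = ?n / 2 * q\<^sup>2" using n2 by (simp add: q field_simps power2_eq_square)
        show ?thesis unfolding 1 2 by (simp add: power_mult_distrib)
      qed
      finally show ?thesis using that dim by (simp add: power_mult_distrib field_simps)
    qed
  qed
qed

section \<open>The energy identity\<close>

lemma integrable_continuous_bounded_support:
  fixes f :: "'a::euclidean_space \<Rightarrow> real"
  assumes "continuous_on UNIV f" "\<And>x. r < norm x \<Longrightarrow> f x = 0"
  shows "integrable lborel f"
proof -
  have "integrable lborel (\<lambda>x. indicator (cball 0 r) x *\<^sub>R f x)"
    by (rule borel_integrable_compact) (auto intro: continuous_on_subset[OF assms(1)])
  moreover have "(\<lambda>x. indicator (cball 0 r) x *\<^sub>R f x) = f"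
    using assms(2) by (auto simp: indicator_def fun_eq_iff)
  ultimately show ?thesis by simp
qed

text \<open>The difference quotients of \<open>F\<close> in direction \<open>b\<close> have integral 0 by translation invariance.\<close>

lemma integral_partial_eq_zero:
  fixes F :: "'a::euclidean_space \<Rightarrow> real"
  assumes diff: "\<And>x. F differentiable (at x)" and cont: "continuous_on UNIV (partial b F)"
    and supp: "\<And>x. r < norm x \<Longrightarrow> F x = 0" and b: "norm b = 1"
  shows "integrable lborel (partial b F)" and "(LINT x|lborel. partial b F x) = 0"
proof -
  have supp': "partial b F x = 0" if "r < norm x" for x
  proof -
    have "open {x::'a. r < norm x}" by (intro open_Collect_less continuous_intros)
    then have "(F has_derivative (\<lambda>h. 0)) (at x)"
      using that supp by (intro has_derivative_transform_within_open[of "\<lambda>x. 0", OF has_derivative_const]) auto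
    then show ?thesis unfolding partial_def using frechet_derivative_at by metis
  qed
  show int: "integrable lborel (partial b F)"
    by (rule integrable_continuous_bounded_support[OF cont supp'])
  have cF: "continuous_on UNIV F"
    using diff by (intro continuous_at_imp_continuous_on ballI differentiable_imp_continuous_within)
  have intF: "integrable lborel F" by (rule integrable_continuous_bounded_support[OF cF supp])
  obtain M where M: "\<And>x. \<bar>partial b F x\<bar> \<le> M" "0 \<le> M"
  proof -
    have "compact (partial b F ` cball 0 r)"
      by (intro compact_continuous_image continuous_on_subset[OF cont]) auto
    then obtain M where "\<forall>y\<in>partial b F ` cball 0 r. norm y \<le> M" using compact_imp_bounded bounded_iff by metis
    then have "\<bar>partial b F x\<bar> \<le> max 0 M" for x
      using supp'[of x] by (cases "r < norm x") (auto simp: le_max_iff_disj)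
    then show ?thesis using that[of "max 0 M"] by simp
  qed
  define s where "s k = inverse (real (Suc k))" for k
  have s: "0 < s k" "s k \<le> 1" for k by (auto simp: s_def field_simps)
  have s_nz: "s k \<noteq> 0" for k using s(1)[of k] by simp
  have s0: "s \<longlonglongrightarrow> 0" unfolding s_def[abs_def] by (rule LIMSEQ_inverse_real_of_nat)
  define D where "D k x = (F (x + s k *\<^sub>R b) - F x) / s k" for k x
  have line: "((\<lambda>t. F (x + t *\<^sub>R b)) has_real_derivative partial b F (x + t *\<^sub>R b)) (at t)" for x t
    by (rule partial_line) (rule diff)
  have "(\<lambda>k. LINT x|lborel. D k x) \<longlonglongrightarrow> (LINT x|lborel. partial b F x)"
  \<comment> \<open>The mean value theorem bounds the quotients by \<open>M\<close>; the radius
    grows by 1 because the shifts \<open>s k *\<^sub>R b\<close> have length at most 1.\<close>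
  proof (rule integral_dominated_convergence[where w = "\<lambda>x. M * indicator (cball 0 (r + 1)) x"])
    show "partial b F \<in> borel_measurable lborel" using cont by (simp add: borel_measurable_continuous_onI)
    have "continuous_on UNIV (D k)" for k
      unfolding D_def by (intro continuous_intros continuous_on_compose2[OF cF]) (auto simp: s_nz)
    then show "D k \<in> borel_measurable lborel" for k by (simp add: borel_measurable_continuous_onI)
    show "integrable lborel (\<lambda>x::'a. M * indicator (cball 0 (r + 1)) x)"
      by (intro integrable_mult_right integrable_real_indicator emeasure_lborel_cball_finite) auto
    show "AE x in lborel. (\<lambda>k. D k x) \<longlonglongrightarrow> partial b F x"
    proof (rule AE_I2)
      fix x
      have "((\<lambda>h. (F (x + (0 + h) *\<^sub>R b) - F (x + 0 *\<^sub>R b)) / h) \<longlongrightarrow> partial b F (x + 0 *\<^sub>R b)) (at 0)"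
        using line[of x 0] unfolding DERIV_def .
      moreover have "filterlim s (at 0) sequentially"
        using s0 s_nz unfolding filterlim_at by (auto intro!: always_eventually)
      ultimately have "((\<lambda>k. (F (x + (0 + s k) *\<^sub>R b) - F (x + 0 *\<^sub>R b)) / s k) \<longlongrightarrow> partial b F (x + 0 *\<^sub>R b)) sequentially"
        by (rule filterlim_compose)
      then show "(\<lambda>k. D k x) \<longlonglongrightarrow> partial b F x" by (simp add: D_def)
    qed
    show "AE x in lborel. norm (D k x) \<le> M * indicator (cball 0 (r + 1)) x" for k
    proof (rule AE_I2)
      fix x
      show "norm (D k x) \<le> M * indicator (cball 0 (r + 1)) x"
      proof (cases "norm x \<le> r + 1")
        case True
        obtain z where "F (x + s k *\<^sub>R b) - F (x + 0 *\<^sub>R b) = (s k - 0) * partial b F (x + z *\<^sub>R b)"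
          using MVT2[OF s(1) line] by blast
        then have "D k x = partial b F (x + z *\<^sub>R b)" using s(1)[of k] by (simp add: D_def)
        then show ?thesis using M True by simp
      next
        case False
        have "norm x \<le> norm (x + s k *\<^sub>R b) + norm (s k *\<^sub>R b)"
          using norm_triangle_ineq4[of "x + s k *\<^sub>R b" "s k *\<^sub>R b"] by simp
        then have "r < norm (x + s k *\<^sub>R b)" using False s[of k] b by simp
        then show ?thesis using False supp M(2) by (simp add: D_def)
      qed
    qed
  qed
  moreover have "(LINT x|lborel. D k x) = 0" for k
  proof -
    have mF: "F \<in> borel_measurable borel" using cF by (rule borel_measurable_continuous_onI)
    have 1: "integrable lborel (\<lambda>x. F (s k *\<^sub>R b + x))"
      using integrable_distr_eq[of "(+) (s k *\<^sub>R b)" lborel borel F] mF intF by (simp add: lborel_distr_plus)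
    have 2: "(LINT x|lborel. F (s k *\<^sub>R b + x)) = (LINT x|lborel. F x)"
      using integral_distr[of "(+) (s k *\<^sub>R b)" lborel borel F] mF by (simp add: lborel_distr_plus)
    show ?thesis using 1 2 intF by (simp add: D_def add.commute)
  qed
  ultimately show "(LINT x|lborel. partial b F x) = 0" by (simp add: LIMSEQ_const_iff)
qed

section \<open>A continuously differentiable cutoff function and the tested equation\<close>

lemma DERIV_max_square:
  "((\<lambda>y::real. (max 0 y)\<^sup>2) has_real_derivative 2 * max 0 y) (at y)"
proof -
  consider "y > 0" | "y < 0" | "y = 0" by linarith
  then show ?thesis
  proof cases
    case 1
    have "((\<lambda>y. y\<^sup>2) has_real_derivative 2 * max 0 y) (at y)"
      using 1 by (auto intro!: derivative_eq_intros)
    then show ?thesis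
      by (rule has_field_derivative_transform_within_open[where S = "{0<..}"]) (use 1 in auto)
  next
    case 2
    have "((\<lambda>y. 0) has_real_derivative 2 * max 0 y) (at y)" using 2 by simp
    then show ?thesis
      by (rule has_field_derivative_transform_within_open[where S = "{..<0}"]) (use 2 in auto)
  next
    case 3
    have "(\<lambda>h::real. (max 0 h)\<^sup>2 / h) = (\<lambda>h. max 0 h)" by (auto simp: max_def power2_eq_square)
    moreover have "((\<lambda>h::real. max 0 h) \<longlongrightarrow> max 0 0) (at 0)" by (intro tendsto_intros)
    ultimately show ?thesis using 3 by (simp add: DERIV_def)
  qed
qed

text \<open>The squared positive part, applied twice to the squared norm, is differentiable without
  any gluing. The result is 1 up to radius \<open>R\<close> and 0 beyond \<open>2 * R\<close>; one
  continuous derivative suffices, since only one falls on the cutoff.\<close>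

definition cutoff :: "real \<Rightarrow> 'a::real_inner \<Rightarrow> real" where
  "cutoff R x = (max 0 (1 - (max 0 ((x \<bullet> x) / R\<^sup>2 - 1))\<^sup>2))\<^sup>2"

text \<open>The gradient of \<open>cutoff R\<close> at \<open>x\<close> is this scalar times
  \<open>x\<close>.\<close>

definition cutoff_slope :: "real \<Rightarrow> 'a::real_inner \<Rightarrow> real" where
  "cutoff_slope R x = - (8 / R\<^sup>2) * max 0 (1 - (max 0 ((x \<bullet> x) / R\<^sup>2 - 1))\<^sup>2) * max 0 ((x \<bullet> x) / R\<^sup>2 - 1)"

lemma cutoff_has_derivative:
  "(cutoff R has_derivative (\<lambda>h. cutoff_slope R x * (x \<bullet> h))) (at x)"
proof -
  let ?s = "\<lambda>x. (x \<bullet> x) / R\<^sup>2 - 1"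
  have 1: "(?s has_derivative (\<lambda>h. 2 * (x \<bullet> h) / R\<^sup>2)) (at x)"
  proof (rule has_derivative_eq_rhs)
    show "(?s has_derivative (\<lambda>h. (x \<bullet> h + h \<bullet> x) * inverse (R\<^sup>2) - 0)) (at x)"
      unfolding divide_inverse
      by (intro has_derivative_diff has_derivative_mult_left has_derivative_const
          has_derivative_inner has_derivative_ident)
  qed (simp add: fun_eq_iff inner_commute divide_inverse)
  have 2: "((\<lambda>x. (max 0 (?s x))\<^sup>2) has_derivative (\<lambda>h. 2 * max 0 (?s x) * (2 * (x \<bullet> h) / R\<^sup>2))) (at x)"
    by (rule has_derivative_compose[OF 1 DERIV_max_square[unfolded has_field_derivative_def]])
  have 3: "((\<lambda>x. 1 - (max 0 (?s x))\<^sup>2) has_derivative (\<lambda>h. - (2 * max 0 (?s x) * (2 * (x \<bullet> h) / R\<^sup>2)))) (at x)"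
    using has_derivative_diff[OF has_derivative_const 2] by simp
  have 4: "((\<lambda>x. (max 0 (1 - (max 0 (?s x))\<^sup>2))\<^sup>2) has_derivative
      (\<lambda>h. 2 * max 0 (1 - (max 0 (?s x))\<^sup>2) * - (2 * max 0 (?s x) * (2 * (x \<bullet> h) / R\<^sup>2)))) (at x)"
    by (rule has_derivative_compose[OF 3 DERIV_max_square[unfolded has_field_derivative_def]])
  show ?thesis unfolding cutoff_def[abs_def] cutoff_slope_def
    by (rule has_derivative_eq_rhs[OF 4]) (simp add: fun_eq_iff)
qed

lemma cutoff_bounds: "0 \<le> cutoff R x" "cutoff R x \<le> 1"
proof -
  show "0 \<le> cutoff R x" by (simp add: cutoff_def)
  have "max 0 (1 - (max 0 ((x \<bullet> x) / R\<^sup>2 - 1))\<^sup>2) \<le> 1" by simp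
  then show "cutoff R x \<le> 1" unfolding cutoff_def by (intro power_le_one) auto
qed

lemma cutoff_eq_1: "norm x \<le> R \<Longrightarrow> 0 < R \<Longrightarrow> cutoff R x = 1"
  and cutoff_slope_eq_0: "norm x \<le> R \<Longrightarrow> 0 < R \<Longrightarrow> cutoff_slope R x = 0"
proof -
  assume "norm x \<le> R" "0 < R"
  then have "(norm x)\<^sup>2 \<le> R\<^sup>2" by (simp add: power_mono)
  then have "(x \<bullet> x) / R\<^sup>2 - 1 \<le> 0" using \<open>0 < R\<close> by (simp add: dot_square_norm)
  then have "max 0 ((x \<bullet> x) / R\<^sup>2 - 1) = 0" by (simp only: max_absorb1)
  then show "cutoff R x = 1" "cutoff_slope R x = 0" by (simp_all add: cutoff_def cutoff_slope_def)
qed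

lemma cutoff_eq_0: "2 * R \<le> norm x \<Longrightarrow> 0 < R \<Longrightarrow> cutoff R x = 0"
  and cutoff_slope_eq_0': "2 * R \<le> norm x \<Longrightarrow> 0 < R \<Longrightarrow> cutoff_slope R x = 0"
proof -
  assume "2 * R \<le> norm x" "0 < R"
  then have "(2 * R)\<^sup>2 \<le> (norm x)\<^sup>2" by (intro power_mono) auto
  then have "4 \<le> (x \<bullet> x) / R\<^sup>2" using \<open>0 < R\<close> by (simp add: dot_square_norm le_divide_eq power_mult_distrib)
  then have s: "1 \<le> max 0 ((x \<bullet> x) / R\<^sup>2 - 1)" by simp
  have "1\<^sup>2 \<le> (max 0 ((x \<bullet> x) / R\<^sup>2 - 1))\<^sup>2" by (rule power_mono[OF s]) simp
  then have "max 0 (1 - (max 0 ((x \<bullet> x) / R\<^sup>2 - 1))\<^sup>2) = 0" by simp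
  then show "cutoff R x = 0" "cutoff_slope R x = 0" unfolding cutoff_def cutoff_slope_def by simp_all
qed

lemma cutoff_slope_bound: "\<bar>cutoff_slope R x\<bar> \<le> 8 / R\<^sup>2"
proof -
  define t where "t = max 0 ((x \<bullet> x) / R\<^sup>2 - 1)"
  have t: "0 \<le> t" by (simp add: t_def)
  have "max 0 (1 - t\<^sup>2) * t \<le> 1"
  proof (cases "t \<le> 1")
    case True then show ?thesis using t by (intro mult_le_one) auto
  next
    case False
    then have "1\<^sup>2 \<le> t\<^sup>2" by (intro power_mono) auto
    then show ?thesis by (simp add: max_def)
  qed
  then have "8 / R\<^sup>2 * (max 0 (1 - t\<^sup>2) * t) \<le> 8 / R\<^sup>2 * 1" by (intro mult_left_mono) auto
  moreover have "\<bar>cutoff_slope R x\<bar> = 8 / R\<^sup>2 * (max 0 (1 - t\<^sup>2) * t)"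
    unfolding cutoff_slope_def t_def[symmetric] using t by (simp add: abs_mult)
  ultimately show ?thesis by simp
qed

lemma cutoff_continuous: "continuous_on S (cutoff R)" "continuous_on S (cutoff_slope R)"
  unfolding cutoff_def[abs_def] cutoff_slope_def[abs_def] divide_inverse by (intro continuous_intros)+

text \<open>The integrand is the divergence of the compactly supported field with components
  \<open>F b\<close>, the cutoff times \<open>\<phi>\<close> times its gradient, and every
  \<open>partial b (F b)\<close> integrates to zero.\<close>

lemma cutoff_identity:
  fixes \<phi> :: "'a::euclidean_space \<Rightarrow> real"
  assumes \<phi>: "C2 \<phi>" and R: "0 < R"
  shows "(LINT x|lborel. cutoff_slope R x * \<phi> x * (x \<bullet> grad \<phi> x) + cutoff R x * (norm (grad \<phi> x))\<^sup>2
           + cutoff R x * (\<phi> x * laplacian \<phi> x)) = 0"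
proof -
  define F where "F b x = cutoff R x * (\<phi> x * partial b \<phi> x)" for b x
  have dF: "(F b has_derivative (\<lambda>h. cutoff R x * (\<phi> x * frechet_derivative (partial b \<phi>) (at x) h
        + frechet_derivative \<phi> (at x) h * partial b \<phi> x) + cutoff_slope R x * (x \<bullet> h) * (\<phi> x * partial b \<phi> x))) (at x)"
    if "b \<in> Basis" for b x
    unfolding F_def[abs_def] using C2D(1,2)[OF \<phi>] that
    by (intro has_derivative_mult cutoff_has_derivative) (auto simp: frechet_derivative_works[symmetric])
  have pF: "partial b (F b) = (\<lambda>x. cutoff R x * (\<phi> x * partial b (partial b \<phi>) x + (partial b \<phi> x)\<^sup>2)
      + cutoff_slope R x * (x \<bullet> b) * (\<phi> x * partial b \<phi> x))" if "b \<in> Basis" for b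
  proof
    fix x
    show "partial b (F b) x = cutoff R x * (\<phi> x * partial b (partial b \<phi>) x + (partial b \<phi> x)\<^sup>2)
      + cutoff_slope R x * (x \<bullet> b) * (\<phi> x * partial b \<phi> x)"
      unfolding partial_def[of b "F b"] frechet_derivative_at[OF dF[OF that], symmetric]
      by (simp add: partial_def power2_eq_square)
  qed
  have cp: "continuous_on S (partial b \<phi>)" if "b \<in> Basis" for b S
    by (intro continuous_at_imp_continuous_on ballI differentiable_imp_continuous_within C2D(2)[OF \<phi> that])
  have z: "integrable lborel (partial b (F b)) \<and> (LINT x|lborel. partial b (F b) x) = 0" if b: "b \<in> Basis" for b
  proof -
    have 1: "F b differentiable (at x)" for x using dF[OF b] by (rule differentiableI)
    have 2: "continuous_on UNIV (partial b (F b))"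
      unfolding pF[OF b] by (intro continuous_intros cutoff_continuous C2_continuous[OF \<phi>] cp b C2D(3)[OF \<phi>])
    have 3: "F b x = 0" if "2 * R < norm x" for x using that R by (simp add: F_def cutoff_eq_0)
    show ?thesis using integral_partial_eq_zero[OF 1 2 3] b by auto
  qed
  have "(\<Sum>b\<in>Basis. partial b (F b) x) = cutoff_slope R x * \<phi> x * (x \<bullet> grad \<phi> x)
     + cutoff R x * (norm (grad \<phi> x))\<^sup>2 + cutoff R x * (\<phi> x * laplacian \<phi> x)" for x
  proof -
    have "(norm (grad \<phi> x))\<^sup>2 = (\<Sum>b\<in>Basis. (partial b \<phi> x)\<^sup>2)"
    proof -
      have "(norm (grad \<phi> x))\<^sup>2 = (\<Sum>b\<in>Basis. (grad \<phi> x \<bullet> b) * (grad \<phi> x \<bullet> b))"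
        by (subst power2_norm_eq_inner) (rule euclidean_inner)
      also have "\<dots> = (\<Sum>b\<in>Basis. (partial b \<phi> x)\<^sup>2)"
        by (intro sum.cong) (auto simp: grad_def inner_sum_left_Basis power2_eq_square)
      finally show ?thesis .
    qed
    moreover have "x \<bullet> grad \<phi> x = (\<Sum>b\<in>Basis. (x \<bullet> b) * partial b \<phi> x)"
      by (simp add: grad_def inner_sum_right mult.commute)
    ultimately show ?thesis
      by (simp add: pF laplacian_def sum.distrib sum_distrib_left distrib_left mult_ac)
  qed
  then have "(LINT x|lborel. cutoff_slope R x * \<phi> x * (x \<bullet> grad \<phi> x) + cutoff R x * (norm (grad \<phi> x))\<^sup>2
           + cutoff R x * (\<phi> x * laplacian \<phi> x)) = (LINT x|lborel. (\<Sum>b\<in>Basis. partial b (F b) x))" by simp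
  also have "\<dots> = (\<Sum>b\<in>Basis. LINT x|lborel. partial b (F b) x)"
    using z by (intro Bochner_Integration.integral_sum) auto
  also have "\<dots> = 0" using z by simp
  finally show ?thesis .
qed

text \<open>The equation is odd, so the locale is closed under negation; facts about the positive
  part of \<phi> thereby also cover the negative part.\<close>

locale critical_solution =
  fixes \<phi> :: "real^'n::finite \<Rightarrow> real" and q k :: real
  assumes dim: "2 < CARD('n)" and q: "q = 2 / (real CARD('n) - 2)" and k: "0 < k"
    and \<phi>: "C2 \<phi>" and pde: "laplacian \<phi> x = - k * \<bar>\<phi> x\<bar> powr (2 * q) * \<phi> x"
    and int_grad: "integrable lborel (\<lambda>x. (norm (grad \<phi> x))\<^sup>2)"
    and int_pot: "integrable lborel (\<lambda>x. \<bar>\<phi> x\<bar> powr (q * CARD('n)))"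
begin

lemma q_pos: "0 < q" using dim by (simp add: q)

lemma uminus_critical_solution: "critical_solution (\<lambda>x. - \<phi> x) q k"
  using dim q k pde int_grad int_pot
  by unfold_locales (simp_all add: uminus_solution_facts[OF \<phi>])

lemma decay_pos:
  assumes "0 < m0"
  obtains R where "0 < R" "\<And>x. R < norm x \<Longrightarrow> m0 * norm x * (max 0 (\<phi> x)) powr q < 1"
  using conformal_factor.decay[OF conformal_factor_of_solution[OF dim q k \<phi> pde int_pot] assms] by blast

lemma decay_abs:
  assumes "0 < m0"
  obtains R where "0 < R" "\<And>x. R < norm x \<Longrightarrow> m0 * norm x * \<bar>\<phi> x\<bar> powr q < 1"
proof -
  obtain R1 where R1: "0 < R1" "\<And>x. R1 < norm x \<Longrightarrow> m0 * norm x * (max 0 (\<phi> x)) powr q < 1"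
    using decay_pos[OF assms] by blast
  obtain R2 where R2: "0 < R2" "\<And>x. R2 < norm x \<Longrightarrow> m0 * norm x * (max 0 (- \<phi> x)) powr q < 1"
    using critical_solution.decay_pos[OF uminus_critical_solution assms] by blast
  show ?thesis
  proof (rule that[of "max R1 R2"])
    fix x :: "real^'n" assume "max R1 R2 < norm x"
    then have "R1 < norm x" "R2 < norm x" by auto
    then show "m0 * norm x * \<bar>\<phi> x\<bar> powr q < 1" using R1(2)[of x] R2(2)[of x] by (cases "\<phi> x \<ge> 0") auto
  qed (use R1 in auto)
qed

text \<open>Since \<open>q\<close> times n - 2 equals 2, the decay assumption bounds
  \<open>(\<phi> x)\<^sup>2\<close> by \<epsilon> / R^(n - 2). With the slope of order 1 / R, the
  arithmetic-geometric inequality leaves half the gradient energy and a term of order \<epsilon> /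
  R^n, whose integral over the ball is of order \<epsilon>.\<close>

lemma boundary_term_bound:
  assumes R: "0 < R" and \<epsilon>: "0 < \<epsilon>" "\<epsilon> \<le> 1"
    and small: "\<And>x. R \<le> norm x \<Longrightarrow> norm x * \<bar>\<phi> x\<bar> powr q \<le> \<epsilon>"
  shows "\<bar>cutoff_slope R x * \<phi> x * (x \<bullet> grad \<phi> x)\<bar>
    \<le> 1/2 * (indicator {x. R \<le> norm x} x * (norm (grad \<phi> x))\<^sup>2) + 128 * \<epsilon> / R ^ CARD('n) * indicator (cball 0 (2 * R)) x"
proof (cases "R \<le> norm x \<and> norm x \<le> 2 * R")
  case False
  then have "cutoff_slope R x = 0" using cutoff_slope_eq_0[of x R] cutoff_slope_eq_0'[of R x] R by linarith
  then show ?thesis using R \<epsilon> by (simp add: indicator_def)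
next
  case True
  let ?n = "CARD('n)"
  have Rx: "R \<le> norm x" "norm x \<le> 2 * R" using True by auto
  have x0: "0 < norm x" using Rx R by linarith
  have "\<bar>\<phi> x\<bar> powr q \<le> \<epsilon> / R"
  proof -
    have "R * \<bar>\<phi> x\<bar> powr q \<le> norm x * \<bar>\<phi> x\<bar> powr q" using Rx by (simp add: mult_right_mono)
    also have "\<dots> \<le> \<epsilon>" using small[OF Rx(1)] .
    finally show ?thesis using R by (simp add: field_simps)
  qed
  then have "(\<bar>\<phi> x\<bar> powr q) ^ (?n - 2) \<le> (\<epsilon> / R) ^ (?n - 2)" by (intro power_mono) auto
  moreover have "(\<bar>\<phi> x\<bar> powr q) ^ (?n - 2) = (\<phi> x)\<^sup>2"
  proof (cases "\<phi> x = 0")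
    case True then show ?thesis using dim by simp
  next
    case False
    have "(\<bar>\<phi> x\<bar> powr q) ^ (?n - 2) = \<bar>\<phi> x\<bar> powr (real (?n - 2) * q)" using False by (simp add: powr_power)
    also have "real (?n - 2) * q = 2" using dim by (simp add: q of_nat_diff field_simps)
    also have "\<bar>\<phi> x\<bar> powr 2 = (\<phi> x)\<^sup>2" using False by (simp add: powr_numeral)
    finally show ?thesis .
  qed
  \<comment> \<open>The power n - 2 is at least 1 and \<epsilon> at most 1, so one factor \<epsilon>
    can be kept and the others dropped.\<close>
  moreover have "(\<epsilon> / R) ^ (?n - 2) \<le> \<epsilon> / R ^ (?n - 2)"
  proof -
    have "\<epsilon> ^ (?n - 2) \<le> \<epsilon> ^ 1" using \<epsilon> dim by (intro power_decreasing) auto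
    then show ?thesis using R by (simp add: power_divide divide_right_mono)
  qed
  ultimately have \<phi>2: "(\<phi> x)\<^sup>2 \<le> \<epsilon> / R ^ (?n - 2)" by linarith
  define A where "A = \<bar>cutoff_slope R x\<bar> * norm x"
  have "A \<le> 8 / R\<^sup>2 * (2 * R)" unfolding A_def using cutoff_slope_bound[of R x] Rx by (intro mult_mono) auto
  then have A: "A \<le> 16 / R" using R by (simp add: power2_eq_square)
  have A0: "0 \<le> A" by (simp add: A_def)
  have "A\<^sup>2 \<le> (16 / R)\<^sup>2" using A A0 by (rule power_mono)
  then have "A\<^sup>2 * (\<phi> x)\<^sup>2 \<le> (16 / R)\<^sup>2 * (\<epsilon> / R ^ (?n - 2))" using \<phi>2 by (intro mult_mono) auto
  also have "\<dots> = 256 * \<epsilon> / R ^ ?n"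
  proof -
    have "?n = 2 + (?n - 2)" using dim by linarith
    then have "R ^ ?n = R ^ (2 + (?n - 2))" by (rule arg_cong)
    also have "\<dots> = R ^ 2 * R ^ (?n - 2)" by (rule power_add)
    finally have e: "R ^ ?n = R ^ 2 * R ^ (?n - 2)" .
    show ?thesis unfolding e using R by (simp add: power_divide)
  qed
  finally have A\<phi>: "A\<^sup>2 * (\<phi> x)\<^sup>2 \<le> 256 * \<epsilon> / R ^ ?n" .
  have "\<bar>cutoff_slope R x * \<phi> x * (x \<bullet> grad \<phi> x)\<bar> \<le> \<bar>cutoff_slope R x * \<phi> x\<bar> * (norm x * norm (grad \<phi> x))"
    unfolding abs_mult[of _ "x \<bullet> grad \<phi> x"] by (intro mult_left_mono Cauchy_Schwarz_ineq2) auto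
  also have "\<dots> = (A * \<bar>\<phi> x\<bar>) * norm (grad \<phi> x)" by (simp add: A_def abs_mult)
  also have "\<dots> \<le> 1/2 * (norm (grad \<phi> x))\<^sup>2 + 1/2 * (A * \<bar>\<phi> x\<bar>)\<^sup>2"
    using sum_squares_bound[of "A * \<bar>\<phi> x\<bar>" "norm (grad \<phi> x)"] by simp
  also have "(A * \<bar>\<phi> x\<bar>)\<^sup>2 = A\<^sup>2 * (\<phi> x)\<^sup>2" by (simp add: power_mult_distrib)
  finally show ?thesis using A\<phi> Rx by (simp add: indicator_def)
qed

text \<open>This is the limit of \<open>cutoff_identity\<close> along integer radii. The cut-off
  integrals converge by domination; the term with the slope is at most half a gradient tail plus a
  fixed multiple of an arbitrarily small \<epsilon>.\<close>

theorem energy_identity: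
  "(LINT x|lborel. (norm (grad \<phi> x))\<^sup>2) = k * (LINT x|lborel. \<bar>\<phi> x\<bar> powr (q * CARD('n)))"
proof -
  let ?n = "CARD('n)"
  let ?\<kappa> = "measure lborel (ball (0 :: real^'n) 1)"
  define B where "B R x = cutoff_slope R x * \<phi> x * (x \<bullet> grad \<phi> x)" for R x
  define T where "T x = (norm (grad \<phi> x))\<^sup>2" for x
  define W where "W x = \<bar>\<phi> x\<bar> powr (q * ?n)" for x
  have iT: "integrable lborel T" and iW: "integrable lborel W"
    using int_grad int_pot by (simp_all add: T_def[abs_def] W_def[abs_def])
  have iB: "integrable lborel (B R)" if "0 < R" for R
  proof (rule integrable_continuous_bounded_support[of _ "2 * R"])
    show "continuous_on UNIV (B R)" unfolding B_def[abs_def]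
      by (intro continuous_intros cutoff_continuous C2_continuous[OF \<phi>] C2_grad_continuous[OF \<phi>])
    show "B R x = 0" if "2 * R < norm x" for x using that \<open>0 < R\<close> by (simp add: B_def cutoff_slope_eq_0')
  qed
  have mc: "cutoff R \<in> borel_measurable borel" for R :: real
    by (rule borel_measurable_continuous_onI) (rule cutoff_continuous)
  have icut: "integrable lborel (\<lambda>x. cutoff R x * f x)" if "integrable lborel f" for R and f :: "real^'n \<Rightarrow> real"
  proof (rule Bochner_Integration.integrable_bound[OF that])
    show "(\<lambda>x. cutoff R x * f x) \<in> borel_measurable lborel"
      using mc borel_measurable_integrable[OF that] by measurable
    show "AE x in lborel. norm (cutoff R x * f x) \<le> norm (f x)"
      by (intro AE_I2) (simp add: abs_mult cutoff_bounds mult_left_le_one_le)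
  qed
  have "\<phi> x * laplacian \<phi> x = - k * W x" for x
  proof -
    have "q * ?n = 2 * q + 2" using dim by (simp add: q field_simps)
    then have "W x = \<bar>\<phi> x\<bar> powr (2 * q) * \<bar>\<phi> x\<bar> powr 2" by (simp add: W_def powr_add)
    also have "\<bar>\<phi> x\<bar> powr 2 = \<phi> x * \<phi> x" by (cases "\<phi> x = 0") (simp_all add: powr_numeral power2_eq_square)
    finally show ?thesis unfolding pde by simp
  qed
  then have id: "(LINT x|lborel. B R x) + (LINT x|lborel. cutoff R x * T x) - k * (LINT x|lborel. cutoff R x * W x) = 0"
    if "0 < R" for R
    using cutoff_identity[OF \<phi> that] iB[OF that] icut[OF iT, of R] icut[OF iW, of R]
    by (simp add: B_def[symmetric] T_def[symmetric] mult.left_commute[of _ k])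
  have cutlim: "(\<lambda>j. LINT x|lborel. cutoff (real (Suc j)) x * f x) \<longlonglongrightarrow> (LINT x|lborel. f x)"
    if f: "integrable lborel f" for f :: "real^'n \<Rightarrow> real"
  proof (rule integral_dominated_convergence[where w = "\<lambda>x. norm (f x)"])
    show "f \<in> borel_measurable lborel" using f by auto
    show "(\<lambda>x. cutoff (real (Suc j)) x * f x) \<in> borel_measurable lborel" for j
      using icut[OF f] by auto
    show "integrable lborel (\<lambda>x. norm (f x))" using f by simp
    show "AE x in lborel. norm (cutoff (real (Suc j)) x * f x) \<le> norm (f x)" for j
      by (intro AE_I2) (simp add: abs_mult cutoff_bounds mult_left_le_one_le del: of_nat_Suc)
    show "AE x in lborel. (\<lambda>j. cutoff (real (Suc j)) x * f x) \<longlonglongrightarrow> f x"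
    proof (intro AE_I2 tendsto_eventually)
      fix x :: "real^'n"
      show "\<forall>\<^sub>F j in sequentially. cutoff (real (Suc j)) x * f x = f x"
        using eventually_ge_at_top[of "nat \<lceil>norm x\<rceil>"]
      proof eventually_elim
        case (elim j)
        then have "norm x \<le> real (Suc j)" by linarith
        then show ?case by (simp add: cutoff_eq_1)
      qed
    qed
  qed
  have taillim: "(\<lambda>j. LINT x|lborel. indicator {x. real (Suc j) \<le> norm x} x * T x) \<longlonglongrightarrow> (LINT x|(lborel :: (real^'n) measure). 0)"
  proof (rule integral_dominated_convergence[where w = T])
    have cl: "{x :: real^'n. real (Suc j) \<le> norm x} \<in> sets borel" for j by measurable
    show "(\<lambda>x. indicator {x. real (Suc j) \<le> norm x} x * T x) \<in> borel_measurable lborel" for j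
      using cl iT by measurable
    show "AE x in lborel. (\<lambda>j. indicator {x. real (Suc j) \<le> norm x} x * T x) \<longlonglongrightarrow> 0"
    proof (intro AE_I2 tendsto_eventually)
      fix x :: "real^'n"
      show "\<forall>\<^sub>F j in sequentially. indicator {x. real (Suc j) \<le> norm x} x * T x = 0"
        using eventually_ge_at_top[of "nat \<lceil>norm x\<rceil>"]
      proof eventually_elim
        case (elim j)
        then have "norm x < real (Suc j)" by linarith
        then show ?case by simp
      qed
    qed
  qed (use iT in \<open>auto simp: T_def indicator_def\<close>)
  have "(\<lambda>j. LINT x|lborel. B (real (Suc j)) x) \<longlonglongrightarrow> 0"
  proof (rule LIMSEQ_I)
    fix r :: real assume r: "0 < r"
    \<comment> \<open>The ball of radius 2 * R contributes the factor 2^n; the summand 1 secures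
      positivity for the division in the choice of \<epsilon>.\<close>
    define C where "C = 128 * 2 ^ ?n * ?\<kappa> + 1"
    have C: "C > 0" by (simp add: C_def add_nonneg_pos)
    define \<epsilon> where "\<epsilon> = min 1 (r / (2 * C))"
    have \<epsilon>: "0 < \<epsilon>" "\<epsilon> \<le> 1" using r C by (auto simp: \<epsilon>_def)
    obtain R0 where R0: "0 < R0" "\<And>x. R0 < norm x \<Longrightarrow> 1 / \<epsilon> * norm x * \<bar>\<phi> x\<bar> powr q < 1"
      using decay_abs[of "1 / \<epsilon>"] \<epsilon> by auto
    have "\<forall>\<^sub>F j in sequentially. (LINT x|lborel. indicator {x. real (Suc j) \<le> norm x} x * T x) < r"
      using taillim r by (auto dest: order_tendstoD(2))
    moreover have "\<forall>\<^sub>F j in sequentially. R0 < real (Suc j)"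
      using eventually_ge_at_top[of "nat \<lceil>R0\<rceil>"] by eventually_elim linarith
    ultimately have "\<forall>\<^sub>F j in sequentially. norm ((LINT x|lborel. B (real (Suc j)) x) - 0) < r"
    proof eventually_elim
      case (elim j)
      let ?R = "real (Suc j)"
      have R: "0 < ?R" by simp
      have small: "norm x * \<bar>\<phi> x\<bar> powr q \<le> \<epsilon>" if "?R \<le> norm x" for x
      proof -
        have "R0 < norm x" using that elim(2) by linarith
        from R0(2)[OF this] show ?thesis using \<epsilon> by (simp add: field_simps)
      qed
      have iI: "integrable lborel (\<lambda>x. indicator {x. ?R \<le> norm x} x * T x)"
        using integrable_mult_indicator[OF _ iT, of "{x. ?R \<le> norm x}"] by simp
      have iC: "integrable lborel (\<lambda>x::real^'n. 128 * \<epsilon> / ?R ^ ?n * indicator (cball 0 (2 * ?R)) x)"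
        by (intro integrable_mult_right integrable_real_indicator emeasure_lborel_cball_finite) auto
      have "norm (LINT x|lborel. B ?R x) \<le> (LINT x|lborel. norm (B ?R x))" by (rule integral_norm_bound)
      also have "\<dots> \<le> (LINT x|lborel. 1/2 * (indicator {x. ?R \<le> norm x} x * T x)
           + 128 * \<epsilon> / ?R ^ ?n * indicator (cball 0 (2 * ?R)) x)"
      proof (rule integral_mono)
        show "integrable lborel (\<lambda>x. norm (B ?R x))" using iB[OF R] by (rule integrable_norm)
        show "integrable lborel (\<lambda>x. 1/2 * (indicator {x. ?R \<le> norm x} x * T x)
           + 128 * \<epsilon> / ?R ^ ?n * indicator (cball 0 (2 * ?R)) x)"
          by (intro Bochner_Integration.integrable_add integrable_mult_right iI iC)
        show "norm (B ?R x) \<le> 1/2 * (indicator {x. ?R \<le> norm x} x * T x)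
           + 128 * \<epsilon> / ?R ^ ?n * indicator (cball 0 (2 * ?R)) x" for x
          using boundary_term_bound[OF R \<epsilon> small] unfolding B_def T_def real_norm_def .
      qed
      also have "\<dots> = 1/2 * (LINT x|lborel. indicator {x. ?R \<le> norm x} x * T x)
           + 128 * \<epsilon> / ?R ^ ?n * measure lborel (cball (0::real^'n) (2 * ?R))"
        using iI iC by simp
      also have "measure lborel (cball (0::real^'n) (2 * ?R)) = (2 * ?R) ^ ?n * ?\<kappa>"
        using content_ball_conv_unit_ball[of "2 * ?R" "0 :: real^'n"] content_cball_conv_ball[of "0 :: real^'n" "2 * ?R"] by simp
      also have "128 * \<epsilon> / ?R ^ ?n * ((2 * ?R) ^ ?n * ?\<kappa>) = \<epsilon> * (128 * 2 ^ ?n * ?\<kappa>)"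
        unfolding power_mult_distrib using R by (simp del: of_nat_Suc)
      also have "\<dots> \<le> \<epsilon> * C" using \<epsilon> by (simp add: C_def)
      also have "\<epsilon> * C \<le> r / (2 * C) * C" using C by (intro mult_right_mono) (auto simp: \<epsilon>_def)
      also have "r / (2 * C) * C = r / 2" using C by simp
      finally show ?case using elim(1) by simp
    qed
    then show "\<exists>N. \<forall>j\<ge>N. norm ((LINT x|lborel. B (real (Suc j)) x) - 0) < r"
      by (simp add: eventually_sequentially)
  qed
  then have "(\<lambda>j. (LINT x|lborel. B (real (Suc j)) x) + (LINT x|lborel. cutoff (real (Suc j)) x * T x)
      - k * (LINT x|lborel. cutoff (real (Suc j)) x * W x)) \<longlonglongrightarrow> 0 + (LINT x|lborel. T x) - k * (LINT x|lborel. W x)"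
    by (intro tendsto_intros cutlim iT iW)
  then have "(\<lambda>j::nat. 0::real) \<longlonglongrightarrow> 0 + (LINT x|lborel. T x) - k * (LINT x|lborel. W x)"
    by (simp only: id[OF of_nat_0_less_iff[THEN iffD2, OF zero_less_Suc]])
  then have "0 = 0 + (LINT x|lborel. T x) - k * (LINT x|lborel. W x)" by (simp add: LIMSEQ_const_iff)
  then show ?thesis by (simp add: T_def W_def)
qed

end

section \<open>The bubble and the minimal action\<close>

lemma integrable_inverse_quadratic_powr:
  fixes c p :: real
  assumes c: "0 < c" and p: "1 / 2 < p"
  shows "integrable lborel (\<lambda>t. (t\<^sup>2 + c) powr (- p))"
proof -
  define h :: "real \<Rightarrow> real" where "h t = indicator {1..} t * t powr (- 2 * p)" for t
  have mh: "h \<in> borel_measurable borel" unfolding h_def[abs_def] by measurable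
  have "(\<lambda>t::real. t powr (- 2 * p)) integrable_on {1..}"
    using has_integral_powr_to_inf[of "- 2 * p" 1] p by (auto simp: integrable_on_def)
  then have "(\<lambda>t::real. t powr (- 2 * p)) absolutely_integrable_on {1..}"
    by (simp add: absolutely_integrable_on_iff_nonneg)
  then have ih: "integrable lborel h"
    using mh unfolding set_integrable_def h_def[abs_def] by (simp add: integrable_completion)
  have ih': "integrable lborel (\<lambda>t. h (- t))"
    using lborel_integrable_real_affine[OF ih, of "-1" 0] by simp
  have i1: "integrable lborel (\<lambda>t::real. c powr (- p) * indicator {-1..1} t)"
    by (intro integrable_mult_right integrable_real_indicator) auto
  show ?thesis
  proof (rule Bochner_Integration.integrable_bound)
    show "integrable lborel (\<lambda>t. (c powr (- p) * indicator {-1..1} t + h t) + h (- t))"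
      by (intro Bochner_Integration.integrable_add i1 ih ih')
    show "(\<lambda>t. (t\<^sup>2 + c) powr (- p)) \<in> borel_measurable lborel" by measurable
    show "AE t in lborel. norm ((t\<^sup>2 + c) powr (- p)) \<le> norm ((c powr (- p) * indicator {-1..1} t + h t) + h (- t))"
    proof (rule AE_I2)
      fix t :: real
      have h0: "0 \<le> h t" "0 \<le> h (- t)" by (simp_all add: h_def)
      have "(t\<^sup>2 + c) powr (- p) \<le> (c powr (- p) * indicator {-1..1} t + h t) + h (- t)"
      proof (cases "\<bar>t\<bar> \<le> 1")
        case True
        have "(t\<^sup>2 + c) powr (- p) \<le> c powr (- p)" using c p by (intro powr_mono2') auto
        then show ?thesis using True h0 by (simp add: abs_le_iff)
      next
        case False
        have "(t\<^sup>2 + c) powr (- p) \<le> (\<bar>t\<bar> powr 2) powr (- p)"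
          using c p False by (intro powr_mono2') auto
        also have "\<dots> = \<bar>t\<bar> powr (- 2 * p)" unfolding powr_powr by simp
        also have "\<dots> \<le> h t + h (- t)" using False h0 by (cases "t \<ge> 0") (auto simp: h_def)
        finally show ?thesis
          using mult_nonneg_nonneg[OF powr_ge_zero[of c "- p"] indicator_pos_le[of "{-1..1}" t]] by linarith
      qed
      then show "norm ((t\<^sup>2 + c) powr (- p)) \<le> norm ((c powr (- p) * indicator {-1..1} t + h t) + h (- t))" by simp
    qed
  qed
qed

text \<open>Polar coordinates are avoided: the squared norm dominates each squared coordinate, so
  distributing the power evenly over the coordinates bounds the function by a product of
  one-variable functions.\<close>

lemma integrable_inverse_quadratic_power:
  fixes c :: real
  assumes c: "0 < c" and m: "real CARD('n) < 2 * real m"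
  shows "integrable lborel (\<lambda>x :: real^'n. 1 / ((norm x)\<^sup>2 + c) ^ m)"
proof -
  \<comment> \<open>Each coordinate receives the share \<open>m / CARD('n)\<close> of the exponent,
    and the assumption on \<open>m\<close> says that it exceeds the one-dimensional threshold 1 /
    2.\<close>
  define p where "p = real m / CARD('n)"
  have p: "1 / 2 < p" using m by (simp add: p_def field_simps)
  define f where "f t = (t\<^sup>2 + c) powr (- p)" for t :: real
  have f0: "0 \<le> f t" for t by (simp add: f_def)
  have mf: "f \<in> borel_measurable borel" unfolding f_def[abs_def] by measurable
  have "(\<integral>\<^sup>+t. ennreal (f t) \<partial>lborel) < \<infinity>"
    using integrable_inverse_quadratic_powr[OF c p] f0 unfolding f_def[symmetric]
    by (simp add: integrable_iff_bounded)
  then have "(\<Prod>b\<in>(Basis :: (real^'n) set). \<integral>\<^sup>+t. ennreal (f t) \<partial>lborel) < \<infinity>"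
    by (simp add: power_less_top_ennreal)
  then have "(\<integral>\<^sup>+x. (\<Prod>b\<in>Basis. ennreal (f ((x::real^'n) \<bullet> b))) \<partial>lborel) < \<infinity>"
    using nn_integral_lborel_prod[of "\<lambda>b::real^'n. \<lambda>t. ennreal (f t)"] mf by simp
  then have fin: "(\<integral>\<^sup>+x. ennreal (\<Prod>b\<in>Basis. f ((x::real^'n) \<bullet> b)) \<partial>lborel) < \<infinity>"
    by (simp add: prod_ennreal f0)
  have mP: "(\<lambda>x::real^'n. \<Prod>b\<in>Basis. f (x \<bullet> b)) \<in> borel_measurable borel"
    using mf by measurable
  have iP: "integrable lborel (\<lambda>x::real^'n. \<Prod>b\<in>Basis. f (x \<bullet> b))"
    using fin mP by (intro integrableI_nonneg) (auto intro!: prod_nonneg f0)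
  show ?thesis
  proof (rule Bochner_Integration.integrable_bound[OF iP])
    show "(\<lambda>x :: real^'n. 1 / ((norm x)\<^sup>2 + c) ^ m) \<in> borel_measurable lborel" by measurable
    show "AE x :: real^'n in lborel. norm (1 / ((norm x)\<^sup>2 + c) ^ m) \<le> norm (\<Prod>b\<in>Basis. f (x \<bullet> b))"
    proof (rule AE_I2)
      fix x :: "real^'n"
      have y0: "0 < (norm x)\<^sup>2 + c" using c by (simp add: add_nonneg_pos)
      have "1 / ((norm x)\<^sup>2 + c) ^ m = ((norm x)\<^sup>2 + c) powr (- real m)"
        using y0 by (simp add: powr_minus_divide powr_realpow)
      also have "\<dots> = ((norm x)\<^sup>2 + c) powr (- p * CARD('n))" by (simp add: p_def)
      also have "\<dots> = (((norm x)\<^sup>2 + c) powr (- p)) ^ CARD('n)"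
        using y0 by (simp add: powr_power mult.commute)
      also have "\<dots> = (\<Prod>b\<in>(Basis :: (real^'n) set). ((norm x)\<^sup>2 + c) powr (- p))" by simp
      also have "\<dots> \<le> (\<Prod>b\<in>Basis. f (x \<bullet> b))"
      proof (intro prod_mono conjI)
        fix b :: "real^'n" assume b: "b \<in> Basis"
        have "\<bar>x \<bullet> b\<bar> \<le> norm x" using b by (rule Basis_le_norm)
        then have "(x \<bullet> b)\<^sup>2 \<le> (norm x)\<^sup>2" by (metis abs_ge_zero power2_abs power_mono)
        then show "((norm x)\<^sup>2 + c) powr (- p) \<le> f (x \<bullet> b)"
          unfolding f_def using c p by (intro powr_mono2') (auto intro: add_nonneg_pos)
      qed simp
      finally show "norm (1 / ((norm x)\<^sup>2 + c) ^ m) \<le> norm (\<Prod>b\<in>Basis. f (x \<bullet> b))"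
        using y0 by (simp add: prod_nonneg f0)
    qed
  qed
qed

lemma weight_integral_pos:
  fixes c :: real
  assumes c: "0 < c"
  shows "integrable lborel (weight c :: real^'n \<Rightarrow> real)" and "0 < (LINT (p::real^'n)|lborel. weight c p)"
proof -
  have "0 < CARD('n)" by simp
  then show i: "integrable lborel (weight c :: real^'n \<Rightarrow> real)"
    unfolding weight_def[abs_def] by (intro integrable_inverse_quadratic_power[OF c]) linarith
  have "(LINT (p::real^'n)|lborel. weight c p) \<noteq> 0"
  proof
    assume "(LINT (p::real^'n)|lborel. weight c p) = 0"
    then have "AE p :: real^'n in lborel. weight c p = 0"
      using i by (subst integral_nonneg_eq_0_iff_AE[symmetric]) (auto simp: less_imp_le[OF weight_pos[OF c]])
    moreover have "weight c (p::real^'n) \<noteq> 0" for p using weight_pos[OF c, of p] by simp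
    ultimately have "(UNIV :: (real^'n) set) = {}" by (intro AE_lborel_open_empty) auto
    then show False by simp
  qed
  moreover have "0 \<le> (LINT (p::real^'n)|lborel. weight c p)"
    by (intro Bochner_Integration.integral_nonneg less_imp_le weight_pos c)
  ultimately show "0 < (LINT (p::real^'n)|lborel. weight c p)" by simp
qed

section \<open>The explicit solution: the Aubin-Talenti bubble\<close>

definition bubble :: "real \<Rightarrow> real \<Rightarrow> 'a::euclidean_space \<Rightarrow> real" where
  "bubble c s x = ((x \<bullet> x + c) / 2) powr (- s)"

lemma bubble_profile_has_derivative:
  fixes c r :: real
  assumes c: "0 < c"
  shows "((\<lambda>x::'a::euclidean_space. ((x \<bullet> x + c) / 2) powr r) has_derivative
    (\<lambda>h. r * ((x \<bullet> x + c) / 2) powr (r - 1) * (x \<bullet> h))) (at x)"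
proof -
  have pos: "0 < (x \<bullet> x + c) / 2" using c by (simp add: add_nonneg_pos)
  have 1: "((\<lambda>x::'a. (x \<bullet> x + c) / 2) has_derivative (\<lambda>h. x \<bullet> h)) (at x)"
  proof (rule has_derivative_eq_rhs)
    show "((\<lambda>x::'a. (x \<bullet> x + c) / 2) has_derivative (\<lambda>h. ((x \<bullet> h + h \<bullet> x) + 0) * inverse 2)) (at x)"
      unfolding divide_inverse
      by (intro has_derivative_add has_derivative_mult_left has_derivative_const
          has_derivative_inner has_derivative_ident)
  qed (simp add: fun_eq_iff inner_commute)
  have 2: "((\<lambda>z. z powr r) has_derivative (\<lambda>h. r * ((x \<bullet> x + c) / 2) powr (r - 1) * h)) (at ((x \<bullet> x + c) / 2))"
    using has_real_derivative_powr[OF pos, of r] by (simp add: has_field_derivative_def)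
  show ?thesis by (rule has_derivative_compose[OF 1 2])
qed

lemma bubble_partials:
  fixes c s :: real
  assumes c: "0 < c"
  shows "partial b (bubble c s) = (\<lambda>x::'a::euclidean_space. - s * ((x \<bullet> x + c) / 2) powr (- s - 1) * (x \<bullet> b))"
    and "partial d (partial b (bubble c s)) = (\<lambda>x::'a. - s * ((x \<bullet> x + c) / 2) powr (- s - 1) * (d \<bullet> b)
      + s * (s + 1) * ((x \<bullet> x + c) / 2) powr (- s - 2) * (x \<bullet> d) * (x \<bullet> b))"
    and "grad (bubble c s) (x::'a) = (- s * ((x \<bullet> x + c) / 2) powr (- s - 1)) *\<^sub>R x"
    and "C2 (bubble c s :: 'a \<Rightarrow> real)"
proof -
  have d1: "(bubble c s has_derivative (\<lambda>h. - s * ((x \<bullet> x + c) / 2) powr (- s - 1) * (x \<bullet> h))) (at x)" for x :: 'a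
    unfolding bubble_def[abs_def] by (rule bubble_profile_has_derivative[OF c])
  show p1: "partial b (bubble c s) = (\<lambda>x::'a. - s * ((x \<bullet> x + c) / 2) powr (- s - 1) * (x \<bullet> b))" for b
    by (rule ext) (simp only: partial_def frechet_derivative_at[OF d1, symmetric])
  have d2: "((\<lambda>x::'a. - s * ((x \<bullet> x + c) / 2) powr (- s - 1) * (x \<bullet> b)) has_derivative
     (\<lambda>h. - s * ((x \<bullet> x + c) / 2) powr (- s - 1) * (h \<bullet> b)
        + (- s * ((- s - 1) * ((x \<bullet> x + c) / 2) powr ((- s - 1) - 1) * (x \<bullet> h))) * (x \<bullet> b))) (at x)" for x b
    by (intro has_derivative_mult has_derivative_mult_right bubble_profile_has_derivative[OF c]
        has_derivative_inner_left has_derivative_ident)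
  show p2: "partial d (partial b (bubble c s)) = (\<lambda>x::'a. - s * ((x \<bullet> x + c) / 2) powr (- s - 1) * (d \<bullet> b)
      + s * (s + 1) * ((x \<bullet> x + c) / 2) powr (- s - 2) * (x \<bullet> d) * (x \<bullet> b))" for d b
  proof
    fix x :: 'a
    show "partial d (partial b (bubble c s)) x = - s * ((x \<bullet> x + c) / 2) powr (- s - 1) * (d \<bullet> b)
      + s * (s + 1) * ((x \<bullet> x + c) / 2) powr (- s - 2) * (x \<bullet> d) * (x \<bullet> b)"
      unfolding p1 partial_def[of d] frechet_derivative_at[OF d2, symmetric]
      by (simp add: algebra_simps)
  qed
  have "(bubble c s has_derivative (\<lambda>h. h \<bullet> ((- s * ((x \<bullet> x + c) / 2) powr (- s - 1)) *\<^sub>R x))) (at x)"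
    by (rule has_derivative_eq_rhs[OF d1]) (simp add: fun_eq_iff inner_commute)
  then show "grad (bubble c s) x = (- s * ((x \<bullet> x + c) / 2) powr (- s - 1)) *\<^sub>R x"
    by (intro grad_eq_gderiv) (simp add: gderiv_def)
  have nz: "(x \<bullet> x + c) / 2 \<noteq> 0" for x :: 'a using add_nonneg_pos[OF inner_ge_zero[of x] c] by simp
  show "C2 (bubble c s :: 'a \<Rightarrow> real)"
    unfolding C2_def
  proof (intro conjI ballI allI)
    show "bubble c s differentiable (at x)" for x :: 'a using d1 by (rule differentiableI)
    show "partial b (bubble c s) differentiable (at x)" for b x :: 'a
      unfolding p1 using d2 by (rule differentiableI)
    show "continuous_on UNIV (partial d (partial b (bubble c s)))" for b d :: 'a
      unfolding p2 using nz by (intro continuous_intros) auto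
  qed
qed

text \<open>When \<open>2 * s + 2\<close> is the dimension, substituting
  \<open>x \<bullet> x = 2 * v - c\<close> cancels the terms of order
  \<open>v powr (- s - 1)\<close>. The surviving \<open>v powr (- s - 2)\<close> is the critical
  power of the bubble.\<close>

lemma bubble_laplacian:
  fixes c s :: real
  assumes c: "0 < c" and s: "2 * s + 2 = DIM('a::euclidean_space)"
  shows "laplacian (bubble c s) (x::'a) = - (s * (s + 1) * c) * ((x \<bullet> x + c) / 2) powr (- s - 2)"
proof -
  define v where "v = (x \<bullet> x + c) / 2"
  have v: "0 < v" using c by (simp add: v_def add_nonneg_pos)
  have "laplacian (bubble c s) x = (\<Sum>b\<in>Basis. - s * v powr (- s - 1) + s * (s + 1) * v powr (- s - 2) * ((x \<bullet> b) * (x \<bullet> b)))"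
    unfolding laplacian_def bubble_partials(2)[OF c] v_def by (intro sum.cong) (auto simp: mult.assoc)
  also have "\<dots> = DIM('a) * (- s * v powr (- s - 1)) + s * (s + 1) * v powr (- s - 2) * (x \<bullet> x)"
    by (simp only: sum.distrib sum_distrib_left[symmetric] sum_constant euclidean_inner[of x x, symmetric]) simp
  also have "x \<bullet> x = 2 * v - c" unfolding v_def by (simp add: field_simps)
  also have "s * (s + 1) * v powr (- s - 2) * (2 * v - c) = s * (2 * s + 2) * v powr (- s - 1) - s * (s + 1) * c * v powr (- s - 2)"
  proof -
    have "- s - 1 = (- s - 2) + 1" by simp
    then have "v powr (- s - 1) = v powr ((- s - 2) + 1)" by (rule arg_cong)
    also have "\<dots> = v powr (- s - 2) * v" using v by (simp only: powr_add) simp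
    finally show ?thesis by (simp add: algebra_simps)
  qed
  finally show ?thesis using s by (simp add: v_def[symmetric])
qed

section \<open>Minimal mass of a nontrivial solution\<close>

context critical_solution begin

definition c0 where "c0 = 2 * q * k / CARD('n)"

lemma c0_pos: "0 < c0"
  using q_pos k dim by (simp add: c0_def)

lemma conformal_factor_pos_part:
  "conformal_factor (\<lambda>x. (max 0 (\<phi> x)) powr q)
    (\<lambda>x. (- q * \<phi> x powr (- q - 1)) *\<^sub>R grad \<phi> x)
    (\<lambda>x h. (q * (q + 1) * \<phi> x powr (- q - 2) * (grad \<phi> x \<bullet> h)) *\<^sub>R grad \<phi> x
        + (- q * \<phi> x powr (- q - 1)) *\<^sub>R hessian \<phi> x h) c0"
  unfolding c0_def by (rule conformal_factor_of_solution[OF dim q k \<phi> pde int_pot])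

definition pos_mass where "pos_mass = (LINT x|lborel. (max 0 (\<phi> x)) powr (q * CARD('n)))"

text \<open>The factor undoes the halving in \<open>mass_lower_bound\<close>. The value depends on
  the solution only through \<open>q\<close> and \<open>k\<close>, so \<phi> and its negative share
  it.\<close>

definition min_mass where "min_mass = 2 ^ CARD('n) * (LINT (p::real^'n)|lborel. weight c0 p)"

lemma power_pos_part: "((max 0 (\<phi> x)) powr q) ^ CARD('n) = (max 0 (\<phi> x)) powr (q * CARD('n))"
  by (cases "max 0 (\<phi> x) = 0") (auto simp: powr_power mult.commute)

lemma integral_half_power:
  "(LINT x|lborel. ((max 0 (\<phi> x)) powr q / 2) ^ CARD('n)) = pos_mass / 2 ^ CARD('n)"
  by (simp add: power_divide power_pos_part pos_mass_def)

lemma pos_mass_ge: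
  assumes "0 < \<phi> x1"
  shows "min_mass \<le> pos_mass"
proof -
  have "0 < (max 0 (\<phi> x1)) powr q" using assms by simp
  from conformal_factor.mass_lower_bound[OF conformal_factor_pos_part this]
  show ?thesis unfolding integral_half_power by (simp add: min_mass_def field_simps)
qed

lemma min_mass_pos: "0 < min_mass"
  unfolding min_mass_def by (intro mult_pos_pos weight_integral_pos(2) c0_pos) simp

lemma pos_mass_nonneg: "0 \<le> pos_mass"
  unfolding pos_mass_def by (intro Bochner_Integration.integral_nonneg) simp

lemma integrable_pos_part: "integrable lborel (\<lambda>x. (max 0 (\<phi> x)) powr (q * CARD('n)))"
  using conformal_factor.u_int[OF conformal_factor_pos_part] by (simp add: power_pos_part)

end

lemma antimono_quadratic_powr:
  fixes a b r :: real
  assumes "0 < a" "0 < b" "0 \<le> r"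
  shows "antimono_on {0..} (\<lambda>t. (1 / (a * t\<^sup>2 + b)) powr r)"
proof (rule monotone_onI)
  fix t t' :: real assume t: "t \<in> {0..}" "t' \<in> {0..}" "t \<le> t'"
  have "t\<^sup>2 \<le> t'\<^sup>2" using t by (intro power_mono) auto
  then have "a * t\<^sup>2 + b \<le> a * t'\<^sup>2 + b" using assms by simp
  moreover have "0 < a * t\<^sup>2 + b" using assms by (simp add: add_nonneg_pos)
  ultimately have "1 / (a * t'\<^sup>2 + b) \<le> 1 / (a * t\<^sup>2 + b)" by (intro divide_left_mono) auto
  moreover have "0 \<le> 1 / (a * t'\<^sup>2 + b)" using assms by simp
  ultimately show "(1 / (a * t'\<^sup>2 + b)) powr r \<le> (1 / (a * t\<^sup>2 + b)) powr r"
    using assms by (intro powr_mono2) auto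
qed

lemma monotone_spherical_uminus:
  assumes "monotone_spherical (\<lambda>x. - f x)"
  shows "monotone_spherical f"
proof -
  obtain x0 g where g: "\<And>x. - f x = g (norm (x - x0))" "mono_on {0..} g \<or> antimono_on {0..} g"
    using assms by (auto simp: monotone_spherical_def)
  have "f x = - g (norm (x - x0))" for x using g(1)[of x] by simp
  moreover have "mono_on {0..} (\<lambda>t. - g t) \<or> antimono_on {0..} (\<lambda>t. - g t)"
    using g(2) by (auto simp: monotone_on_def)
  ultimately show ?thesis unfolding monotone_spherical_def by (intro exI[of _ x0] exI[of _ "\<lambda>t. - g t"]) auto
qed

context critical_solution begin

lemma mass_split:
  "(LINT x|lborel. \<bar>\<phi> x\<bar> powr (q * CARD('n))) = pos_mass + critical_solution.pos_mass (\<lambda>x. - \<phi> x) q"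
proof -
  interpret neg: critical_solution "\<lambda>x. - \<phi> x" q k by (rule uminus_critical_solution)
  have "\<bar>\<phi> x\<bar> powr (q * CARD('n)) = (max 0 (\<phi> x)) powr (q * CARD('n)) + (max 0 (- \<phi> x)) powr (q * CARD('n))" for x
    by (cases "\<phi> x \<ge> 0") auto
  then show ?thesis using integrable_pos_part neg.integrable_pos_part by (simp add: pos_mass_def neg.pos_mass_def)
qed

lemma mass_ge_of_pos:
  assumes x1: "0 < \<phi> x1"
  shows "min_mass \<le> (LINT x|lborel. \<bar>\<phi> x\<bar> powr (q * CARD('n)))"
    and "(LINT x|lborel. \<bar>\<phi> x\<bar> powr (q * CARD('n))) = min_mass \<Longrightarrow> monotone_spherical \<phi>"
proof -
  interpret neg: critical_solution "\<lambda>x. - \<phi> x" q k by (rule uminus_critical_solution)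
  note ge = pos_mass_ge[OF x1]
  show "min_mass \<le> (LINT x|lborel. \<bar>\<phi> x\<bar> powr (q * CARD('n)))"
    unfolding mass_split using ge neg.pos_mass_nonneg by linarith
  assume eq: "(LINT x|lborel. \<bar>\<phi> x\<bar> powr (q * CARD('n))) = min_mass"
  then have neg0: "neg.pos_mass = 0" and pos: "pos_mass = min_mass"
    unfolding mass_split using ge neg.pos_mass_nonneg by linarith+
  \<comment> \<open>A negative value anywhere would give the negative part at least
    \<open>neg.min_mass\<close>, which is positive, although its mass is zero.\<close>
  have nonneg: "0 \<le> \<phi> x" for x
  proof (rule ccontr)
    assume "\<not> 0 \<le> \<phi> x"
    then have "neg.min_mass \<le> neg.pos_mass" by (intro neg.pos_mass_ge[of x]) simp
    then show False using neg0 neg.min_mass_pos by simp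
  qed
  have "(LINT (p::real^'n)|lborel. weight c0 p) = (LINT x|lborel. ((max 0 (\<phi> x)) powr q / 2) ^ CARD('n))"
    unfolding integral_half_power pos by (simp add: min_mass_def)
  moreover have "0 < (max 0 (\<phi> x1)) powr q" using x1 by simp
  ultimately obtain a b x0 where ab: "0 < a" "0 < b"
    "\<And>x. (max 0 (\<phi> x)) powr q = 1 / (a * (norm (x - x0))\<^sup>2 + b)"
    using conformal_factor.quadratic_of_equality[OF conformal_factor_pos_part] by blast
  have "\<phi> x = (1 / (a * (norm (x - x0))\<^sup>2 + b)) powr (1 / q)" for x
  proof -
    have "(1 / (a * (norm (x - x0))\<^sup>2 + b)) powr (1 / q) = (\<phi> x powr q) powr (1 / q)"
      using ab(3)[of x] nonneg[of x] by simp
    also have "\<dots> = \<phi> x" using q_pos nonneg[of x] by (simp add: powr_powr)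
    finally show ?thesis by simp
  qed
  then show "monotone_spherical \<phi>"
    unfolding monotone_spherical_def using antimono_quadratic_powr[OF ab(1,2), of "1 / q"] q_pos
    by (intro exI[of _ x0] exI[of _ "\<lambda>t. (1 / (a * t\<^sup>2 + b)) powr (1 / q)"]) simp
qed

theorem mass_ge:
  assumes nz: "\<phi> \<noteq> (\<lambda>x. 0)"
  shows "min_mass \<le> (LINT x|lborel. \<bar>\<phi> x\<bar> powr (q * CARD('n)))"
    and "(LINT x|lborel. \<bar>\<phi> x\<bar> powr (q * CARD('n))) = min_mass \<Longrightarrow> monotone_spherical \<phi>"
proof -
  interpret neg: critical_solution "\<lambda>x. - \<phi> x" q k by (rule uminus_critical_solution)
  have mm: "neg.min_mass = min_mass" by (simp add: min_mass_def neg.min_mass_def c0_def neg.c0_def)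
  obtain x1 where "\<phi> x1 \<noteq> 0" using nz by auto
  then consider "0 < \<phi> x1" | "0 < - \<phi> x1" by linarith
  note cases = this
  show "min_mass \<le> (LINT x|lborel. \<bar>\<phi> x\<bar> powr (q * CARD('n)))"
    using cases by cases (use mass_ge_of_pos(1) neg.mass_ge_of_pos(1) mm in auto)
  show "monotone_spherical \<phi>" if "(LINT x|lborel. \<bar>\<phi> x\<bar> powr (q * CARD('n))) = min_mass"
    using cases by cases (use mass_ge_of_pos(2) neg.mass_ge_of_pos(2) mm that monotone_spherical_uminus in auto)
qed

text \<open>The energy identity makes the gradient half equal to \<open>- lam * gam / 2\<close>
  times the mass, and \<open>gam / 2 - 1 = q\<close>. Comparing actions thus amounts to comparing
  masses.\<close>

lemma action_eq_mass:
  assumes "gam = q * CARD('n)" "k = - lam * gam"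
  shows "action lam gam \<phi> = - lam * q * (LINT x|lborel. \<bar>\<phi> x\<bar> powr (q * CARD('n)))"
proof -
  have n2: "real CARD('n) - 2 > 0" using dim by simp
  have g: "gam = 2 * q + 2" unfolding assms(1) using n2 by (simp add: q field_simps)
  let ?W = "LINT x|lborel. \<bar>\<phi> x\<bar> powr (q * CARD('n))"
  have "action lam gam \<phi> = 1/2 * (LINT x|lborel. (norm (grad \<phi> x))\<^sup>2) + lam * ?W"
    unfolding action_def potential_def assms(1) using int_grad int_pot by simp
  also have "\<dots> = 1/2 * (- lam * gam * ?W) + lam * ?W" unfolding energy_identity assms(2) ..
  also have "\<dots> = - lam * q * ?W" unfolding g by (simp add: algebra_simps)
  finally show ?thesis .
qed

end

section \<open>Admissible solutions, the bubble as minimizer, and the conclusion\<close>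

lemma critical_solution_of_admissible:
  fixes \<phi> :: "real^'n::finite \<Rightarrow> real"
  assumes dim: "2 < CARD('n)" and q: "q = 2 / (real CARD('n) - 2)" and gam: "gam = q * CARD('n)"
    and lam: "lam < 0" and adm: "admissible lam gam \<phi>"
  shows "critical_solution \<phi> q (- lam * gam)"
proof
  have n2: "real CARD('n) - 2 > 0" using dim by simp
  have g: "gam = 2 * q + 2" unfolding gam using n2 by (simp add: q field_simps)
  have q0: "q > 0" using n2 by (simp add: q)
  show "2 < CARD('n)" "q = 2 / (real CARD('n) - 2)" by fact+
  show "0 < - lam * gam" using lam g q0 by (simp add: mult_neg_pos)
  show "C2 \<phi>" using adm by (simp add: admissible_def is_solution_def)
  show "laplacian \<phi> x = - (- lam * gam) * \<bar>\<phi> x\<bar> powr (2 * q) * \<phi> x" for x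
    using adm by (simp add: admissible_def is_solution_def potential_deriv_def g)
  have "integrable lborel (\<lambda>x. 1/2 * (norm (grad \<phi> x))\<^sup>2)" "integrable lborel (\<lambda>x. lam * \<bar>\<phi> x\<bar> powr gam)"
    using adm by (simp_all add: admissible_def finite_action_def potential_def)
  note int = this
  show "integrable lborel (\<lambda>x. (norm (grad \<phi> x))\<^sup>2)"
    using integrable_mult_right[of 2, OF int(1)] by simp
  show "integrable lborel (\<lambda>x. \<bar>\<phi> x\<bar> powr (q * CARD('n)))"
    using int(2) lam unfolding gam[symmetric] by simp
qed

text \<open>The gradient map of the paraboloid (|x|^2 + c) / 2 is the identity, which is why the
  mass density of the bubble is the weight at \<open>x\<close> itself; its integral is
  \<open>min_mass\<close> when \<open>c\<close> is \<open>c0\<close>.\<close>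

lemma bubble_mass:
  fixes c q :: real
  assumes c: "0 < c" and q: "0 < q"
  shows "\<bar>bubble c (1 / q) (x :: real^'n::finite)\<bar> powr (q * CARD('n)) = 2 ^ CARD('n) * weight c x"
proof -
  have v: "0 < (x \<bullet> x + c) / 2" using c by (simp add: add_nonneg_pos)
  have "\<bar>bubble c (1 / q) x\<bar> powr (q * CARD('n)) = ((x \<bullet> x + c) / 2) powr (- real CARD('n))"
    using q by (simp add: bubble_def powr_powr)
  also have "\<dots> = 1 / ((x \<bullet> x + c) / 2) ^ CARD('n)" using v by (simp add: powr_minus_divide powr_realpow)
  finally show ?thesis by (simp add: weight_def power_divide dot_square_norm)
qed

lemma bubble_monotone_spherical:
  fixes c s :: real
  assumes c: "0 < c" and s: "0 < s"
  shows "monotone_spherical (bubble c s :: 'a::euclidean_space \<Rightarrow> real)"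
proof -
  have "bubble c s x = (1 / (1/2 * (norm (x - 0))\<^sup>2 + c / 2)) powr s" for x :: 'a
  proof -
    have "1/2 * (norm (x - 0))\<^sup>2 + c / 2 = (x \<bullet> x + c) / 2" by (simp add: dot_square_norm)
    moreover have "0 < (x \<bullet> x + c) / 2" using c by (simp add: add_nonneg_pos)
    moreover have "v powr (- s) = (1 / v) powr s" if "0 < v" for v :: real
      using that by (simp add: powr_minus_divide powr_divide)
    ultimately show ?thesis unfolding bubble_def by metis
  qed
  then show ?thesis unfolding monotone_spherical_def
    using antimono_quadratic_powr[of "1/2" "c / 2" s] c s
    by (intro exI[of _ 0] exI[of _ "\<lambda>t. (1 / (1/2 * t\<^sup>2 + c / 2)) powr s"]) simp
qed

lemma bubble_vanishes_at_infinity: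
  fixes c s :: real
  assumes c: "0 < c" and s: "0 < s"
  shows "vanishes_at_infinity (bubble c s :: 'a::euclidean_space \<Rightarrow> real)"
  unfolding vanishes_at_infinity_def bubble_def[abs_def]
proof (rule tendsto_neg_powr)
  \<comment> \<open>The quadratic is compared with a linear minorant obtained from 2 |x| \<le> |x|^2
    + 1.\<close>
  have "filterlim (\<lambda>x::'a. - (1/2) + norm x) at_top at_infinity"
    by (rule filterlim_tendsto_add_at_top[OF tendsto_const])
       (rule filterlim_at_infinity_imp_norm_at_top[OF filterlim_ident])
  then show "filterlim (\<lambda>x::'a. (x \<bullet> x + c) / 2) at_top at_infinity"
  proof (rule filterlim_at_top_mono)
    have "- (1/2) + norm x \<le> (x \<bullet> x + c) / 2" for x :: 'a
      using sum_squares_bound[of "norm x" 1] c by (simp add: dot_square_norm)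
    then show "\<forall>\<^sub>F x::'a in at_infinity. - (1/2) + norm x \<le> (x \<bullet> x + c) / 2" by simp
  qed
qed (use s in simp)

lemma bubble_admissible:
  fixes lam gam q :: real
  assumes dim: "2 < CARD('n::finite)" and q: "q = 2 / (real CARD('n) - 2)" and gam: "gam = q * CARD('n)"
    and lam: "lam < 0" and c: "c = 2 * q * (- lam * gam) / CARD('n)"
  shows "admissible lam gam (bubble c (1 / q) :: real^'n \<Rightarrow> real)"
proof -
  have n2: "real CARD('n) - 2 > 0" using dim by simp
  have g: "gam = 2 * q + 2" unfolding gam using n2 by (simp add: q field_simps)
  have q0: "q > 0" using n2 by (simp add: q)
  have c0: "c > 0" unfolding c g using q0 lam dim by (intro divide_pos_pos mult_pos_pos) auto
  define s where "s = 1 / q"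
  have s0: "s > 0" using q0 by (simp add: s_def)
  have "s = (real CARD('n) - 2) / 2" using n2 by (simp add: s_def q)
  then have s: "2 * s + 2 = DIM(real^'n)" by simp
  let ?\<phi> = "bubble c s :: real^'n \<Rightarrow> real"
  let ?v = "\<lambda>x::real^'n. (x \<bullet> x + c) / 2"
  have v: "0 < ?v x" for x using c0 by (simp add: add_nonneg_pos)
  have pde: "laplacian ?\<phi> x - potential_deriv lam gam (?\<phi> x) = 0" for x
  proof -
    have "potential_deriv lam gam (?\<phi> x) = lam * gam * (?v x powr (- s * (2 * q)) * ?v x powr (- s))"
      unfolding potential_deriv_def bubble_def g by (simp add: powr_powr)
    also have "?v x powr (- s * (2 * q)) * ?v x powr (- s) = ?v x powr (- s - 2)"
    proof -
      have "- s * (2 * q) + - s = - s - 2" using q0 by (simp add: s_def)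
      then show ?thesis unfolding powr_add[symmetric] by (rule arg_cong)
    qed
    \<comment> \<open>This is where \<open>c\<close> comes from: \<open>s + 1\<close> is half the
      dimension and \<open>s * q = 1\<close>, so the factors in \<open>c\<close> cancel and leave
      \<open>- lam * gam\<close>.\<close>
    also have "lam * gam = - (s * (s + 1) * c)"
    proof -
      have e: "s + 1 = CARD('n) / 2" using s by simp
      have "s * (s + 1) * c = s * (CARD('n) / 2) * (2 * q * (- lam * gam) / CARD('n))" unfolding e c ..
      also have "\<dots> = (s * q) * (- lam * gam)" using dim by simp
      also have "s * q = 1" using q0 by (simp add: s_def)
      finally show ?thesis by simp
    qed
    finally show ?thesis using bubble_laplacian[OF c0 s, of x] by simp
  qed
  have ipot: "integrable lborel (\<lambda>x. \<bar>?\<phi> x\<bar> powr gam)"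
    unfolding gam s_def bubble_mass[OF c0 q0] using weight_integral_pos(1)[OF c0] by (rule integrable_mult_right)
  have igrad: "integrable lborel (\<lambda>x. (norm (grad ?\<phi> x))\<^sup>2)"
  proof (rule Bochner_Integration.integrable_bound)
    \<comment> \<open>The squared gradient decays like the norm to the power - 2 (n - 1), which is
      integrable exactly because n exceeds 2.\<close>
    have "real CARD('n) < 2 * real (CARD('n) - 1)" using dim by linarith
    then have "integrable lborel (\<lambda>x::real^'n. 1 / ((norm x)\<^sup>2 + c) ^ (CARD('n) - 1))"
      by (rule integrable_inverse_quadratic_power[OF c0])
    then show "integrable lborel (\<lambda>x::real^'n. (s\<^sup>2 * 2 ^ CARD('n)) * (1 / ((norm x)\<^sup>2 + c) ^ (CARD('n) - 1)))"
      by (rule integrable_mult_right)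
    show "(\<lambda>x. (norm (grad ?\<phi> x))\<^sup>2) \<in> borel_measurable lborel"
      using C2_grad_continuous[OF bubble_partials(4)[OF c0], of UNIV s]
      by (auto intro!: borel_measurable_continuous_onI continuous_intros)
    show "AE x in lborel. norm ((norm (grad ?\<phi> x))\<^sup>2) \<le> norm ((s\<^sup>2 * 2 ^ CARD('n)) * (1 / ((norm x)\<^sup>2 + c) ^ (CARD('n) - 1)))"
    proof (rule AE_I2)
      fix x :: "real^'n"
      define y where "y = (norm x)\<^sup>2 + c"
      have y: "0 < y" "?v x = y / 2" "(norm x)\<^sup>2 \<le> y" using c0 v[of x] by (auto simp: y_def dot_square_norm)
      have "(?v x powr (- s - 1))\<^sup>2 = ?v x powr (2 * (- s - 1))"
        using v[of x] by (simp add: power2_eq_square powr_add[symmetric])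
      also have "2 * (- s - 1) = - real CARD('n)" using s by simp
      also have "?v x powr (- real CARD('n)) = 1 / (y / 2) ^ CARD('n)"
        unfolding y(2) using y(1) by (simp add: powr_minus_divide powr_realpow)
      finally have e: "(?v x powr (- s - 1))\<^sup>2 = 2 ^ CARD('n) / y ^ CARD('n)" by (simp add: power_divide)
      have "(norm (grad ?\<phi> x))\<^sup>2 = s\<^sup>2 * (?v x powr (- s - 1))\<^sup>2 * (norm x)\<^sup>2"
        unfolding bubble_partials(3)[OF c0] by (simp add: power_mult_distrib)
      also have "\<dots> \<le> s\<^sup>2 * (2 ^ CARD('n) / y ^ CARD('n)) * y"
        unfolding e using y by (intro mult_left_mono) auto
      also have "\<dots> = (s\<^sup>2 * 2 ^ CARD('n)) * (1 / y ^ (CARD('n) - 1))"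
      proof -
        have "y ^ CARD('n) = y * y ^ (CARD('n) - 1)" using dim by (simp add: power_eq_if)
        then show ?thesis using y by simp
      qed
      finally show "norm ((norm (grad ?\<phi> x))\<^sup>2) \<le> norm ((s\<^sup>2 * 2 ^ CARD('n)) * (1 / ((norm x)\<^sup>2 + c) ^ (CARD('n) - 1)))"
        using y(1) unfolding y_def by simp
    qed
  qed
  have "?\<phi> 0 > 0" using c0 by (simp add: bubble_def)
  then have nz: "?\<phi> \<noteq> (\<lambda>x. 0)" by (metis less_irrefl)
  have "C2 ?\<phi>" "vanishes_at_infinity ?\<phi>"
    by (rule bubble_partials(4)[OF c0], rule bubble_vanishes_at_infinity[OF c0 s0])
  then show ?thesis
    unfolding admissible_def is_solution_def finite_action_def s_def[symmetric]
    using pde ipot igrad nz by (simp add: potential_def)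
qed

theorem mainTheorem1:
  fixes lam gam :: real
  assumes "CARD('n::finite) > 2"
    and "gam = 2 * real CARD('n) / (real CARD('n) - 2)"
    and "lam < 0"
  shows "\<exists>\<phi>0 :: real ^ 'n \<Rightarrow> real.
           admissible lam gam \<phi>0 \<and> monotone_spherical \<phi>0 \<and>
           (\<forall>\<phi> :: real ^ 'n \<Rightarrow> real. admissible lam gam \<phi> \<longrightarrow>
              action lam gam \<phi>0 \<le> action lam gam \<phi> \<and>
              (\<not> monotone_spherical \<phi> \<longrightarrow> action lam gam \<phi>0 < action lam gam \<phi>))"
proof -
  define q where "q = 2 / (real CARD('n) - 2)"
  have gam: "gam = q * CARD('n)" by (simp add: q_def assms(2))
  have q0: "0 < q" using assms(1) by (simp add: q_def)
  \<comment> \<open>This is \<open>c0\<close> of every admissible solution, so all of them, the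
    bubble included, are compared with the same minimal mass.\<close>
  define c where "c = 2 * q * (- lam * gam) / CARD('n)"
  have gam0: "0 < gam" using q0 gam by simp
  have c0: "0 < c" unfolding c_def using q0 gam0 assms(1,3) by (intro divide_pos_pos mult_pos_pos) auto
  let ?M = "2 ^ CARD('n) * (LINT (p::real^'n)|lborel. weight c p)"
  let ?W = "\<lambda>\<phi> :: real^'n \<Rightarrow> real. LINT x|lborel. \<bar>\<phi> x\<bar> powr (q * CARD('n))"
  let ?\<phi>0 = "bubble c (1 / q) :: real^'n \<Rightarrow> real"
  note crit = critical_solution_of_admissible[OF assms(1) q_def gam assms(3)]
  have adm0: "admissible lam gam ?\<phi>0" by (rule bubble_admissible[OF assms(1) q_def gam assms(3) c_def])
  have act: "action lam gam \<phi> = - lam * q * ?W \<phi>" if "admissible lam gam \<phi>" for \<phi>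
    by (rule critical_solution.action_eq_mass[OF crit[OF that] gam refl])
  have W0: "?W ?\<phi>0 = ?M" unfolding bubble_mass[OF c0 q0] by simp
  have lq: "0 < - lam * q" using assms(3) q0 by (simp add: mult_neg_pos)
  have main: "?M \<le> ?W \<phi> \<and> (?W \<phi> = ?M \<longrightarrow> monotone_spherical \<phi>)" if adm: "admissible lam gam \<phi>" for \<phi>
  proof -
    interpret critical_solution \<phi> q "- lam * gam" by (rule crit[OF adm])
    have "min_mass = ?M" unfolding min_mass_def c0_def c_def ..
    then show ?thesis using mass_ge adm by (simp add: admissible_def)
  qed
  show ?thesis
  proof (intro exI[of _ ?\<phi>0] conjI allI impI)
    show "admissible lam gam ?\<phi>0" by (rule adm0)
    show "monotone_spherical ?\<phi>0" using c0 q0 by (intro bubble_monotone_spherical) auto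
    fix \<phi> :: "real^'n \<Rightarrow> real" assume adm: "admissible lam gam \<phi>"
    show "action lam gam ?\<phi>0 \<le> action lam gam \<phi>"
      unfolding act[OF adm0] act[OF adm] W0 using main[OF adm] lq by (intro mult_left_mono) auto
    assume "\<not> monotone_spherical \<phi>"
    then have "?M < ?W \<phi>" using main[OF adm] by (auto simp: less_le)
    then show "action lam gam ?\<phi>0 < action lam gam \<phi>"
      unfolding act[OF adm0] act[OF adm] W0 using lq by (rule mult_strict_left_mono)
  qed
qed

end
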